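(* Let $N,n\ge1$, $\mathfrak{g}=\mathfrak{gl}_N(\mathbb{C})$, $A=\mathbb{C}[t,t^{-1}]$, let $\underline{\lambda}=(\lambda_1,\dots,\lambda_n)$ be dominant integral weights of $\mathfrak{g}$ and $\underline{a}=(a_1,\dots,a_n)$ distinct non-zero complex numbers. Let $V(\underline{\lambda},\underline{a})=\bigoplus_\mu W(\mu)$ be the decomposition of the evaluation module $V(\underline{\lambda},\underline{a})$ into its (non-zero) $\mathfrak{g}$-isotypic components. Then each $W(\mu)$ is an irreducible module for $T\otimes U(\mathfrak{g})$.
   Context: For a dominant integral weight $\lambda$, $V(\lambda)$ denotes the irreducible finite dimensional highest weight $\mathfrak{g}$-module of highest weight $\lambda$. The Lie algebra $\mathfrak{g}\otimes A$ has bracket $[x\otimes a,y\otimes b]=[x,y]\otimes ab$, and $\mathfrak{g}$ is identified with $\mathfrak{g}\otimes1$. The evaluation module $V(\underline{\lambda},\underline{a})$ is the vector space $V(\lambda_1)\otimes\cdots\otimes V(\lambda_n)$ with $\mathfrak{g}\otimes A$ acting by $$(X\otimes t^k)(w_1\otimes\cdots\otimes w_n)=\sum_{i=1}^n a_i^k\,w_1\otimes\cdots\otimes Xw_i\otimes\cdots\otimes w_n,\qquad X\in\mathfrak{g},\ k\in\mathbb{Z},\ w_i\in V(\lambda_i);$$ in particular $\mathfrak{g}$ acts as on the usual tensor product, and the module is completely reducible over $\mathfrak{g}$. The isotypic component $W(\mu)$ is the sum of all $\mathfrak{g}$-submodules isomorphic to $V(\mu)$. Let $E_{ij}$ be the matrix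 units of $\mathfrak{gl}_N$ and $E_{ij}(b)=E_{ij}\otimes b$ for $b\in A$. For $k\ge1$ and $b_1,\dots,b_k\in A$ put $$T_k(b_1,\dots,b_k)=\sum_{(i_1,\dots,i_k)\in\{1,\dots,N\}^k}E_{i_1i_2}(b_1)E_{i_2i_3}(b_2)\cdots E_{i_ki_1}(b_k)\in U(\mathfrak{g}\otimes A).$$ $T$ is the associative subalgebra (with unit) of $U(\mathfrak{g}\otimes A)$ generated by all $T_k(b_1,\dots,b_k)$, $k\ge1$, $b_i\in A$. The elements of $T$ commute with $\mathfrak{g}\otimes1$, and $T\otimes U(\mathfrak{g})$ acts on $V(\underline{\lambda},\underline{a})$ by $(x\otimes u)\cdot w=x(u(w))$, preserving each $W(\mu)$. *)

theory Defs
  imports "HOL-Analysis.Analysis" "HOL-Library.Poly_Mapping" "HOL-Library.Function_Algebras"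
begin

text \<open>All Lie algebras are over the complex numbers.\<close>

class complex_lie_algebra = ab_group_add +
  fixes lscale :: "complex \<Rightarrow> 'a \<Rightarrow> 'a"
    and lie_bracket :: "'a \<Rightarrow> 'a \<Rightarrow> 'a"
  assumes lscale_add_right: "lscale c (x + y) = lscale c x + lscale c y"
    and lscale_add_left: "lscale (c + d) x = lscale c x + lscale d x"
    and lscale_lscale: "lscale c (lscale d x) = lscale (c * d) x"
    and lscale_one: "lscale 1 x = x"
    and bracket_add_left: "lie_bracket (x + y) z = lie_bracket x z + lie_bracket y z"
    and bracket_add_right: "lie_bracket z (x + y) = lie_bracket z x + lie_bracket z y"
    and bracket_lscale_left: "lie_bracket (lscale c x) y = lscale c (lie_bracket x y)"
    and bracket_lscale_right: "lie_bracket x (lscale c y) = lscale c (lie_bracket x y)"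
    and bracket_self: "lie_bracket x x = 0"
    and bracket_jacobi: "lie_bracket x (lie_bracket y z) + lie_bracket y (lie_bracket z x)
                           + lie_bracket z (lie_bracket x y) = 0"

text \<open>Commutative associative unital complex algebras, given by their structure map.\<close>

class complex_comm_algebra = comm_ring_1 +
  fixes of_C :: "complex \<Rightarrow> 'a"
  assumes of_C_one: "of_C 1 = 1"
    and of_C_add: "of_C (c + d) = of_C c + of_C d"
    and of_C_mult: "of_C (c * d) = of_C c * of_C d"

instantiation complex :: complex_comm_algebra
begin
definition of_C_complex :: "complex \<Rightarrow> complex" where "of_C_complex c = c"
instance by standard (simp_all add: of_C_complex_def)
end

instantiation poly_mapping :: (comm_monoid_add, complex_comm_algebra) complex_comm_algebra
begin
definition of_C_poly_mapping :: "complex \<Rightarrow> 'a \<Rightarrow>\<^sub>0 'b" where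
  "of_C_poly_mapping c = Poly_Mapping.single 0 (of_C c)"
instance
  by standard (simp_all add: of_C_poly_mapping_def of_C_one of_C_add of_C_mult single_add mult_single)
end

text \<open>The algebra of Laurent polynomials is the group algebra of the integers;
  \<open>t\<^sup>k\<close> is \<open>Poly_Mapping.single k 1\<close>.\<close>

type_synonym laurent = "int \<Rightarrow>\<^sub>0 complex"

text \<open>\<open>(R, n) gl\<close> is the complex Lie algebra of square matrices over \<open>R\<close> with rows and columns
  indexed by \<open>n\<close>. For \<open>R\<close> the complex numbers it is \<open>gl\<^sub>N\<close>, \<open>N = CARD(n)\<close>; for a commutative
  algebra \<open>R\<close> it is \<open>gl\<^sub>N \<otimes> R\<close>, with \<open>X \<otimes> b\<close> the matrix \<open>gl_tensor X b\<close> below.\<close>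

typedef ('r, 'n::finite) gl = "UNIV :: ('r ^ 'n ^ 'n) set"
  morphisms mat_of_gl gl_of_mat by simp

setup_lifting type_definition_gl

instantiation gl :: (complex_comm_algebra, finite) complex_lie_algebra
begin

lift_definition zero_gl :: "('a, 'b) gl" is 0 .
lift_definition plus_gl :: "('a, 'b) gl \<Rightarrow> ('a, 'b) gl \<Rightarrow> ('a, 'b) gl" is "(+)" .
lift_definition minus_gl :: "('a, 'b) gl \<Rightarrow> ('a, 'b) gl \<Rightarrow> ('a, 'b) gl" is "(-)" .
lift_definition uminus_gl :: "('a, 'b) gl \<Rightarrow> ('a, 'b) gl" is uminus .
lift_definition lscale_gl :: "complex \<Rightarrow> ('a, 'b) gl \<Rightarrow> ('a, 'b) gl"
  is "\<lambda>c M. \<chi> i j. of_C c * M $ i $ j" .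
lift_definition lie_bracket_gl :: "('a, 'b) gl \<Rightarrow> ('a, 'b) gl \<Rightarrow> ('a, 'b) gl"
  is "\<lambda>M M'. M ** M' - M' ** M" .

instance
proof
  fix x y z :: "('a, 'b) gl" and c d :: complex
  have diff_l: "A ** (B - C) = A ** B - A ** C" and diff_r: "(B - C) ** A = B ** A - C ** A"
    for A B C :: "'a ^ 'b ^ 'b"
    by (simp_all add: matrix_matrix_mult_def vec_eq_iff algebra_simps sum_subtractf)
  have add_l: "A ** (B + C) = A ** B + A ** C" and add_r: "(B + C) ** A = B ** A + C ** A"
    for A B C :: "'a ^ 'b ^ 'b"
    by (simp_all add: matrix_matrix_mult_def vec_eq_iff algebra_simps sum.distrib)
  show "x + y + z = x + (y + z)" by transfer (simp add: add.assoc)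
  show "x + y = y + x" by transfer (simp add: add.commute)
  show "0 + x = x" by transfer simp
  show "- x + x = 0" by transfer simp
  show "x - y = x + - y" by transfer simp
  show "lscale c (x + y) = lscale c x + lscale c y"
    by transfer (simp add: vec_eq_iff algebra_simps)
  show "lscale (c + d) x = lscale c x + lscale d x"
    by transfer (simp add: vec_eq_iff algebra_simps of_C_add)
  show "lscale c (lscale d x) = lscale (c * d) x"
    by transfer (simp add: vec_eq_iff algebra_simps of_C_mult)
  show "lscale 1 x = x" by transfer (simp add: vec_eq_iff of_C_one)
  show "lie_bracket (x + y) z = lie_bracket x z + lie_bracket y z"
    by transfer (simp add: add_l add_r)
  show "lie_bracket z (x + y) = lie_bracket z x + lie_bracket z y"
    by transfer (simp add: add_l add_r)
  show "lie_bracket (lscale c x) y = lscale c (lie_bracket x y)"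
    by transfer (simp add: vec_eq_iff matrix_matrix_mult_def sum_distrib_left algebra_simps)
  show "lie_bracket x (lscale c y) = lscale c (lie_bracket x y)"
    by transfer (simp add: vec_eq_iff matrix_matrix_mult_def sum_distrib_left algebra_simps)
  show "lie_bracket x x = 0" by transfer simp
  show "lie_bracket x (lie_bracket y z) + lie_bracket y (lie_bracket z x)
          + lie_bracket z (lie_bracket x y) = 0"
    by transfer (simp add: diff_l diff_r matrix_mul_assoc)
qed

end

lift_definition gl_unit :: "'n \<Rightarrow> 'n \<Rightarrow> (complex, 'n::finite) gl"
  is "\<lambda>i j. \<chi> k l. if k = i \<and> l = j then 1 else 0" .

lift_definition gl_tensor :: "(complex, 'n::finite) gl \<Rightarrow> 'r::complex_comm_algebra \<Rightarrow> ('r, 'n) gl"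
  is "\<lambda>X b. \<chi> i j. of_C (X $ i $ j) * b" .

lemma of_C_zero: "of_C 0 = (0 :: 'r::complex_comm_algebra)"
  using of_C_add[of 0 0, where ?'a = 'r] by simp

lemma of_C_diff: "of_C (c - d) = (of_C c - of_C d :: 'r::complex_comm_algebra)"
  using of_C_add[of "c - d" d, where ?'a = 'r] by (simp add: algebra_simps)

lemma of_C_sum: "of_C (sum f A) = (\<Sum>x\<in>A. of_C (f x) :: 'r::complex_comm_algebra)"
  by (induction A rule: infinite_finite_induct) (simp_all add: of_C_zero of_C_add)

lemma bracket_gl_tensor:
  fixes a b :: "'r::complex_comm_algebra"
  shows "lie_bracket (gl_tensor X a) (gl_tensor Y b) = gl_tensor (lie_bracket X Y) (a * b)"
  by transfer
    (simp add: vec_eq_iff matrix_matrix_mult_def of_C_diff of_C_sum of_C_mult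
      left_diff_distrib right_diff_distrib sum_distrib_left sum_distrib_right ac_simps)

lemma gl_tensor_one:
  fixes X Y :: "(complex, 'n::finite) gl"
  shows "gl_tensor (X + Y) 1 = (gl_tensor X 1 + gl_tensor Y 1 :: ('r::complex_comm_algebra, 'n) gl)"
    and "gl_tensor (lscale c X) 1 = (lscale c (gl_tensor X 1) :: ('r, 'n) gl)"
    and "gl_tensor (lie_bracket X Y) 1 = (lie_bracket (gl_tensor X 1) (gl_tensor Y 1) :: ('r, 'n) gl)"
  by (simp_all add: bracket_gl_tensor)
    (simp_all add: mat_of_gl_inject[symmetric] gl_tensor.rep_eq plus_gl.rep_eq lscale_gl.rep_eq
      vec_eq_iff of_C_add of_C_mult of_C_complex_def)



text \<open>The universal enveloping algebra: the free associative algebra on the set \<open>L\<close>, i.e. the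
  monoid algebra of the words over \<open>L\<close>, modulo the two-sided ideal making the inclusion of
  generators linear and a homomorphism for the commutator bracket. The wrapper type \<open>word\<close>
  carries concatenation as \<open>(+)\<close>, which is what the multiplication of \<open>poly_mapping\<close> uses.\<close>

datatype 'l word = Word (letters: "'l list")

instantiation word :: (type) monoid_add
begin
definition zero_word :: "'a word" where "zero_word = Word []"
definition plus_word :: "'a word \<Rightarrow> 'a word \<Rightarrow> 'a word" where
  "plus_word u v = Word (letters u @ letters v)"
instance by standard (simp_all add: zero_word_def plus_word_def)
end

abbreviation free_gen :: "'l \<Rightarrow> ('l word \<Rightarrow>\<^sub>0 complex)" where
  "free_gen x \<equiv> Poly_Mapping.single (Word [x]) 1"

abbreviation free_const :: "complex \<Rightarrow> ('l word \<Rightarrow>\<^sub>0 complex)" where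
  "free_const c \<equiv> Poly_Mapping.single 0 c"

inductive_set uea_ideal :: "('l::complex_lie_algebra word \<Rightarrow>\<^sub>0 complex) set" where
  uea_ideal_gen_add: "free_gen (x + y) - free_gen x - free_gen y \<in> uea_ideal"
| uea_ideal_gen_scale: "free_gen (lscale c x) - free_const c * free_gen x \<in> uea_ideal"
| uea_ideal_gen_bracket:
    "free_gen x * free_gen y - free_gen y * free_gen x - free_gen (lie_bracket x y) \<in> uea_ideal"
| uea_ideal_add: "p \<in> uea_ideal \<Longrightarrow> q \<in> uea_ideal \<Longrightarrow> p + q \<in> uea_ideal"
| uea_ideal_mult_left: "p \<in> uea_ideal \<Longrightarrow> r * p \<in> uea_ideal"
| uea_ideal_mult_right: "p \<in> uea_ideal \<Longrightarrow> p * r \<in> uea_ideal"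

lemma uea_ideal_zero: "0 \<in> uea_ideal"
  using uea_ideal_mult_left[OF uea_ideal_gen_add, of 0] by simp

lemma uea_ideal_uminus: "p \<in> uea_ideal \<Longrightarrow> - p \<in> uea_ideal"
  using uea_ideal_mult_left[of p "- 1"] by simp

lemma uea_ideal_diff: "p \<in> uea_ideal \<Longrightarrow> q \<in> uea_ideal \<Longrightarrow> p - q \<in> uea_ideal"
  using uea_ideal_add[OF _ uea_ideal_uminus, of p q] by simp

definition uea_rel ::
  "('l::complex_lie_algebra word \<Rightarrow>\<^sub>0 complex) \<Rightarrow> ('l word \<Rightarrow>\<^sub>0 complex) \<Rightarrow> bool" where
  "uea_rel p q \<longleftrightarrow> p - q \<in> uea_ideal"

lemma equivp_uea_rel: "equivp uea_rel"
proof (rule equivpI)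
  show "reflp uea_rel" by (simp add: reflp_def uea_rel_def uea_ideal_zero)
  show "symp uea_rel" unfolding symp_def uea_rel_def
    using uea_ideal_uminus by fastforce
  show "transp uea_rel" unfolding transp_def uea_rel_def
    using uea_ideal_add by fastforce
qed

lemma counit_mult:
  fixes p q :: "'l word \<Rightarrow>\<^sub>0 complex"
  shows "Poly_Mapping.lookup (p * q) 0 = Poly_Mapping.lookup p 0 * Poly_Mapping.lookup q 0"
proof -
  have *: "(0 = l + q) \<longleftrightarrow> l = 0 \<and> q = 0" for l q :: "'l word"
    by (cases l; cases q) (auto simp: zero_word_def plus_word_def)
  have "Poly_Mapping.lookup (p * q) 0
      = (\<Sum>l. Poly_Mapping.lookup p l * (\<Sum>r. Poly_Mapping.lookup q r when 0 = l + r))"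
    by (simp add: lookup_mult)
  also have "\<dots> = (\<Sum>l. Poly_Mapping.lookup p l * Poly_Mapping.lookup q 0 when l = 0)"
  proof (rule Sum_any.cong)
    fix l
    show "Poly_Mapping.lookup p l * (\<Sum>r. Poly_Mapping.lookup q r when 0 = l + r)
        = (Poly_Mapping.lookup p l * Poly_Mapping.lookup q 0 when l = 0)"
      by (cases "l = 0") (simp_all add: * )
  qed
  also have "\<dots> = Poly_Mapping.lookup p 0 * Poly_Mapping.lookup q 0" by simp
  finally show ?thesis .
qed

lemma counit_free_gen: "Poly_Mapping.lookup (free_gen x) 0 = 0"
  by (simp add: lookup_single zero_word_def)

lemma counit_uea_ideal: "p \<in> uea_ideal \<Longrightarrow> Poly_Mapping.lookup p 0 = 0"
proof (induction rule: uea_ideal.induct)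
qed (simp_all add: lookup_minus lookup_add counit_mult counit_free_gen)

quotient_type (overloaded) 'l uea = "'l::complex_lie_algebra word \<Rightarrow>\<^sub>0 complex" / uea_rel
  by (rule equivp_uea_rel)

instantiation uea :: (complex_lie_algebra) ring_1
begin

lift_definition zero_uea :: "'a uea" is 0 .
lift_definition one_uea :: "'a uea" is 1 .
lift_definition plus_uea :: "'a uea \<Rightarrow> 'a uea \<Rightarrow> 'a uea" is "(+)"
proof -
  fix p p' q q' :: "'a word \<Rightarrow>\<^sub>0 complex"
  assume "uea_rel p p'" "uea_rel q q'"
  then show "uea_rel (p + q) (p' + q')"
    unfolding uea_rel_def add_diff_add by (rule uea_ideal_add)
qed
lift_definition minus_uea :: "'a uea \<Rightarrow> 'a uea \<Rightarrow> 'a uea" is "(-)"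
proof -
  fix p p' q q' :: "'a word \<Rightarrow>\<^sub>0 complex"
  assume "uea_rel p p'" "uea_rel q q'"
  then have "(p - p') - (q - q') \<in> uea_ideal"
    unfolding uea_rel_def by (rule uea_ideal_diff)
  then show "uea_rel (p - q) (p' - q')" by (simp add: uea_rel_def algebra_simps)
qed
lift_definition uminus_uea :: "'a uea \<Rightarrow> 'a uea" is uminus
proof -
  fix p p' :: "'a word \<Rightarrow>\<^sub>0 complex"
  assume "uea_rel p p'"
  then have "- (p - p') \<in> uea_ideal"
    unfolding uea_rel_def by (rule uea_ideal_uminus)
  then show "uea_rel (- p) (- p')" by (simp add: uea_rel_def)
qed
lift_definition times_uea :: "'a uea \<Rightarrow> 'a uea \<Rightarrow> 'a uea" is "(*)"
proof -
  fix p p' q q' :: "'a word \<Rightarrow>\<^sub>0 complex"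
  assume "uea_rel p p'" "uea_rel q q'"
  then have "(p - p') * q + p' * (q - q') \<in> uea_ideal"
    unfolding uea_rel_def by (intro uea_ideal_add uea_ideal_mult_left uea_ideal_mult_right)
  then show "uea_rel (p * q) (p' * q')" by (simp add: uea_rel_def algebra_simps)
qed

instance
proof
  have eq: "p = q \<Longrightarrow> uea_rel p q" for p q :: "'a word \<Rightarrow>\<^sub>0 complex"
    by (simp add: uea_rel_def uea_ideal_zero)
  fix x y z :: "'a uea"
  show "x + y + z = x + (y + z)" by transfer (simp add: eq add.assoc)
  show "x + y = y + x" by transfer (simp add: eq add.commute)
  show "0 + x = x" by transfer (simp add: eq)
  show "- x + x = 0" by transfer (simp add: eq)
  show "x - y = x + - y" by transfer (simp add: eq)
  show "x * y * z = x * (y * z)" by transfer (simp add: eq mult.assoc)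
  show "(x + y) * z = x * z + y * z" by transfer (simp add: eq distrib_right)
  show "x * (y + z) = x * y + x * z" by transfer (simp add: eq distrib_left)
  show "1 * x = x" by transfer (simp add: eq)
  show "x * 1 = x" by transfer (simp add: eq)
  show "(0::'a uea) \<noteq> 1"
  proof transfer
    show "\<not> uea_rel (0 :: 'a word \<Rightarrow>\<^sub>0 complex) 1"
      using counit_uea_ideal[of "- 1"] by (auto simp: uea_rel_def lookup_minus)
  qed
qed

end

lift_definition uea_gen :: "'l::complex_lie_algebra \<Rightarrow> 'l uea" is free_gen .
lift_definition uea_const :: "complex \<Rightarrow> 'l::complex_lie_algebra uea" is free_const .

inductive_set subalgebra_generated ::
  "'l::complex_lie_algebra uea set \<Rightarrow> 'l uea set" for G where
  subalgebra_gen: "x \<in> G \<Longrightarrow> x \<in> subalgebra_generated G"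
| subalgebra_const: "uea_const c \<in> subalgebra_generated G"
| subalgebra_add:
    "x \<in> subalgebra_generated G \<Longrightarrow> y \<in> subalgebra_generated G \<Longrightarrow> x + y \<in> subalgebra_generated G"
| subalgebra_mult:
    "x \<in> subalgebra_generated G \<Longrightarrow> y \<in> subalgebra_generated G \<Longrightarrow> x * y \<in> subalgebra_generated G"

text \<open>\<open>T\<^sub>k(b\<^sub>1, \<dots>, b\<^sub>k)\<close> with \<open>bs = [b\<^sub>1, \<dots>, b\<^sub>k]\<close>; the index after the last one is the first.\<close>

definition trace_elt :: "laurent list \<Rightarrow> (laurent, 'n::finite) gl uea" where
  "trace_elt bs =
    (\<Sum>is\<in>{is. length is = length bs}.
      \<Prod>j\<leftarrow>[0..<length bs].
        uea_gen (gl_tensor (gl_unit (is ! j) (is ! (Suc j mod length bs))) (bs ! j)))"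

definition trace_alg :: "(laurent, 'n::finite) gl uea set" where
  "trace_alg = subalgebra_generated {trace_elt bs | bs. bs \<noteq> []}"


text \<open>A module is a subspace \<open>V\<close> of an ambient complex vector space with scalar multiplication
  \<open>s\<close>; only the values of an action on \<open>V\<close> are relevant.\<close>

definition lie_module ::
  "(complex \<Rightarrow> 'v::ab_group_add \<Rightarrow> 'v) \<Rightarrow> 'v set \<Rightarrow> ('l::complex_lie_algebra \<Rightarrow> 'v \<Rightarrow> 'v) \<Rightarrow> bool" where
  "lie_module s V \<rho> \<longleftrightarrow> vector_space s \<and> module.subspace s V \<and>
    (\<forall>x. \<forall>v\<in>V. \<rho> x v \<in> V) \<and>
    (\<forall>x. \<forall>v\<in>V. \<forall>w\<in>V. \<rho> x (v + w) = \<rho> x v + \<rho> x w) \<and>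
    (\<forall>x c. \<forall>v\<in>V. \<rho> x (s c v) = s c (\<rho> x v)) \<and>
    (\<forall>x y. \<forall>v\<in>V. \<rho> (x + y) v = \<rho> x v + \<rho> y v) \<and>
    (\<forall>c x. \<forall>v\<in>V. \<rho> (lscale c x) v = s c (\<rho> x v)) \<and>
    (\<forall>x y. \<forall>v\<in>V. \<rho> (lie_bracket x y) v = \<rho> x (\<rho> y v) - \<rho> y (\<rho> x v))"

definition lie_submodule ::
  "(complex \<Rightarrow> 'v::ab_group_add \<Rightarrow> 'v) \<Rightarrow> 'v set \<Rightarrow> ('l \<Rightarrow> 'v \<Rightarrow> 'v) \<Rightarrow> 'v set \<Rightarrow> bool" where
  "lie_submodule s V \<rho> S \<longleftrightarrow> module.subspace s S \<and> S \<subseteq> V \<and> (\<forall>x. \<forall>v\<in>S. \<rho> x v \<in> S)"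

definition irreducible_lie_module ::
  "(complex \<Rightarrow> 'v::ab_group_add \<Rightarrow> 'v) \<Rightarrow> 'v set \<Rightarrow> ('l::complex_lie_algebra \<Rightarrow> 'v \<Rightarrow> 'v) \<Rightarrow> bool" where
  "irreducible_lie_module s V \<rho> \<longleftrightarrow> lie_module s V \<rho> \<and> V \<noteq> {0} \<and>
    (\<forall>S. lie_submodule s V \<rho> S \<longrightarrow> S = {0} \<or> S = V)"

definition lie_module_iso ::
  "(complex \<Rightarrow> 'v::ab_group_add \<Rightarrow> 'v) \<Rightarrow> 'v set \<Rightarrow> ('l \<Rightarrow> 'v \<Rightarrow> 'v) \<Rightarrow>
   (complex \<Rightarrow> 'w::ab_group_add \<Rightarrow> 'w) \<Rightarrow> 'w set \<Rightarrow> ('l \<Rightarrow> 'w \<Rightarrow> 'w) \<Rightarrow> bool" where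
  "lie_module_iso s V \<rho> s' V' \<rho>' \<longleftrightarrow> (\<exists>\<phi>. bij_betw \<phi> V V' \<and>
    (\<forall>v\<in>V. \<forall>w\<in>V. \<phi> (v + w) = \<phi> v + \<phi> w) \<and>
    (\<forall>c. \<forall>v\<in>V. \<phi> (s c v) = s' c (\<phi> v)) \<and>
    (\<forall>x. \<forall>v\<in>V. \<phi> (\<rho> x v) = \<rho>' x (\<phi> v)))"

definition isotypic_component ::
  "(complex \<Rightarrow> 'v::ab_group_add \<Rightarrow> 'v) \<Rightarrow> 'v set \<Rightarrow> ('l \<Rightarrow> 'v \<Rightarrow> 'v) \<Rightarrow>
   (complex \<Rightarrow> 'w::ab_group_add \<Rightarrow> 'w) \<Rightarrow> 'w set \<Rightarrow> ('l \<Rightarrow> 'w \<Rightarrow> 'w) \<Rightarrow> 'v set" where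
  "isotypic_component s V \<rho> s' M \<sigma> =
    module.span s (\<Union>{S. lie_submodule s V \<rho> S \<and> lie_module_iso s' M \<sigma> s S \<rho>})"

text \<open>A weight is given by its values on the diagonal matrix units \<open>E\<^sub>i\<^sub>i\<close>, and the positive root
  vectors are the \<open>E\<^sub>i\<^sub>j\<close> with \<open>i < j\<close>; dominant integrality is the condition that the values on
  the coroots \<open>E\<^sub>i\<^sub>i - E\<^sub>j\<^sub>j\<close>, \<open>i < j\<close>, are natural numbers.\<close>

definition dominant_integral :: "('n::{finite,linorder} \<Rightarrow> complex) \<Rightarrow> bool" where
  "dominant_integral lam \<longleftrightarrow> (\<forall>i j. i < j \<longrightarrow> lam i - lam j \<in> \<nat>)"

text \<open>\<open>(V, \<rho>)\<close> is a model of \<open>V(\<lambda>)\<close>. By irreducibility the highest weight vector generates \<open>V\<close>.\<close>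

definition is_highest_weight_irrep ::
  "(complex \<Rightarrow> 'v::ab_group_add \<Rightarrow> 'v) \<Rightarrow> 'v set \<Rightarrow>
   ((complex, 'n::{finite,linorder}) gl \<Rightarrow> 'v \<Rightarrow> 'v) \<Rightarrow> ('n \<Rightarrow> complex) \<Rightarrow> bool" where
  "is_highest_weight_irrep s V \<rho> lam \<longleftrightarrow>
    irreducible_lie_module s V \<rho> \<and>
    (\<exists>B. finite B \<and> module.span s B = V) \<and>
    (\<exists>v\<in>V. v \<noteq> 0 \<and> (\<forall>i j. i < j \<longrightarrow> \<rho> (gl_unit i j) v = 0) \<and>
      (\<forall>i. \<rho> (gl_unit i i) v = s (lam i) v))"

text \<open>The action of the enveloping algebra on a module. The choice of a representative in the free
  algebra is immaterial: see \<open>uea_act_abs\<close>.\<close>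

definition free_act ::
  "(complex \<Rightarrow> 'v::ab_group_add \<Rightarrow> 'v) \<Rightarrow> ('l \<Rightarrow> 'v \<Rightarrow> 'v) \<Rightarrow> ('l word \<Rightarrow>\<^sub>0 complex) \<Rightarrow> 'v \<Rightarrow> 'v" where
  "free_act s \<rho> p v =
    (\<Sum>w\<in>Poly_Mapping.keys p. s (Poly_Mapping.lookup p w) (foldr \<rho> (letters w) v))"

definition uea_act ::
  "(complex \<Rightarrow> 'v::ab_group_add \<Rightarrow> 'v) \<Rightarrow> ('l::complex_lie_algebra \<Rightarrow> 'v \<Rightarrow> 'v) \<Rightarrow> 'l uea \<Rightarrow> 'v \<Rightarrow> 'v" where
  "uea_act s \<rho> u v = free_act s \<rho> (rep_uea u) v"


lemma free_act_superset:
  assumes "vector_space s" "finite K" "Poly_Mapping.keys p \<subseteq> K"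
  shows "free_act s \<rho> p v = (\<Sum>w\<in>K. s (Poly_Mapping.lookup p w) (foldr \<rho> (letters w) v))"
proof -
  interpret vector_space s by fact
  show ?thesis unfolding free_act_def
    using assms by (intro sum.mono_neutral_left) (auto simp: in_keys_iff)
qed

lemma free_act_add:
  assumes "vector_space s"
  shows "free_act s \<rho> (p + q) v = free_act s \<rho> p v + free_act s \<rho> q v"
proof -
  interpret vector_space s by fact
  let ?K = "Poly_Mapping.keys p \<union> Poly_Mapping.keys q"
  have "Poly_Mapping.keys (p + q) \<subseteq> ?K" by (rule keys_add)
  then show ?thesis
    by (simp add: free_act_superset[OF assms, of ?K] lookup_add scale_left_distrib sum.distrib)
qed

lemma free_act_zero: "free_act s \<rho> 0 v = 0"
  by (simp add: free_act_def)

lemma free_act_single: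
  assumes "vector_space s"
  shows "free_act s \<rho> (Poly_Mapping.single w c) v = s c (foldr \<rho> (letters w) v)"
  using free_act_superset[OF assms, of "{w}" "Poly_Mapping.single w c"] by simp

lemma free_act_diff:
  assumes "vector_space s"
  shows "free_act s \<rho> (p - q) v = free_act s \<rho> p v - free_act s \<rho> q v"
  using free_act_add[OF assms, of \<rho> "p - q" q v] by simp

lemma poly_mapping_single_induct [case_names zero add]:
  assumes "P 0" and "\<And>p k c. P p \<Longrightarrow> P (p + Poly_Mapping.single k c)"
  shows "P (p :: 'a \<Rightarrow>\<^sub>0 'b::comm_monoid_add)"
proof (induction p rule: update_induct)
  case const then show ?case by (rule assms(1))
next
  case (update f a b)
  have "Poly_Mapping.update a b f = f + Poly_Mapping.single a b"
    using update(1) by (intro poly_mapping_eqI) (auto simp: lookup_update lookup_add lookup_single in_keys_iff)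
  then show ?case using assms(2)[OF update(3)] by simp
qed

context
  fixes s :: "complex \<Rightarrow> 'v::ab_group_add \<Rightarrow> 'v" and V
    and \<rho> :: "'l::complex_lie_algebra \<Rightarrow> 'v \<Rightarrow> 'v"
  assumes mod: "lie_module s V \<rho>"
begin

interpretation vector_space s using mod by (simp add: lie_module_def)

lemma foldr_act_in: "v \<in> V \<Longrightarrow> foldr \<rho> xs v \<in> V"
  using mod by (induction xs) (auto simp: lie_module_def)

lemma foldr_act_lin:
  assumes "v \<in> V" "w \<in> V"
  shows "foldr \<rho> xs (v + w) = foldr \<rho> xs v + foldr \<rho> xs w"
    and "foldr \<rho> xs (s c v) = s c (foldr \<rho> xs v)"
  using assms mod by (induction xs) (auto simp: lie_module_def foldr_act_in)

lemma free_act_in: "v \<in> V \<Longrightarrow> free_act s \<rho> p v \<in> V"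
  unfolding free_act_def using mod
  by (intro subspace_sum subspace_scale) (auto simp: lie_module_def foldr_act_in)

lemma foldr_act_zero: "foldr \<rho> xs 0 = 0"
  using foldr_act_lin(2)[of 0 0 xs 0] mod by (auto simp: lie_module_def dest: subspace_0)

lemma foldr_free_act:
  assumes "v \<in> V"
  shows "foldr \<rho> xs (free_act s \<rho> q v) = free_act s \<rho> (Poly_Mapping.single (Word xs) 1 * q) v"
proof (induction q rule: poly_mapping_single_induct)
  case zero then show ?case by (simp add: free_act_zero foldr_act_zero)
next
  case (add p k c)
  have "s c (foldr \<rho> (letters k) v) \<in> V"
    using mod assms by (auto simp: lie_module_def foldr_act_in intro: subspace_scale)
  then show ?case using add assms
    by (simp add: free_act_add[OF vector_space_axioms] free_act_single[OF vector_space_axioms]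
        free_act_in foldr_act_in foldr_act_lin distrib_left mult_single plus_word_def)
qed

lemma free_act_const_mult: "free_act s \<rho> (Poly_Mapping.single k c * q) v
    = s c (free_act s \<rho> (Poly_Mapping.single k 1 * q) v)"
  by (induction q rule: poly_mapping_single_induct)
    (simp_all add: free_act_zero free_act_add[OF vector_space_axioms]
      free_act_single[OF vector_space_axioms] distrib_left mult_single scale_right_distrib)

lemma free_act_mult:
  assumes "v \<in> V"
  shows "free_act s \<rho> (p * q) v = free_act s \<rho> p (free_act s \<rho> q v)"
proof (induction p rule: poly_mapping_single_induct)
  case zero then show ?case by (simp add: free_act_zero)
next
  case (add p k c)
  have "free_act s \<rho> (Poly_Mapping.single k c * q) v = s c (foldr \<rho> (letters k) (free_act s \<rho> q v))"
    by (simp add: foldr_free_act[OF assms] free_act_const_mult[of k c])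
  then show ?case using add
    by (simp add: free_act_add[OF vector_space_axioms] free_act_single[OF vector_space_axioms]
        distrib_right)
qed

lemma free_act_uea_ideal: "p \<in> uea_ideal \<Longrightarrow> \<forall>v\<in>V. free_act s \<rho> p v = 0"
proof (induction rule: uea_ideal.induct)
  case (uea_ideal_gen_add x y)
  then show ?case using mod
    by (auto simp: free_act_diff[OF vector_space_axioms] free_act_single[OF vector_space_axioms] lie_module_def)
next
  case (uea_ideal_gen_scale c x)
  then show ?case using mod
    by (auto simp: free_act_diff[OF vector_space_axioms] free_act_single[OF vector_space_axioms]
        lie_module_def mult_single)
next
  case (uea_ideal_gen_bracket x y)
  then show ?case using mod
    by (auto simp: free_act_diff[OF vector_space_axioms] free_act_single[OF vector_space_axioms]
        lie_module_def mult_single plus_word_def)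
next
  case (uea_ideal_add p q)
  then show ?case by (simp add: free_act_add[OF vector_space_axioms])
next
  case (uea_ideal_mult_left p r)
  then show ?case using free_act_zero mod
    by (simp add: free_act_mult) (simp add: free_act_def foldr_act_zero)
next
  case (uea_ideal_mult_right p r)
  then show ?case by (simp add: free_act_mult free_act_in)
qed

lemma uea_act_abs: "v \<in> V \<Longrightarrow> uea_act s \<rho> (abs_uea p) v = free_act s \<rho> p v"
  using free_act_uea_ideal[of "rep_uea (abs_uea p) - p"]
    Quotient3_rep_abs[OF Quotient3_uea, of p]
    free_act_diff[OF vector_space_axioms, of \<rho> "rep_uea (abs_uea p)" p v]
  by (simp add: uea_act_def uea_rel_def uea_ideal_zero)

lemma abs_rep_uea: "abs_uea (rep_uea u) = u"
  by (rule Quotient3_abs_rep[OF Quotient3_uea])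

lemma uea_act_in: "v \<in> V \<Longrightarrow> uea_act s \<rho> u v \<in> V"
  by (simp add: uea_act_def free_act_in)

lemma uea_act_gen: "v \<in> V \<Longrightarrow> uea_act s \<rho> (uea_gen x) v = \<rho> x v"
  by (simp add: uea_gen_def uea_act_abs free_act_single[OF vector_space_axioms])

lemma uea_act_const: "v \<in> V \<Longrightarrow> uea_act s \<rho> (uea_const c) v = s c v"
  by (simp add: uea_const_def uea_act_abs free_act_single[OF vector_space_axioms] zero_word_def)

lemma uea_act_add: "v \<in> V \<Longrightarrow> uea_act s \<rho> (x + y) v = uea_act s \<rho> x v + uea_act s \<rho> y v"
  using uea_act_abs[of v "rep_uea x + rep_uea y"]
  by (simp add: plus_uea.abs_eq[symmetric] abs_rep_uea uea_act_def free_act_add[OF vector_space_axioms])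

lemma uea_act_mult: "v \<in> V \<Longrightarrow> uea_act s \<rho> (x * y) v = uea_act s \<rho> x (uea_act s \<rho> y v)"
  using uea_act_abs[of v "rep_uea x * rep_uea y"]
  by (simp add: times_uea.abs_eq[symmetric] abs_rep_uea uea_act_def free_act_mult)

end


definition fun_scale :: "complex \<Rightarrow> ('a \<Rightarrow> complex) \<Rightarrow> 'a \<Rightarrow> complex" where
  "fun_scale c F = (\<lambda>x. c * F x)"

lemma vector_space_fun_scale: "vector_space fun_scale"
  by unfold_locales (simp_all add: fun_scale_def fun_eq_iff algebra_simps)

definition multilinear_form ::
  "(complex \<Rightarrow> 'v::ab_group_add \<Rightarrow> 'v) \<Rightarrow> ('m \<Rightarrow> 'v set) \<Rightarrow> (('m \<Rightarrow> 'v) \<Rightarrow> complex) \<Rightarrow> bool" where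
  "multilinear_form s V f \<longleftrightarrow>
    (\<forall>w i. (\<forall>j. w j \<in> V j) \<longrightarrow>
      (\<forall>x\<in>V i. \<forall>y\<in>V i. f (w(i := x + y)) = f (w(i := x)) + f (w(i := y))) \<and>
      (\<forall>c. \<forall>x\<in>V i. f (w(i := s c x)) = c * f (w(i := x))))"

text \<open>The tensor product \<open>\<Otimes>\<^sub>i V\<^sub>i\<close> is realised inside the dual of the space of multilinear
  forms: the pure tensor of a family \<open>w\<close> is evaluation at \<open>w\<close>. A multilinear form \<open>f\<close> factors
  through the linear form \<open>F \<mapsto> F f\<close>, which is the universal property.\<close>

definition pure_tensor ::
  "(complex \<Rightarrow> 'v::ab_group_add \<Rightarrow> 'v) \<Rightarrow> ('m \<Rightarrow> 'v set) \<Rightarrow> ('m \<Rightarrow> 'v) \<Rightarrow> (('m \<Rightarrow> 'v) \<Rightarrow> complex) \<Rightarrow> complex" where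
  "pure_tensor s V w = (\<lambda>f. if multilinear_form s V f then f w else 0)"

definition tensor_product ::
  "(complex \<Rightarrow> 'v::ab_group_add \<Rightarrow> 'v) \<Rightarrow> ('m \<Rightarrow> 'v set) \<Rightarrow> ((('m \<Rightarrow> 'v) \<Rightarrow> complex) \<Rightarrow> complex) set" where
  "tensor_product s V = module.span fun_scale {pure_tensor s V w | w. \<forall>i. w i \<in> V i}"

definition laurent_eval :: "complex \<Rightarrow> laurent \<Rightarrow> complex" where
  "laurent_eval a b = (\<Sum>k\<in>Poly_Mapping.keys b. Poly_Mapping.lookup b k * a powi k)"

lift_definition gl_eval :: "complex \<Rightarrow> (laurent, 'n::finite) gl \<Rightarrow> (complex, 'n) gl"
  is "\<lambda>a M. \<chi> i j. laurent_eval a (M $ i $ j)" .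

lemma laurent_eval_superset:
  assumes "finite K" "Poly_Mapping.keys b \<subseteq> K"
  shows "laurent_eval a b = (\<Sum>k\<in>K. Poly_Mapping.lookup b k * a powi k)"
  unfolding laurent_eval_def using assms
  by (intro sum.mono_neutral_left) (auto simp: in_keys_iff)

lemma laurent_eval_zero: "laurent_eval a 0 = 0"
  by (simp add: laurent_eval_def)

lemma laurent_eval_add: "laurent_eval a (b + c) = laurent_eval a b + laurent_eval a c"
proof -
  let ?K = "Poly_Mapping.keys b \<union> Poly_Mapping.keys c"
  have "Poly_Mapping.keys (b + c) \<subseteq> ?K" by (rule keys_add)
  then show ?thesis
    by (simp add: laurent_eval_superset[of ?K] lookup_add distrib_right sum.distrib)
qed

lemma laurent_eval_diff: "laurent_eval a (b - c) = laurent_eval a b - laurent_eval a c"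
  using laurent_eval_add[of a "b - c" c] by simp

lemma laurent_eval_sum: "laurent_eval a (sum f A) = (\<Sum>x\<in>A. laurent_eval a (f x))"
  by (induction A rule: infinite_finite_induct) (simp_all add: laurent_eval_zero laurent_eval_add)

lemma laurent_eval_single: "laurent_eval a (Poly_Mapping.single k c) = c * a powi k"
  using laurent_eval_superset[of "{k}" "Poly_Mapping.single k c"] by simp

lemma laurent_eval_mult:
  assumes "a \<noteq> 0"
  shows "laurent_eval a (b * c) = laurent_eval a b * laurent_eval a c"
proof (induction b rule: poly_mapping_single_induct)
  case zero then show ?case by (simp add: laurent_eval_zero)
next
  case (add b k d)
  have "laurent_eval a (Poly_Mapping.single k d * c) = d * a powi k * laurent_eval a c"
    using assms by (induction c rule: poly_mapping_single_induct)
      (simp_all add: laurent_eval_zero laurent_eval_add laurent_eval_single distrib_left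
        mult_single power_int_add)
  with add show ?case by (simp add: distrib_right laurent_eval_add laurent_eval_single)
qed

lemma gl_eval_tensor:
  "a \<noteq> 0 \<Longrightarrow> gl_eval a (gl_tensor X b) = lscale (laurent_eval a b) X"
  by transfer
    (simp add: vec_eq_iff laurent_eval_mult of_C_poly_mapping_def of_C_complex_def laurent_eval_single)

lemma gl_eval_add: "gl_eval a (x + y) = gl_eval a x + gl_eval a y"
  by transfer (simp add: vec_eq_iff laurent_eval_add)

lemma gl_eval_lscale: "a \<noteq> 0 \<Longrightarrow> gl_eval a (lscale c x) = lscale c (gl_eval a x)"
  by transfer
    (simp add: vec_eq_iff laurent_eval_mult of_C_poly_mapping_def of_C_complex_def laurent_eval_single)

lemma gl_eval_bracket:
  "a \<noteq> 0 \<Longrightarrow> gl_eval a (lie_bracket x y) = lie_bracket (gl_eval a x) (gl_eval a y)"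
  by transfer
    (simp add: vec_eq_iff matrix_matrix_mult_def laurent_eval_diff laurent_eval_sum laurent_eval_mult)

text \<open>The action on the evaluation module: \<open>x(t)\<close> acts on the \<open>i\<close>-th tensor factor as \<open>x(a\<^sub>i)\<close>.
  On pure tensors this is the usual formula: see \<open>eval_act_pure_tensor\<close>.\<close>

definition eval_act ::
  "(complex \<Rightarrow> 'v::ab_group_add \<Rightarrow> 'v) \<Rightarrow> ('m::finite \<Rightarrow> 'v set) \<Rightarrow>
   ('m \<Rightarrow> (complex, 'n::finite) gl \<Rightarrow> 'v \<Rightarrow> 'v) \<Rightarrow> ('m \<Rightarrow> complex) \<Rightarrow>
   (laurent, 'n) gl \<Rightarrow> ((('m \<Rightarrow> 'v) \<Rightarrow> complex) \<Rightarrow> complex) \<Rightarrow> (('m \<Rightarrow> 'v) \<Rightarrow> complex) \<Rightarrow> complex" where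
  "eval_act s V \<rho> a x F =
    (\<lambda>f. if multilinear_form s V f
      then \<Sum>i\<in>UNIV. F (\<lambda>w. f (w(i := \<rho> i (gl_eval (a i) x) (w i)))) else 0)"

text \<open>The restriction of the action to \<open>gl\<^sub>N = gl\<^sub>N \<otimes> 1\<close>.\<close>

definition eval_act_gl ::
  "(complex \<Rightarrow> 'v::ab_group_add \<Rightarrow> 'v) \<Rightarrow> ('m::finite \<Rightarrow> 'v set) \<Rightarrow>
   ('m \<Rightarrow> (complex, 'n::finite) gl \<Rightarrow> 'v \<Rightarrow> 'v) \<Rightarrow> ('m \<Rightarrow> complex) \<Rightarrow>
   (complex, 'n) gl \<Rightarrow> ((('m \<Rightarrow> 'v) \<Rightarrow> complex) \<Rightarrow> complex) \<Rightarrow> (('m \<Rightarrow> 'v) \<Rightarrow> complex) \<Rightarrow> complex" where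
  "eval_act_gl s V \<rho> a X = eval_act s V \<rho> a (gl_tensor X 1)"

context
  fixes s :: "complex \<Rightarrow> 'v::ab_group_add \<Rightarrow> 'v" and V :: "'m::finite \<Rightarrow> 'v set"
    and \<rho> :: "'m \<Rightarrow> (complex, 'n::finite) gl \<Rightarrow> 'v \<Rightarrow> 'v" and a :: "'m \<Rightarrow> complex"
  assumes mods: "\<And>i. lie_module s (V i) (\<rho> i)" and nz: "\<And>i. a i \<noteq> 0"
begin

interpretation vector_space s using mods by (simp add: lie_module_def)
interpretation F: vector_space fun_scale by (rule vector_space_fun_scale)

lemma rho_in: "v \<in> V i \<Longrightarrow> \<rho> i X v \<in> V i"
  and rho_add: "v \<in> V i \<Longrightarrow> w \<in> V i \<Longrightarrow> \<rho> i X (v + w) = \<rho> i X v + \<rho> i X w"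
  and rho_scale: "v \<in> V i \<Longrightarrow> \<rho> i X (s c v) = s c (\<rho> i X v)"
  and rho_plus: "v \<in> V i \<Longrightarrow> \<rho> i (X + Y) v = \<rho> i X v + \<rho> i Y v"
  and rho_lscale: "v \<in> V i \<Longrightarrow> \<rho> i (lscale c X) v = s c (\<rho> i X v)"
  and rho_bracket: "v \<in> V i \<Longrightarrow> \<rho> i (lie_bracket X Y) v = \<rho> i X (\<rho> i Y v) - \<rho> i Y (\<rho> i X v)"
  and V_add: "v \<in> V i \<Longrightarrow> w \<in> V i \<Longrightarrow> v + w \<in> V i"
  and V_diff: "v \<in> V i \<Longrightarrow> w \<in> V i \<Longrightarrow> v - w \<in> V i"
  and V_scale: "v \<in> V i \<Longrightarrow> s c v \<in> V i"
  using mods[of i] by (auto simp: lie_module_def intro: subspace_add subspace_diff subspace_scale)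

lemma multilinear_formD:
  assumes "multilinear_form s V f" "\<And>j. w j \<in> V j" "x \<in> V i"
  shows "y \<in> V i \<Longrightarrow> f (w(i := x + y)) = f (w(i := x)) + f (w(i := y))"
    and "f (w(i := s c x)) = c * f (w(i := x))"
  using assms unfolding multilinear_form_def by blast+

lemma pure_tensor_add:
  assumes "\<And>j. w j \<in> V j" "x \<in> V i" "y \<in> V i"
  shows "pure_tensor s V (w(i := x + y)) = pure_tensor s V (w(i := x)) + pure_tensor s V (w(i := y))"
  using multilinear_formD(1)[of _ w x i y] assms by (auto simp: pure_tensor_def fun_eq_iff)

lemma pure_tensor_scale:
  assumes "\<And>j. w j \<in> V j" "x \<in> V i"
  shows "pure_tensor s V (w(i := s c x)) = fun_scale c (pure_tensor s V (w(i := x)))"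
  using multilinear_formD(2)[of _ w x i c] assms by (auto simp: pure_tensor_def fun_eq_iff fun_scale_def)

lemma pure_tensor_diff:
  assumes "\<And>j. w j \<in> V j" "x \<in> V i" "y \<in> V i"
  shows "pure_tensor s V (w(i := x - y)) = pure_tensor s V (w(i := x)) - pure_tensor s V (w(i := y))"
  using pure_tensor_add[of w "x - y" i y] assms by (simp add: V_diff)

lemma multilinear_form_slot:
  assumes "multilinear_form s V f"
  shows "multilinear_form s V (\<lambda>w. f (w(i := \<rho> i X (w i))))"
  unfolding multilinear_form_def
proof (intro allI impI conjI ballI)
  fix w k x y c assume w: "\<forall>j. w j \<in> V j" and x: "x \<in> V k"
  have w': "\<And>j. (w(i := \<rho> i X (w i))) j \<in> V j" using w by (simp add: rho_in)
  have sw: "w(k := z, i := \<rho> i X (w i)) = w(i := \<rho> i X (w i), k := z)" if "k \<noteq> i" for z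
    using that by (simp add: fun_upd_twist)
  show "f ((w(k := s c x))(i := \<rho> i X ((w(k := s c x)) i)))
      = c * f ((w(k := x))(i := \<rho> i X ((w(k := x)) i)))"
  proof (cases "k = i")
    case True
    then show ?thesis
      using multilinear_formD(2)[OF assms spec[OF w], of "\<rho> i X x" i c] x
      by (simp add: rho_in rho_scale)
  next
    case False
    then show ?thesis
      using multilinear_formD(2)[of f "w(i := \<rho> i X (w i))" x k c, OF assms w' x] by (simp add: sw)
  qed
  assume y: "y \<in> V k"
  show "f ((w(k := x + y))(i := \<rho> i X ((w(k := x + y)) i)))
      = f ((w(k := x))(i := \<rho> i X ((w(k := x)) i))) + f ((w(k := y))(i := \<rho> i X ((w(k := y)) i)))"
  proof (cases "k = i")
    case True
    then show ?thesis
      using multilinear_formD(1)[OF assms spec[OF w], of "\<rho> i X x" i "\<rho> i X y"] x y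
      by (simp add: rho_in rho_add)
  next
    case False
    then show ?thesis
      using multilinear_formD(1)[of f "w(i := \<rho> i X (w i))" x k y, OF assms w' x y] by (simp add: sw)
  qed
qed

lemma eval_act_add: "eval_act s V \<rho> a x (F + G) = eval_act s V \<rho> a x F + eval_act s V \<rho> a x G"
  by (auto simp: eval_act_def fun_eq_iff sum.distrib)

lemma eval_act_scale: "eval_act s V \<rho> a x (fun_scale c F) = fun_scale c (eval_act s V \<rho> a x F)"
  by (auto simp: eval_act_def fun_eq_iff fun_scale_def sum_distrib_left)

lemma eval_act_zero: "eval_act s V \<rho> a x 0 = 0"
  by (auto simp: eval_act_def fun_eq_iff)

lemma eval_act_sum: "eval_act s V \<rho> a x (sum G A) = (\<Sum>i\<in>A. eval_act s V \<rho> a x (G i))"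
  by (induction A rule: infinite_finite_induct)
    (simp_all only: sum.infinite sum.empty sum.insert eval_act_zero eval_act_add not_False_eq_True)

lemma sum_fun_apply: "sum G A f = (\<Sum>i\<in>A. (G i f :: complex))"
  by (induction A rule: infinite_finite_induct) simp_all

lemma eval_act_pure:
  "eval_act s V \<rho> a x (pure_tensor s V w)
    = (\<Sum>i\<in>UNIV. pure_tensor s V (w(i := \<rho> i (gl_eval (a i) x) (w i))))"
  by (auto simp: fun_eq_iff sum_fun_apply eval_act_def pure_tensor_def multilinear_form_slot)

lemma eval_act_pure_tensor:
  assumes "\<And>i. w i \<in> V i"
  shows "eval_act s V \<rho> a (gl_tensor X (Poly_Mapping.single k 1)) (pure_tensor s V w)
    = (\<Sum>i\<in>UNIV. fun_scale (a i powi k) (pure_tensor s V (w(i := \<rho> i X (w i)))))"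
  unfolding eval_act_pure
  by (intro sum.cong refl)
    (simp add: gl_eval_tensor nz laurent_eval_single rho_lscale assms pure_tensor_scale rho_in)

lemma pure_tensor_in: "(\<And>i. w i \<in> V i) \<Longrightarrow> pure_tensor s V w \<in> tensor_product s V"
  unfolding tensor_product_def by (rule F.span_base) blast

lemma tensor_induct [consumes 1, case_names zero add scale pure]:
  assumes "G \<in> tensor_product s V" "P 0" "\<And>G H. P G \<Longrightarrow> P H \<Longrightarrow> P (G + H)"
    "\<And>c G. P G \<Longrightarrow> P (fun_scale c G)" "\<And>w. (\<And>i. w i \<in> V i) \<Longrightarrow> P (pure_tensor s V w)"
  shows "P G"
proof -
  have "F.subspace {G. P G}" using assms(2-4) by (auto simp: F.subspace_def)
  then have "tensor_product s V \<subseteq> {G. P G}"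
    unfolding tensor_product_def using assms(5) by (intro F.span_minimal) auto
  with assms(1) show ?thesis by blast
qed

lemma lie_module_eval: "lie_module fun_scale (tensor_product s V) (eval_act s V \<rho> a)"
proof -
  note [simp del] = plus_fun_apply zero_fun_apply minus_apply
  note [simp] = eval_act_add eval_act_scale eval_act_zero eval_act_sum
  have sub: "F.subspace (tensor_product s V)"
    by (simp add: tensor_product_def)
  have upd: "(w(i := \<rho> i X (w i))) j \<in> V j" if "\<And>i. w i \<in> V i" for w i j X
    using that by (simp add: rho_in)
  have closed: "eval_act s V \<rho> a x G \<in> tensor_product s V" if "G \<in> tensor_product s V" for x G
    using that
  proof (induction rule: tensor_induct)
    case (pure w)
    then show ?case unfolding eval_act_pure
      by (intro F.subspace_sum[OF sub] pure_tensor_in upd)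
  qed (simp_all only: eval_act_add eval_act_scale eval_act_zero
      F.subspace_0[OF sub] F.subspace_add[OF sub] F.subspace_scale[OF sub])
  have plus: "eval_act s V \<rho> a (x + y) G = eval_act s V \<rho> a x G + eval_act s V \<rho> a y G"
    if "G \<in> tensor_product s V" for x y G
    using that
    by (induction rule: tensor_induct)
      (simp_all add: F.scale_right_distrib eval_act_pure gl_eval_add rho_plus pure_tensor_add
        rho_in sum.distrib)
  have scale: "eval_act s V \<rho> a (lscale c x) G = fun_scale c (eval_act s V \<rho> a x G)"
    if "G \<in> tensor_product s V" for c x G
    using that
    by (induction rule: tensor_induct)
      (simp_all add: F.scale_right_distrib eval_act_pure gl_eval_lscale nz rho_lscale
        pure_tensor_scale rho_in F.scale_sum_right F.scale_left_commute)
  have bracket: "eval_act s V \<rho> a (lie_bracket x y) G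
      = eval_act s V \<rho> a x (eval_act s V \<rho> a y G) - eval_act s V \<rho> a y (eval_act s V \<rho> a x G)"
    if "G \<in> tensor_product s V" for x y G
    using that
  proof (induction rule: tensor_induct)
    case (pure w)
    define r where "r z i = \<rho> i (gl_eval (a i) z)" for z i
    define A where "A x y i j = pure_tensor s V ((w(i := r y i (w i)))(j := r x j ((w(i := r y i (w i))) j)))"
      for x y i j
    have act2: "eval_act s V \<rho> a x (eval_act s V \<rho> a y (pure_tensor s V w)) = (\<Sum>i\<in>UNIV. \<Sum>j\<in>UNIV. A x y i j)"
      for x y by (simp add: eval_act_pure A_def r_def)
    have comm: "A y x j i = A x y i j" if "i \<noteq> j" for i j
      using that by (simp add: A_def fun_upd_twist)
    have diag: "pure_tensor s V (w(i := \<rho> i (gl_eval (a i) (lie_bracket x y)) (w i)))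
        = A x y i i - A y x i i" for i
      using pure by (simp add: gl_eval_bracket nz rho_bracket A_def r_def pure_tensor_diff rho_in)
    have "(\<Sum>i\<in>UNIV. \<Sum>j\<in>UNIV. A x y i j) - (\<Sum>i\<in>UNIV. \<Sum>j\<in>UNIV. A y x i j)
        = (\<Sum>i\<in>UNIV. \<Sum>j\<in>UNIV. A x y i j) - (\<Sum>i\<in>UNIV. \<Sum>j\<in>UNIV. A y x j i)"
      by (subst (2) sum.swap) simp
    also have "\<dots> = (\<Sum>i\<in>UNIV. \<Sum>j\<in>UNIV. A x y i j - A y x j i)"
      by (simp add: sum_subtractf)
    also have "\<dots> = (\<Sum>i\<in>UNIV. \<Sum>j\<in>UNIV. if j = i then A x y i i - A y x i i else 0)"
      using comm by (intro sum.cong refl) auto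
    also have "\<dots> = (\<Sum>i\<in>UNIV. A x y i i - A y x i i)"
      by (simp only: sum.delta' finite UNIV_I if_True sum.delta)
    finally show ?case
      by (simp only: act2 eval_act_pure[of "lie_bracket x y"] diag)
  qed (simp_all add: F.scale_right_diff_distrib)
  show ?thesis
    unfolding lie_module_def
    using vector_space_fun_scale sub closed plus scale bracket by auto
qed

lemma lie_module_eval_gl: "lie_module fun_scale (tensor_product s V) (eval_act_gl s V \<rho> a)"
  using lie_module_eval by (simp add: lie_module_def eval_act_gl_def gl_tensor_one)

end

text \<open>Submodules for \<open>T \<otimes> U(gl\<^sub>N)\<close>, where \<open>x \<otimes> u\<close> acts by \<open>w \<mapsto> x (u w)\<close>; for a subspace it is
  enough to be stable under these elements since they span.\<close>

definition TU_submodule ::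
  "(complex \<Rightarrow> 'v::ab_group_add \<Rightarrow> 'v) \<Rightarrow> ('m::finite \<Rightarrow> 'v set) \<Rightarrow>
   ('m \<Rightarrow> (complex, 'n::finite) gl \<Rightarrow> 'v \<Rightarrow> 'v) \<Rightarrow> ('m \<Rightarrow> complex) \<Rightarrow>
   ((('m \<Rightarrow> 'v) \<Rightarrow> complex) \<Rightarrow> complex) set \<Rightarrow> bool" where
  "TU_submodule s V \<rho> a S \<longleftrightarrow> module.subspace fun_scale S \<and> S \<subseteq> tensor_product s V \<and>
    (\<forall>x\<in>trace_alg. \<forall>u. \<forall>w\<in>S.
      uea_act fun_scale (eval_act s V \<rho> a) x (uea_act fun_scale (eval_act_gl s V \<rho> a) u w) \<in> S)"

definition TU_irreducible ::
  "(complex \<Rightarrow> 'v::ab_group_add \<Rightarrow> 'v) \<Rightarrow> ('m::finite \<Rightarrow> 'v set) \<Rightarrow>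
   ('m \<Rightarrow> (complex, 'n::finite) gl \<Rightarrow> 'v \<Rightarrow> 'v) \<Rightarrow> ('m \<Rightarrow> complex) \<Rightarrow>
   ((('m \<Rightarrow> 'v) \<Rightarrow> complex) \<Rightarrow> complex) set \<Rightarrow> bool" where
  "TU_irreducible s V \<rho> a W \<longleftrightarrow> TU_submodule s V \<rho> a W \<and> W \<noteq> {0} \<and>
    (\<forall>S. TU_submodule s V \<rho> a S \<and> S \<subseteq> W \<longrightarrow> S = {0} \<or> S = W)"

text \<open>The isotypic component of \<open>V(\<lambda>, a)\<close>, as a \<open>gl\<^sub>N\<close>-module, of the type of \<open>(M, \<sigma>)\<close>.\<close>

definition eval_isotypic ::
  "(complex \<Rightarrow> 'v::ab_group_add \<Rightarrow> 'v) \<Rightarrow> ('m::finite \<Rightarrow> 'v set) \<Rightarrow>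
   ('m \<Rightarrow> (complex, 'n::finite) gl \<Rightarrow> 'v \<Rightarrow> 'v) \<Rightarrow> ('m \<Rightarrow> complex) \<Rightarrow>
   (complex \<Rightarrow> 'w::ab_group_add \<Rightarrow> 'w) \<Rightarrow> 'w set \<Rightarrow> ((complex, 'n) gl \<Rightarrow> 'w \<Rightarrow> 'w) \<Rightarrow>
   ((('m \<Rightarrow> 'v) \<Rightarrow> complex) \<Rightarrow> complex) set" where
  "eval_isotypic s V \<rho> a s' M \<sigma> =
    isotypic_component fun_scale (tensor_product s V) (eval_act_gl s V \<rho> a) s' M \<sigma>"

end

theory Submission
  imports Defs "HOL-Combinatorics.Cycles" "HOL-Computational_Algebra.Fundamental_Theorem_Algebra"
begin

text \<open>Write \<open>g\<close> for \<open>gl\<^sub>N\<close> and \<open>W\<close> for the evaluation module. The heart of the matter is that every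
\<open>g\<close>-equivariant map \<open>f\<close> from a \<open>g\<close>-submodule \<open>N\<close> of \<open>W\<close> to \<open>W\<close> is the action of an element of
the trace algebra \<open>T\<close> (\<open>equivariant_map_from_trace_alg\<close>). Granted this, let \<open>S\<close> be a submodule of
the isotypic component \<open>W(\<mu>)\<close> that contains some \<open>F \<noteq> 0\<close>. A sum of copies of \<open>V(\<mu>)\<close> can be thinned
out to a direct one, so some equivariant map from a submodule around \<open>F\<close> to any prescribed copy of
\<open>V(\<mu>)\<close> does not kill \<open>F\<close> (\<open>detecting_homomorphism\<close>). This map comes from \<open>T\<close>, hence \<open>S\<close> meets the
copy, hence contains it, and \<open>S = W(\<mu>)\<close>. Conversely \<open>W(\<mu>)\<close> is stable because \<open>T\<close> commutes with
\<open>g\<close> (\<open>trace_alg_commutes_gl\<close>).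

The equivariant map \<open>f\<close> is lifted to \<open>T\<close> in three steps.

First, \<open>U(g \<otimes> A)\<close> acts on \<open>W\<close> by all endomorphisms: the \<open>a\<^sub>i\<close> are distinct, so Lagrange
interpolation gives elements that act on a single tensor factor, and on one factor Burnside's
theorem applies (\<open>enveloping_algebra_onto_endomorphisms\<close>). Thus \<open>f\<close> is the action of a combination
of words of bounded length in the letters \<open>E\<^sub>i\<^sub>j \<otimes> b\<^sub>m\<close>, where \<open>b\<^sub>m(a\<^sub>k) = \<delta>\<^sub>m\<^sub>k\<close>.

Second, this combination can be chosen \<open>g\<close>-invariant. On the finite-dimensional space of
coefficient functions of words with its standard Hermitian product, \<open>E\<^sub>q\<^sub>p\<close> acts as the adjoint of
\<open>E\<^sub>p\<^sub>q\<close> (\<open>coeff_ad_adjoint\<close>). Choose the coefficient function \<open>c\<close> of \<open>f\<close> orthogonal to the space of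
functions that act by \<open>0\<close> on \<open>N\<close>. That space is \<open>g\<close>-stable, and it contains \<open>E\<^sub>p\<^sub>q c\<close> because \<open>f\<close>
is equivariant. As \<open>E\<^sub>p\<^sub>q c\<close> is also orthogonal to it, \<open>E\<^sub>p\<^sub>q c = 0\<close>.

Third, an invariant combination of words lies in \<open>T\<close>. By the first fundamental theorem
(\<open>gl_invariants_spanned_by_permutations\<close>) it is a combination of permuted traces
\<open>\<Sum>\<^sub>i E\<^sub>i\<^sub>1\<^sub>,\<^sub>i\<^sub>\<sigma>\<^sub>1(b\<^sub>1) \<cdots> E\<^sub>i\<^sub>k\<^sub>,\<^sub>i\<^sub>\<sigma>\<^sub>k(b\<^sub>k)\<close>. Exchanging neighbouring factors changes such an element by shorter
ones, and once the cycles of \<open>\<sigma>\<close> are written one after the other it is a product of generators of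
\<open>T\<close> (\<open>index_sum_in_trace_alg\<close>).\<close>


section \<open>Orthogonal projection\<close>

lemma sum_mult_cnj_eq_0_iff:
  assumes "finite A"
  shows "(\<Sum>x\<in>A. f x * cnj (f x)) = 0 \<longleftrightarrow> (\<forall>x\<in>A. f x = 0)"
proof -
  have "(\<Sum>x\<in>A. f x * cnj (f x)) = of_real (\<Sum>x\<in>A. (cmod (f x))\<^sup>2)"
    unfolding of_real_sum by (intro sum.cong refl) (rule complex_norm_square[symmetric])
  also have "\<dots> = 0 \<longleftrightarrow> (\<Sum>x\<in>A. (cmod (f x))\<^sup>2) = 0" by (simp only: of_real_eq_0_iff)
  also have "\<dots> \<longleftrightarrow> (\<forall>x\<in>A. (cmod (f x))\<^sup>2 = 0)"
    using assms by (intro sum_nonneg_eq_0_iff) auto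
  finally show ?thesis by simp
qed

text \<open>Gram--Schmidt by induction on \<open>\<Omega>\<close>: the members of \<open>K\<close> that vanish at a new point \<open>a\<close> have
codimension at most one in \<open>K\<close>, so projecting to them and correcting along one orthogonal vector
suffices.\<close>

lemma orthogonal_projection_exists:
  fixes K :: "('a \<Rightarrow> complex) set"
  assumes "finite \<Omega>" "(\<lambda>_. 0) \<in> K" "\<And>f g. f \<in> K \<Longrightarrow> g \<in> K \<Longrightarrow> (\<lambda>x. f x + g x) \<in> K"
    "\<And>c f. f \<in> K \<Longrightarrow> (\<lambda>x. c * f x) \<in> K"
  shows "\<exists>k\<in>K. \<forall>k'\<in>K. (\<Sum>x\<in>\<Omega>. (f x - k x) * cnj (k' x)) = 0"
  using assms
proof (induction \<Omega> arbitrary: K f rule: finite_induct)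
  case empty
  then show ?case by auto
next
  case (insert a \<Omega>)
  define K0 where "K0 = {k\<in>K. k a = 0}"
  define ip where "ip f g = (\<Sum>x\<in>insert a \<Omega>. f x * cnj (g x))" for f g :: "'a \<Rightarrow> complex"
  have K0: "\<exists>k\<in>K0. \<forall>k'\<in>K0. ip (\<lambda>x. f x - k x) k' = 0" for f
  proof -
    have "\<exists>k\<in>K0. \<forall>k'\<in>K0. (\<Sum>x\<in>\<Omega>. (f x - k x) * cnj (k' x)) = 0"
      by (rule insert.IH) (use insert.prems in \<open>auto simp: K0_def\<close>)
    then show ?thesis using insert.hyps by (auto simp: K0_def ip_def)
  qed
  have ip_lin: "ip (\<lambda>x. f x - c * g x) h = ip f h - c * ip g h"
    "ip h (\<lambda>x. f x + c * g x) = ip h f + cnj c * ip h g" for f g h c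
    by (simp_all add: ip_def sum_subtractf sum_distrib_left algebra_simps sum.distrib
        del: sum.insert sum.insert_if)
  show ?case
  proof (cases "\<exists>k\<in>K. k a \<noteq> 0")
    case False
    then have "K0 = K" by (auto simp: K0_def)
    then show ?thesis using K0[of f] by (simp add: ip_def)
  next
    case True
    then obtain k1 where k1: "k1 \<in> K" "k1 a \<noteq> 0" by blast
    obtain k2 where k2: "k2 \<in> K0" "\<And>k. k \<in> K0 \<Longrightarrow> ip (\<lambda>x. k1 x - k2 x) k = 0"
      using K0[of k1] by blast
    \<comment> \<open>\<open>e\<close> is orthogonal to \<open>K0\<close>, and together they span \<open>K\<close>\<close>
    define e where "e = (\<lambda>x. k1 x - k2 x)"
    have e: "e \<in> K" "e a \<noteq> 0"
      using insert.prems(2)[of k1 "\<lambda>x. (-1) * k2 x"] insert.prems(3)[of k2 "-1"] k1 k2(1)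
      by (auto simp: e_def K0_def)
    have ee: "ip e e \<noteq> 0"
      using sum_mult_cnj_eq_0_iff[of "insert a \<Omega>" e] insert.hyps e by (auto simp: ip_def)
    obtain k0 where k0: "k0 \<in> K0" "\<And>k. k \<in> K0 \<Longrightarrow> ip (\<lambda>x. f x - k0 x) k = 0"
      using K0[of f] by blast
    define c where "c = ip (\<lambda>x. f x - k0 x) e / ip e e"
    show ?thesis
    proof (intro bexI ballI)
      show "(\<lambda>x. k0 x + c * e x) \<in> K"
        using insert.prems(2)[of k0 "\<lambda>x. c * e x"] insert.prems(3)[of e c] e(1) k0(1)
        by (auto simp: K0_def)
      fix k assume k: "k \<in> K"
      define d where "d = k a / e a"
      have "(\<lambda>x. k x + (- d) * e x) \<in> K0"
        using insert.prems(2)[of k "\<lambda>x. (- d) * e x"] insert.prems(3)[of e "- d"] e k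
        by (auto simp: K0_def d_def)
      moreover define r where "r = (\<lambda>x. k x + (- d) * e x)"
      ultimately have r: "r \<in> K0" by simp
      have kr: "k = (\<lambda>x. r x + d * e x)" by (simp add: r_def fun_eq_iff)
      have "ip (\<lambda>x. (f x - k0 x) - c * e x) k = 0"
        unfolding kr ip_lin using ee k0(2)[OF r] k2(2)[OF r, folded e_def]
        by (simp add: c_def)
      then show "(\<Sum>x\<in>insert a \<Omega>. (f x - (k0 x + c * e x)) * cnj (k x)) = 0"
        by (simp add: ip_def algebra_simps del: sum.insert sum.insert_if)
    qed
  qed
qed

section \<open>Invariants of mixed tensors\<close>

text \<open>Functions of two arguments in a finite set \<open>X\<close> serve as square matrices with index set \<open>X\<close>, and
the condition is the equality of the two matrix products.\<close>

definition commutes_on :: "'x set \<Rightarrow> ('x \<Rightarrow> 'x \<Rightarrow> complex) \<Rightarrow> ('x \<Rightarrow> 'x \<Rightarrow> complex) \<Rightarrow> bool" where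
  "commutes_on X c z \<longleftrightarrow> (\<forall>x\<in>X. \<forall>y\<in>X. (\<Sum>u\<in>X. c x u * z u y) = (\<Sum>u\<in>X. z x u * c u y))"

lemma commutes_on_cong:
  assumes "commutes_on X c z" "\<And>x y. x \<in> X \<Longrightarrow> y \<in> X \<Longrightarrow> z x y = z' x y"
  shows "commutes_on X c z'"
  using assms by (simp add: commutes_on_def cong: sum.cong)

lemma commutes_on_sum:
  assumes "\<And>j. j \<in> J \<Longrightarrow> commutes_on X c (z j)"
  shows "commutes_on X c (\<lambda>x y. \<Sum>j\<in>J. z j x y)"
  using assms unfolding commutes_on_def sum_distrib_left sum_distrib_right
  by (subst (1 2) sum.swap) (simp add: sum_distrib_left sum_distrib_right cong: sum.cong)

lemma commutes_on_scale: "commutes_on X c z \<Longrightarrow> commutes_on X c (\<lambda>x y. a * z x y)"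
  unfolding commutes_on_def by (simp add: mult.left_commute[of _ a] mult.assoc flip: sum_distrib_left)

lemma commutes_on_mult:
  assumes "commutes_on X c z" "commutes_on X c z'"
  shows "commutes_on X c (\<lambda>x y. \<Sum>u\<in>X. z x u * z' u y)"
  unfolding commutes_on_def
proof (intro ballI)
  fix x y assume xy: "x \<in> X" "y \<in> X"
  have "(\<Sum>u\<in>X. c x u * (\<Sum>v\<in>X. z u v * z' v y)) = (\<Sum>v\<in>X. (\<Sum>u\<in>X. c x u * z u v) * z' v y)"
    unfolding sum_distrib_left sum_distrib_right by (subst sum.swap) (simp add: mult.assoc)
  also have "\<dots> = (\<Sum>v\<in>X. (\<Sum>u\<in>X. z x u * c u v) * z' v y)"
    using assms xy by (simp add: commutes_on_def cong: sum.cong)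
  also have "\<dots> = (\<Sum>u\<in>X. z x u * (\<Sum>v\<in>X. c u v * z' v y))"
    unfolding sum_distrib_left sum_distrib_right by (subst sum.swap) (simp add: mult.assoc)
  also have "\<dots> = (\<Sum>u\<in>X. z x u * (\<Sum>v\<in>X. z' u v * c v y))"
    using assms xy by (simp add: commutes_on_def cong: sum.cong)
  also have "\<dots> = (\<Sum>v\<in>X. (\<Sum>u\<in>X. z x u * z' u v) * c v y)"
    unfolding sum_distrib_left sum_distrib_right by (subst sum.swap) (simp add: mult.assoc)
  finally show "(\<Sum>u\<in>X. c x u * (\<Sum>v\<in>X. z u v * z' v y)) = (\<Sum>v\<in>X. (\<Sum>u\<in>X. z x u * z' u v) * c v y)" .
qed

lemma commutes_on_diff:
  assumes "commutes_on X c z" "commutes_on X c z'"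
  shows "commutes_on X c (\<lambda>x y. z x y - z' x y)"
  using assms unfolding commutes_on_def by (simp add: algebra_simps sum_subtractf)

text \<open>Index tuples label the standard basis of a tensor power of the vector space with basis \<open>'n\<close>. Tuples
are extensional functions, so that permutations of \<open>I\<close> act on them by composition.\<close>

definition tuples :: "'k set \<Rightarrow> ('k \<Rightarrow> 'n) set" where
  "tuples I = PiE I (\<lambda>_. UNIV)"

definition tensor_mat :: "'k set \<Rightarrow> ('k \<Rightarrow> 'n \<Rightarrow> 'n \<Rightarrow> complex) \<Rightarrow> ('k \<Rightarrow> 'n) \<Rightarrow> ('k \<Rightarrow> 'n) \<Rightarrow> complex" where
  "tensor_mat I Y x y = (\<Prod>r\<in>I. Y r (x r) (y r))"

definition unit_mat :: "'n \<Rightarrow> 'n \<Rightarrow> 'n \<Rightarrow> 'n \<Rightarrow> complex" where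
  "unit_mat p q i j = of_bool (i = p \<and> j = q)"

definition id_mat :: "'n \<Rightarrow> 'n \<Rightarrow> complex" where
  "id_mat i j = of_bool (i = j)"

definition mat_mult :: "('n::finite \<Rightarrow> 'n \<Rightarrow> complex) \<Rightarrow> ('n \<Rightarrow> 'n \<Rightarrow> complex) \<Rightarrow> 'n \<Rightarrow> 'n \<Rightarrow> complex" where
  "mat_mult A B i j = (\<Sum>l\<in>UNIV. A i l * B l j)"

text \<open>The derivation by which \<open>Z\<close> acts on the tensor power indexed by \<open>I\<close>.\<close>

definition diagonal_act :: "'k set \<Rightarrow> ('n \<Rightarrow> 'n \<Rightarrow> complex) \<Rightarrow> ('k \<Rightarrow> 'n) \<Rightarrow> ('k \<Rightarrow> 'n) \<Rightarrow> complex" where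
  "diagonal_act I Z x y = (\<Sum>r\<in>I. tensor_mat I ((\<lambda>_. id_mat)(r := Z)) x y)"

definition sym_tens :: "'k set \<Rightarrow> ('k \<Rightarrow> 'n \<Rightarrow> 'n \<Rightarrow> complex) \<Rightarrow> ('k \<Rightarrow> 'n) \<Rightarrow> ('k \<Rightarrow> 'n) \<Rightarrow> complex" where
  "sym_tens I Y x y = (\<Sum>\<sigma> | \<sigma> permutes I. tensor_mat I (Y \<circ> \<sigma>) x y)"

lemma finite_tuples: "finite I \<Longrightarrow> finite (tuples I :: ('k \<Rightarrow> 'n::finite) set)"
  by (simp add: tuples_def finite_PiE)

lemma tuples_eqI: "x \<in> tuples I \<Longrightarrow> y \<in> tuples I \<Longrightarrow> (\<And>r. r \<in> I \<Longrightarrow> x r = y r) \<Longrightarrow> x = y"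
  unfolding tuples_def by (rule PiE_ext)

lemma tuples_upd: "x \<in> tuples I \<Longrightarrow> r \<in> I \<Longrightarrow> x(r := p) \<in> tuples I"
  by (auto simp: tuples_def PiE_def extensional_def)

lemma tuples_comp: "x \<in> tuples I \<Longrightarrow> \<sigma> permutes I \<Longrightarrow> x \<circ> \<sigma> \<in> tuples I"
  by (auto simp: tuples_def PiE_def extensional_def permutes_not_in)

lemma tensor_mat_mult:
  fixes A B :: "'k \<Rightarrow> 'n::finite \<Rightarrow> 'n \<Rightarrow> complex"
  assumes "finite I"
  shows "(\<Sum>u\<in>tuples I. tensor_mat I A x u * tensor_mat I B u y) = tensor_mat I (\<lambda>r. mat_mult (A r) (B r)) x y"
  unfolding tensor_mat_def mat_mult_def tuples_def
  by (subst prod_sum_PiE) (simp_all add: assms prod.distrib)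

lemma mat_mult_id: "mat_mult id_mat A = A"
  by (auto simp: fun_eq_iff mat_mult_def id_mat_def of_bool_def if_distrib[of "\<lambda>x. x * _"] cong: if_cong)

lemma sym_tens_permute:
  assumes "\<tau> permutes I"
  shows "sym_tens I (Y \<circ> \<tau>) = sym_tens I Y"
proof -
  have "sym_tens I Y x y = (\<Sum>\<sigma> | \<sigma> permutes I. tensor_mat I (Y \<circ> (\<tau> \<circ> \<sigma>)) x y)" for x y
    unfolding sym_tens_def
    using setum_permutations_compose_left[OF assms, of "\<lambda>\<sigma>. tensor_mat I (Y \<circ> \<sigma>) x y"] by simp
  then show ?thesis by (simp add: sym_tens_def fun_eq_iff comp_assoc)
qed

text \<open>The diagonal action of \<open>Z\<close> multiplies one tensor slot at a time; since the sum over all slots is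
symmetric, it may be performed before the symmetrisation.\<close>

lemma diagonal_act_sym_tens:
  fixes Y :: "'k \<Rightarrow> 'n::finite \<Rightarrow> 'n \<Rightarrow> complex"
  assumes "finite I"
  shows "(\<Sum>u\<in>tuples I. diagonal_act I Z x u * sym_tens I Y u y)
    = (\<Sum>r\<in>I. sym_tens I (Y(r := mat_mult Z (Y r))) x y)"
proof -
  have "(\<Sum>u\<in>tuples I. diagonal_act I Z x u * sym_tens I Y u y)
     = (\<Sum>\<sigma> | \<sigma> permutes I. \<Sum>r\<in>I. \<Sum>u\<in>tuples I. tensor_mat I ((\<lambda>_. id_mat)(r := Z)) x u * tensor_mat I (Y \<circ> \<sigma>) u y)"
    unfolding diagonal_act_def sym_tens_def sum_product
    by (subst sum.swap, subst (2) sum.swap, subst sum.swap) (simp add: sum.swap[of _ "tuples I"])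
  also have "\<dots> = (\<Sum>\<sigma> | \<sigma> permutes I. \<Sum>r\<in>I. tensor_mat I (Y(\<sigma> r := mat_mult Z (Y (\<sigma> r))) \<circ> \<sigma>) x y)"
  proof (intro sum.cong refl)
    fix \<sigma> r assume s: "\<sigma> \<in> {\<sigma>. \<sigma> permutes I}" and r: "r \<in> I"
    then have inj: "\<sigma> t = \<sigma> r \<longleftrightarrow> t = r" for t
      by (auto dest: permutes_inj simp: inj_eq)
    have "(\<lambda>t. mat_mult (((\<lambda>_. id_mat)(r := Z)) t) ((Y \<circ> \<sigma>) t)) = Y(\<sigma> r := mat_mult Z (Y (\<sigma> r))) \<circ> \<sigma>"
      by (auto simp: fun_eq_iff mat_mult_id inj)
    then show "(\<Sum>u\<in>tuples I. tensor_mat I ((\<lambda>_. id_mat)(r := Z)) x u * tensor_mat I (Y \<circ> \<sigma>) u y)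
        = tensor_mat I (Y(\<sigma> r := mat_mult Z (Y (\<sigma> r))) \<circ> \<sigma>) x y"
      by (simp add: tensor_mat_mult[OF assms])
  qed
  also have "\<dots> = (\<Sum>\<sigma> | \<sigma> permutes I. \<Sum>r\<in>I. tensor_mat I (Y(r := mat_mult Z (Y r)) \<circ> \<sigma>) x y)"
  proof (rule sum.cong[OF refl])
    fix \<sigma> assume "\<sigma> \<in> {\<sigma>. \<sigma> permutes I}"
    then show "(\<Sum>r\<in>I. tensor_mat I (Y(\<sigma> r := mat_mult Z (Y (\<sigma> r))) \<circ> \<sigma>) x y)
      = (\<Sum>r\<in>I. tensor_mat I (Y(r := mat_mult Z (Y r)) \<circ> \<sigma>) x y)"
      using sum.permute[of \<sigma> I "\<lambda>r. tensor_mat I (Y(r := mat_mult Z (Y r)) \<circ> \<sigma>) x y"]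
      by (simp add: comp_def)
  qed
  also have "\<dots> = (\<Sum>r\<in>I. sym_tens I (Y(r := mat_mult Z (Y r))) x y)"
    unfolding sym_tens_def by (subst sum.swap) simp
  finally show ?thesis .
qed

lemma commutes_with_identity:
  assumes "finite X" and "\<And>x y. x \<in> X \<Longrightarrow> y \<in> X \<Longrightarrow> z x y = (if x = y then d else 0)"
  shows "commutes_on X c z"
  unfolding commutes_on_def
proof (intro ballI)
  fix x y assume xy: "x \<in> X" "y \<in> X"
  have "(\<Sum>u\<in>X. c x u * z u y) = (\<Sum>u\<in>X. if u = y then c x u * d else 0)"
    using xy by (intro sum.cong) (auto simp: assms)
  moreover have "(\<Sum>u\<in>X. z x u * c u y) = (\<Sum>u\<in>X. if u = x then d * c u y else 0)"
    using xy by (intro sum.cong) (auto simp: assms)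
  ultimately show "(\<Sum>u\<in>X. c x u * z u y) = (\<Sum>u\<in>X. z x u * c u y)"
    using xy assms(1) by simp
qed

text \<open>Every symmetrised tensor is a polynomial in diagonal actions. Induction on the number of slots that
are not the identity: remove the matrix \<open>Z\<close> from one such slot and let \<open>Z\<close> act diagonally on the
rest. The terms where \<open>Z\<close> lands on an identity slot all equal the original tensor, by symmetry; in
the others fewer slots differ from the identity.\<close>

lemma commutes_sym_tens:
  fixes Y :: "'k \<Rightarrow> 'n::finite \<Rightarrow> 'n \<Rightarrow> complex"
  assumes fin: "finite I" and comm: "\<And>Z. commutes_on (tuples I) c (diagonal_act I Z)"
  shows "commutes_on (tuples I) c (sym_tens I Y)"
proof (induction "card {r\<in>I. Y r \<noteq> id_mat}" arbitrary: Y rule: less_induct)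
  case less
  show ?case
  proof (cases "{r\<in>I. Y r \<noteq> id_mat} = {}")
    case True
    have "sym_tens I Y x y = (if x = y then of_nat (card {\<sigma>. \<sigma> permutes I}) else 0)"
      if "x \<in> tuples I" "y \<in> tuples I" for x y
    proof -
      have "tensor_mat I (Y \<circ> \<sigma>) x y = of_bool (x = y)" if "\<sigma> permutes I" for \<sigma>
      proof -
        have "tensor_mat I (Y \<circ> \<sigma>) x y = (\<Prod>r\<in>I. id_mat (x r) (y r))"
          unfolding tensor_mat_def using True that by (intro prod.cong) (auto simp: permutes_in_image)
        also have "\<dots> = of_bool (x = y)"
        proof (cases "x = y")
          case False
          then obtain r where "r \<in> I" "x r \<noteq> y r" using tuples_eqI[of x I y] \<open>x \<in> _\<close> \<open>y \<in> _\<close> by blast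
          with False show ?thesis using fin by (auto simp: id_mat_def)
        qed (simp add: id_mat_def)
        finally show ?thesis .
      qed
      then show ?thesis by (simp add: sym_tens_def)
    qed
    then show ?thesis by (rule commutes_with_identity[OF finite_tuples[OF fin]])
  next
    case False
    then obtain r0 where r0: "r0 \<in> I" "Y r0 \<noteq> id_mat" by blast
    \<comment> \<open>the tensor from which the slot \<open>r0\<close> has been removed; \<open>J\<close> is the set of its identity slots\<close>
    define Y0 where "Y0 = Y(r0 := id_mat)"
    define J where "J = {r\<in>I. Y0 r = id_mat}"
    define Z where "Z = Y r0"
    have J: "finite J" "r0 \<in> J" "J \<subseteq> I" using fin r0 by (auto simp: J_def Y0_def)
    then have cJ: "of_nat (card J) \<noteq> (0 :: complex)" by auto
    have sub: "{r\<in>I. Y0 r \<noteq> id_mat} = {r\<in>I. Y r \<noteq> id_mat} - {r0}" by (auto simp: Y0_def)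
    have lt: "card {r\<in>I. Y0 r \<noteq> id_mat} < card {r\<in>I. Y r \<noteq> id_mat}"
      unfolding sub by (rule psubset_card_mono) (use fin r0 in auto)
    have idJ: "sym_tens I (Y0(r := mat_mult Z (Y0 r))) = sym_tens I Y" if "r \<in> J" for r
    proof -
      have mid: "mat_mult Z id_mat = Z"
        by (auto simp: fun_eq_iff mat_mult_def id_mat_def of_bool_def if_distrib[of "\<lambda>x. _ * x"] cong: if_cong)
      have "Y0(r := mat_mult Z (Y0 r)) = Y \<circ> Transposition.transpose r0 r"
        using that mid by (auto simp: fun_eq_iff[where 'a = 'k] Y0_def J_def Z_def Transposition.transpose_def)
      moreover have "Transposition.transpose r0 r permutes I"
        using that r0 by (intro permutes_swap_id) (auto simp: J_def)
      ultimately show ?thesis by (simp add: sym_tens_permute)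
    qed
    have other: "commutes_on (tuples I) c (sym_tens I (Y0(r := mat_mult Z (Y0 r))))" if "r \<in> I - J" for r
    proof (rule less)
      have "card {s\<in>I. (Y0(r := mat_mult Z (Y0 r))) s \<noteq> id_mat} \<le> card {s\<in>I. Y0 s \<noteq> id_mat}"
        using that fin by (intro card_mono) (auto simp: J_def)
      with lt show "card {s\<in>I. (Y0(r := mat_mult Z (Y0 r))) s \<noteq> id_mat} < card {s\<in>I. Y s \<noteq> id_mat}"
        by simp
    qed
    have "commutes_on (tuples I) c (\<lambda>x y. (1 / of_nat (card J)) * ((\<Sum>u\<in>tuples I. diagonal_act I Z x u * sym_tens I Y0 u y)
        - (\<Sum>r\<in>I - J. sym_tens I (Y0(r := mat_mult Z (Y0 r))) x y)))"
      by (intro commutes_on_scale commutes_on_diff commutes_on_mult commutes_on_sum comm other less lt)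
    moreover have "(1 / of_nat (card J)) * ((\<Sum>u\<in>tuples I. diagonal_act I Z x u * sym_tens I Y0 u y)
        - (\<Sum>r\<in>I - J. sym_tens I (Y0(r := mat_mult Z (Y0 r))) x y)) = sym_tens I Y x y" for x y
    proof -
      have "(\<Sum>u\<in>tuples I. diagonal_act I Z x u * sym_tens I Y0 u y)
        = (\<Sum>r\<in>I. sym_tens I (Y0(r := mat_mult Z (Y0 r))) x y)"
        by (rule diagonal_act_sym_tens[OF fin])
      also have "\<dots> = (\<Sum>r\<in>J. sym_tens I (Y0(r := mat_mult Z (Y0 r))) x y)
          + (\<Sum>r\<in>I - J. sym_tens I (Y0(r := mat_mult Z (Y0 r))) x y)"
        using sum.subset_diff[OF J(3) fin] by (simp add: add.commute)
      also have "(\<Sum>r\<in>J. sym_tens I (Y0(r := mat_mult Z (Y0 r))) x y) = of_nat (card J) * sym_tens I Y x y"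
        by (simp add: idJ)
      finally show ?thesis using cJ by (simp only: add_diff_cancel_right') simp
    qed
    ultimately show ?thesis by (rule commutes_on_cong) 
  qed
qed

lemma sym_tens_unit:
  fixes x y :: "'k \<Rightarrow> 'n"
  assumes "finite I" "p \<in> tuples I" "q \<in> tuples I" "x \<in> tuples I" "y \<in> tuples I"
  shows "sym_tens I (\<lambda>r. unit_mat (p r) (q r)) x y = (\<Sum>\<sigma> | \<sigma> permutes I. of_bool (x = p \<circ> \<sigma> \<and> y = q \<circ> \<sigma>))"
  unfolding sym_tens_def
proof (intro sum.cong refl)
  fix \<sigma> assume "\<sigma> \<in> {\<sigma>. \<sigma> permutes I}"
  then have s: "\<sigma> permutes I" by simp
  have "tensor_mat I ((\<lambda>r. unit_mat (p r) (q r)) \<circ> \<sigma>) x y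
      = of_bool (\<forall>r\<in>I. x r = p (\<sigma> r) \<and> y r = q (\<sigma> r))"
    using assms(1) by (auto simp: tensor_mat_def unit_mat_def)
  also have "(\<forall>r\<in>I. x r = p (\<sigma> r) \<and> y r = q (\<sigma> r)) \<longleftrightarrow> x = p \<circ> \<sigma> \<and> y = q \<circ> \<sigma>"
    using tuples_eqI[OF assms(4) tuples_comp[OF assms(2) s]] tuples_eqI[OF assms(5) tuples_comp[OF assms(3) s]]
    by auto
  finally show "tensor_mat I ((\<lambda>r. unit_mat (p r) (q r)) \<circ> \<sigma>) x y = of_bool (x = p \<circ> \<sigma> \<and> y = q \<circ> \<sigma>)" .
qed

text \<open>A matrix that is invariant under simultaneous permutation of both indices is an average of
symmetrised products of matrix units.\<close>

lemma commutes_invariant: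
  fixes c :: "('k \<Rightarrow> 'n::finite) \<Rightarrow> ('k \<Rightarrow> 'n) \<Rightarrow> complex"
  assumes fin: "finite I" and comm: "\<And>Z. commutes_on (tuples I) c (diagonal_act I Z)"
    and inv: "\<And>\<sigma> x y. \<sigma> permutes I \<Longrightarrow> x \<in> tuples I \<Longrightarrow> y \<in> tuples I \<Longrightarrow> z (x \<circ> \<sigma>) (y \<circ> \<sigma>) = z x y"
  shows "commutes_on (tuples I) c z"
proof -
  let ?G = "{\<sigma>. \<sigma> permutes I}"
  have G: "finite ?G" "of_nat (card ?G) \<noteq> (0 :: complex)"
    using finite_permutations[OF fin] permutes_id[of I] by (auto intro: exI[of _ id])
  have "commutes_on (tuples I) c (\<lambda>x y. (1 / of_nat (card ?G)) *
      (\<Sum>(p, q)\<in>tuples I \<times> tuples I. z p q * sym_tens I (\<lambda>r. unit_mat (p r) (q r)) x y))"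
    by (intro commutes_on_scale commutes_on_sum) (auto intro!: commutes_on_scale commutes_sym_tens fin comm)
  then show ?thesis
  proof (rule commutes_on_cong)
    fix x y :: "'k \<Rightarrow> 'n" assume xy: "x \<in> tuples I" "y \<in> tuples I"
    have "(\<Sum>(p, q)\<in>tuples I \<times> tuples I. z p q * sym_tens I (\<lambda>r. unit_mat (p r) (q r)) x y)
       = (\<Sum>(p, q)\<in>tuples I \<times> tuples I. \<Sum>\<sigma>\<in>?G. z p q * of_bool (x = p \<circ> \<sigma> \<and> y = q \<circ> \<sigma>))"
      using xy by (intro sum.cong) (auto simp: sym_tens_unit[OF fin] sum_distrib_left simp del: sum_mult_of_bool_eq)
    also have "\<dots> = (\<Sum>\<sigma>\<in>?G. \<Sum>(p, q)\<in>tuples I \<times> tuples I. z p q * of_bool (x = p \<circ> \<sigma> \<and> y = q \<circ> \<sigma>))"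
      unfolding split_beta by (rule sum.swap)
    also have "\<dots> = (\<Sum>\<sigma>\<in>?G. z x y)"
    proof (intro sum.cong refl)
      fix \<sigma> assume "\<sigma> \<in> ?G"
      then have s: "\<sigma> permutes I" by simp
      then have si: "inv \<sigma> permutes I" by (rule permutes_inv)
      have "(\<Sum>(p, q)\<in>tuples I \<times> tuples I. z p q * of_bool (x = p \<circ> \<sigma> \<and> y = q \<circ> \<sigma>))
         = (\<Sum>pq\<in>tuples I \<times> tuples I. if pq = (x \<circ> inv \<sigma>, y \<circ> inv \<sigma>) then z x y else 0)"
      proof (intro sum.cong refl)
        fix pq :: "('k \<Rightarrow> 'n) \<times> ('k \<Rightarrow> 'n)" assume pq: "pq \<in> tuples I \<times> tuples I"
        obtain p q where [simp]: "pq = (p, q)" by force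
        have *: "u = w \<circ> \<sigma> \<longleftrightarrow> w = u \<circ> inv \<sigma>" for u w :: "'k \<Rightarrow> 'n"
          using permutes_inv_o[OF s] by (metis comp_assoc comp_id)
        show "(case pq of (p, q) \<Rightarrow> z p q * of_bool (x = p \<circ> \<sigma> \<and> y = q \<circ> \<sigma>))
          = (if pq = (x \<circ> inv \<sigma>, y \<circ> inv \<sigma>) then z x y else 0)"
          using inv[OF s, of p q] pq by (auto simp: * [symmetric])
      qed
      also have "\<dots> = z x y"
        using finite_tuples[OF fin, where ?'n = 'n] tuples_comp[OF xy(1) si] tuples_comp[OF xy(2) si]
        by (simp add: sum.delta)
      finally show "(\<Sum>(p, q)\<in>tuples I \<times> tuples I. z p q * of_bool (x = p \<circ> \<sigma> \<and> y = q \<circ> \<sigma>)) = z x y" .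
    qed
    also have "\<dots> = of_nat (card ?G) * z x y" by simp
    finally show "1 / of_nat (card ?G) * (\<Sum>(p, q)\<in>tuples I \<times> tuples I. z p q *
        sym_tens I (\<lambda>r. unit_mat (p r) (q r)) x y) = z x y"
      using G by simp
  qed
qed

lemma tensor_mat_single_slot:
  assumes "finite I" "r \<in> I" "x \<in> tuples I" "u \<in> tuples I"
  shows "tensor_mat I ((\<lambda>_. id_mat)(r := Z)) x u = Z (x r) (u r) * of_bool (u = x(r := u r))"
proof -
  have "tensor_mat I ((\<lambda>_. id_mat)(r := Z)) x u = Z (x r) (u r) * (\<Prod>t\<in>I - {r}. id_mat (x t) (u t))"
    using assms(1,2) by (simp add: tensor_mat_def prod.remove)
  also have "(\<Prod>t\<in>I - {r}. id_mat (x t) (u t)) = of_bool (\<forall>t\<in>I - {r}. x t = u t)"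
    using assms(1) by (auto simp: id_mat_def)
  also have "(\<forall>t\<in>I - {r}. x t = u t) \<longleftrightarrow> u = x(r := u r)"
  proof
    assume "\<forall>t\<in>I - {r}. x t = u t"
    then show "u = x(r := u r)" using assms by (intro tuples_eqI[of u I]) (auto intro: tuples_upd)
  next
    assume "u = x(r := u r)"
    then show "\<forall>t\<in>I - {r}. x t = u t" by (metis DiffE fun_upd_other singletonI)
  qed
  finally show ?thesis .
qed

lemma commutes_diagonal_act:
  fixes c :: "('k \<Rightarrow> 'n::finite) \<Rightarrow> ('k \<Rightarrow> 'n) \<Rightarrow> complex"
  assumes fin: "finite I"
    and inv: "\<And>p q x y. x \<in> tuples I \<Longrightarrow> y \<in> tuples I \<Longrightarrow>
      (\<Sum>r\<in>I. of_bool (x r = p) * c (x(r := q)) y) = (\<Sum>r\<in>I. of_bool (y r = q) * c x (y(r := p)))"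
  shows "commutes_on (tuples I) c (diagonal_act I Z)"
proof -
  note f = finite_tuples[OF fin, where ?'n = 'n]
  have unit: "commutes_on (tuples I) c (diagonal_act I (unit_mat p q))" for p q
    unfolding commutes_on_def
  proof (intro ballI)
    fix x y :: "'k \<Rightarrow> 'n" assume xy: "x \<in> tuples I" "y \<in> tuples I"
    have "(\<Sum>u\<in>tuples I. diagonal_act I (unit_mat p q) x u * c u y)
      = (\<Sum>r\<in>I. \<Sum>u\<in>tuples I. if u = x(r := q) then of_bool (x r = p) * c (x(r := q)) y else 0)"
      unfolding diagonal_act_def sum_distrib_right
      by (subst sum.swap, intro sum.cong refl)
        (use xy fin in \<open>auto simp: tensor_mat_single_slot unit_mat_def\<close>)
    also have "\<dots> = (\<Sum>r\<in>I. of_bool (x r = p) * c (x(r := q)) y)"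
      using f xy by (intro sum.cong refl) (simp add: tuples_upd)
    also have "\<dots> = (\<Sum>r\<in>I. of_bool (y r = q) * c x (y(r := p)))" by (rule inv[OF xy])
    also have "\<dots> = (\<Sum>r\<in>I. \<Sum>u\<in>tuples I. if u = y(r := p) then of_bool (y r = q) * c x (y(r := p)) else 0)"
      using f xy by (intro sum.cong refl) (simp add: tuples_upd)
    also have "\<dots> = (\<Sum>u\<in>tuples I. c x u * diagonal_act I (unit_mat p q) u y)"
      unfolding diagonal_act_def sum_distrib_left
    proof (subst sum.swap, intro sum.cong refl)
      fix u :: "'k \<Rightarrow> 'n" and r assume u: "u \<in> tuples I" and r: "r \<in> I"
      have "y = u(r := y r) \<and> u r = p \<longleftrightarrow> u = y(r := p)"
        by (metis fun_upd_same fun_upd_triv fun_upd_upd)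
      then show "(if u = y(r := p) then of_bool (y r = q) * c x (y(r := p)) else 0)
        = c x u * tensor_mat I ((\<lambda>_. id_mat)(r := unit_mat p q)) u y"
        using tensor_mat_single_slot[OF fin r u xy(2), of "unit_mat p q"] by (auto simp: unit_mat_def)
    qed
    finally show "(\<Sum>u\<in>tuples I. c x u * diagonal_act I (unit_mat p q) u y)
      = (\<Sum>u\<in>tuples I. diagonal_act I (unit_mat p q) x u * c u y)" by simp
  qed
  have "commutes_on (tuples I) c (\<lambda>x y. \<Sum>p\<in>UNIV. \<Sum>q\<in>UNIV. Z p q * diagonal_act I (unit_mat p q) x y)"
    by (intro commutes_on_sum commutes_on_scale unit)
  then show ?thesis
  proof (rule commutes_on_cong)
    fix x y :: "'k \<Rightarrow> 'n" assume xy: "x \<in> tuples I" "y \<in> tuples I"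
    have Z: "(\<Sum>p\<in>UNIV. \<Sum>q\<in>UNIV. Z p q * unit_mat p q i j) = Z i j" for i j
    proof -
      have "(\<Sum>p\<in>UNIV. \<Sum>q\<in>UNIV. Z p q * unit_mat p q i j) = (\<Sum>p\<in>UNIV. if p = i then Z i j else 0)"
      proof (intro sum.cong refl)
        fix p
        have "(\<Sum>q\<in>UNIV. Z p q * unit_mat p q i j) = (\<Sum>q\<in>UNIV. if q = j then if p = i then Z i j else 0 else 0)"
          by (intro sum.cong) (auto simp: unit_mat_def)
        then show "(\<Sum>q\<in>UNIV. Z p q * unit_mat p q i j) = (if p = i then Z i j else 0)" by simp
      qed
      then show ?thesis by simp
    qed
    have "(\<Sum>p\<in>UNIV. \<Sum>q\<in>UNIV. Z p q * diagonal_act I (unit_mat p q) x y)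
      = (\<Sum>p\<in>UNIV. \<Sum>q\<in>UNIV. \<Sum>r\<in>I. Z p q * unit_mat p q (x r) (y r) * of_bool (y = x(r := y r)))"
      unfolding diagonal_act_def sum_distrib_left
      by (intro sum.cong refl) (use xy fin in \<open>simp add: tensor_mat_single_slot\<close>)
    also have "\<dots> = (\<Sum>r\<in>I. (\<Sum>p\<in>UNIV. \<Sum>q\<in>UNIV. Z p q * unit_mat p q (x r) (y r)) * of_bool (y = x(r := y r)))"
      unfolding sum_distrib_right by (subst (2) sum.swap, subst sum.swap) simp
    also have "\<dots> = diagonal_act I Z x y"
      unfolding diagonal_act_def Z by (intro sum.cong refl) (use xy fin in \<open>simp add: tensor_mat_single_slot\<close>)
    finally show "(\<Sum>p\<in>UNIV. \<Sum>q\<in>UNIV. Z p q * diagonal_act I (unit_mat p q) x y) = diagonal_act I Z x y" .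
  qed
qed

text \<open>The first fundamental theorem of invariant theory for \<open>gl\<^sub>N\<close>, in the form of a double commutant
theorem: a matrix \<open>c\<close> that commutes with the diagonal action commutes with all
permutation-invariant matrices, and must be shown to lie in the span \<open>D\<close> of the permutation matrices.
Let \<open>l\<close> be the conjugate of the component of \<open>c\<close> orthogonal to \<open>D\<close>, and let \<open>\<Phi>\<close> send a family \<open>\<eta>\<close>
of vectors indexed by \<open>X\<close> to the numbers \<open>l(\<sigma> \<eta>)\<close>, for all permutations \<open>\<sigma>\<close>. Then \<open>\<Phi>\<^sup>* \<Phi>\<close> consists
of permutation-invariant blocks \<open>M\<close>, hence commutes with \<open>c\<close>, and it kills the standard basis \<open>\<xi>\<close>
because \<open>l\<close> is orthogonal to \<open>D\<close>. So \<open>\<Phi>\<^sup>* \<Phi>\<close> kills \<open>c \<xi>\<close>, so does \<open>\<Phi>\<close>, and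
\<open>l(c \<xi>)\<close>, which is the squared norm of the orthogonal component, vanishes.\<close>

theorem gl_invariants_spanned_by_permutations:
  fixes c :: "('k \<Rightarrow> 'n::finite) \<Rightarrow> ('k \<Rightarrow> 'n) \<Rightarrow> complex"
  assumes fin: "finite I"
    and inv: "\<And>p q x y. x \<in> tuples I \<Longrightarrow> y \<in> tuples I \<Longrightarrow>
      (\<Sum>r\<in>I. of_bool (x r = p) * c (x(r := q)) y) = (\<Sum>r\<in>I. of_bool (y r = q) * c x (y(r := p)))"
  obtains \<gamma> where "\<And>x y. x \<in> tuples I \<Longrightarrow> y \<in> tuples I \<Longrightarrow>
    c x y = (\<Sum>\<sigma> | \<sigma> permutes I. \<gamma> \<sigma> * of_bool (y = x \<circ> \<sigma>))"
proof -
  let ?X = "tuples I :: ('k \<Rightarrow> 'n) set" and ?G = "{\<sigma>. \<sigma> permutes I}"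
  define D where "D = range (\<lambda>\<gamma> (x :: 'k \<Rightarrow> 'n, y :: 'k \<Rightarrow> 'n). \<Sum>\<sigma>\<in>?G. \<gamma> \<sigma> * of_bool (y = x \<circ> \<sigma>) :: complex)"
  note f = finite_tuples[OF fin, where ?'n = 'n] and fG = finite_permutations[OF fin]
  have "\<exists>k\<in>D. \<forall>k'\<in>D. (\<Sum>xy\<in>?X \<times> ?X. ((\<lambda>(x, y). c x y) xy - k xy) * cnj (k' xy)) = 0"
  proof (rule orthogonal_projection_exists)
    show "finite (?X \<times> ?X)" using f by simp
    show "(\<lambda>_. 0) \<in> D" unfolding D_def by (rule range_eqI[of _ _ "\<lambda>_. 0"]) (auto simp: fun_eq_iff)
    show "(\<lambda>x. f x + g x) \<in> D" if "f \<in> D" "g \<in> D" for f g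
    proof -
      from that obtain \<gamma> \<delta> where *: "f = (\<lambda>(x, y). \<Sum>\<sigma>\<in>?G. \<gamma> \<sigma> * of_bool (y = x \<circ> \<sigma>))"
        "g = (\<lambda>(x, y). \<Sum>\<sigma>\<in>?G. \<delta> \<sigma> * of_bool (y = x \<circ> \<sigma>))" unfolding D_def by blast
      show ?thesis unfolding D_def
        by (rule range_eqI[of _ _ "\<lambda>\<sigma>. \<gamma> \<sigma> + \<delta> \<sigma>"]) (auto simp: * fun_eq_iff distrib_right sum.distrib simp del: sum_mult_of_bool_eq)
    qed
    show "(\<lambda>x. a * f x) \<in> D" if "f \<in> D" for f a
    proof -
      from that obtain \<gamma> where *: "f = (\<lambda>(x, y). \<Sum>\<sigma>\<in>?G. \<gamma> \<sigma> * of_bool (y = x \<circ> \<sigma>))" unfolding D_def by blast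
      show ?thesis unfolding D_def
        by (rule range_eqI[of _ _ "\<lambda>\<sigma>. a * \<gamma> \<sigma>"]) (auto simp: * fun_eq_iff sum_distrib_left mult.assoc simp del: sum_mult_of_bool_eq)
    qed
  qed
  then obtain k where k: "k \<in> D" and
    orth: "\<And>k'. k' \<in> D \<Longrightarrow> (\<Sum>xy\<in>?X \<times> ?X. ((\<lambda>(x, y). c x y) xy - k xy) * cnj (k' xy)) = 0" by blast
  define l where "l x y = cnj (c x y - k (x, y))" for x y
  \<comment> \<open>orthogonality to \<open>D\<close>, spelled out for the permutation matrices\<close>
  have l_perm: "(\<Sum>u\<in>?X. l (u \<circ> \<sigma>) u) = 0" if s: "\<sigma> permutes I" for \<sigma>
  proof -
    have si: "inv \<sigma> permutes I" by (rule permutes_inv[OF s])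
    have delta: "(\<Sum>\<tau>\<in>?G. of_bool (\<tau> = inv \<sigma>) * g \<tau>) = g (inv \<sigma>)" for g :: "('k \<Rightarrow> 'k) \<Rightarrow> complex"
    proof -
      have "(\<Sum>\<tau>\<in>?G. of_bool (\<tau> = inv \<sigma>) * g \<tau>) = (\<Sum>\<tau>\<in>?G. if \<tau> = inv \<sigma> then g \<tau> else 0)"
        by (intro sum.cong) auto
      then show ?thesis using fG si by simp
    qed
    have inD: "(\<lambda>(x, y). of_bool (y = x \<circ> inv \<sigma>)) \<in> D"
      unfolding D_def by (rule range_eqI[of _ _ "\<lambda>\<tau>. of_bool (\<tau> = inv \<sigma>)"]) (simp only: delta)
    have cnj_bool: "cnj (of_bool P) = of_bool P" for P by (cases P) auto
    from orth[OF inD] have "(\<Sum>xy\<in>?X \<times> ?X. ((\<lambda>(x, y). c x y) xy - k xy) * of_bool (snd xy = fst xy \<circ> inv \<sigma>)) = 0"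
      by (simp only: split_beta cnj_bool)
    then have "(\<Sum>x\<in>?X. \<Sum>y\<in>?X. (c x y - k (x, y)) * of_bool (y = x \<circ> inv \<sigma>)) = 0"
      by (simp add: sum.cartesian_product split_beta del: sum_mult_of_bool_eq)
    also have "(\<Sum>x\<in>?X. \<Sum>y\<in>?X. (c x y - k (x, y)) * of_bool (y = x \<circ> inv \<sigma>))
      = (\<Sum>y\<in>?X. \<Sum>x\<in>?X. if x = y \<circ> \<sigma> then (c (y \<circ> \<sigma>) y - k (y \<circ> \<sigma>, y)) else 0)"
    proof (subst sum.swap, intro sum.cong refl)
      fix x y :: "'k \<Rightarrow> 'n"
      have "y = x \<circ> inv \<sigma> \<longleftrightarrow> x = y \<circ> \<sigma>"
        using permutes_inv_o[OF s] by (metis comp_assoc comp_id)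
      then show "(c x y - k (x, y)) * of_bool (y = x \<circ> inv \<sigma>)
        = (if x = y \<circ> \<sigma> then (c (y \<circ> \<sigma>) y - k (y \<circ> \<sigma>, y)) else 0)" by auto
    qed
    also have "\<dots> = (\<Sum>y\<in>?X. c (y \<circ> \<sigma>) y - k (y \<circ> \<sigma>, y))"
      using f by (intro sum.cong refl) (simp add: tuples_comp[OF _ s])
    finally show ?thesis unfolding l_def by (simp only: cnj_sum[symmetric] complex_cnj_zero)
  qed
  define M where "M y v x u = (\<Sum>\<sigma>\<in>?G. cnj (l (x \<circ> \<sigma>) y) * l (u \<circ> \<sigma>) v)" for y v x u
  have comm: "commutes_on ?X c (M y v)" for y v
  proof (rule commutes_invariant[OF fin commutes_diagonal_act[OF fin inv]])
    fix \<tau> x u assume t: "\<tau> permutes I"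
    show "M y v (x \<circ> \<tau>) (u \<circ> \<tau>) = M y v x u"
      unfolding M_def comp_assoc
      using setum_permutations_compose_left[OF t, of "\<lambda>\<sigma>. cnj (l (x \<circ> \<sigma>) y) * l (u \<circ> \<sigma>) v"] by simp
  qed
  have M0: "(\<Sum>v\<in>?X. M y v x v) = 0" for x y
    unfolding M_def by (subst sum.swap) (simp add: l_perm flip: sum_distrib_left)
  define \<Phi> where "\<Phi> \<sigma> = (\<Sum>v\<in>?X. \<Sum>u\<in>?X. l (u \<circ> \<sigma>) v * c u v)" for \<sigma>
  have "(\<Sum>\<sigma>\<in>?G. cnj (\<Phi> \<sigma>) * \<Phi> \<sigma>) = 0"
  proof -
    have "(\<Sum>\<sigma>\<in>?G. cnj (l (x \<circ> \<sigma>) y) * \<Phi> \<sigma>) = 0" if "x \<in> ?X" "y \<in> ?X" for x y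
    proof -
      have "(\<Sum>\<sigma>\<in>?G. cnj (l (x \<circ> \<sigma>) y) * \<Phi> \<sigma>) = (\<Sum>v\<in>?X. \<Sum>u\<in>?X. M y v x u * c u v)"
        unfolding M_def \<Phi>_def sum_distrib_left sum_distrib_right
        by (subst sum.swap, rule sum.cong[OF refl], subst sum.swap) (simp add: mult.assoc)
      also have "\<dots> = (\<Sum>v\<in>?X. \<Sum>u\<in>?X. c x u * M y v u v)"
      proof (rule sum.cong[OF refl])
        fix v assume "v \<in> ?X"
        then show "(\<Sum>u\<in>?X. M y v x u * c u v) = (\<Sum>u\<in>?X. c x u * M y v u v)"
          using comm[of y v] that unfolding commutes_on_def by simp
      qed
      also have "\<dots> = 0" by (subst sum.swap) (simp add: M0 flip: sum_distrib_left)
      finally show ?thesis .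
    qed
    moreover have "(\<Sum>\<sigma>\<in>?G. cnj (\<Phi> \<sigma>) * \<Phi> \<sigma>)
      = (\<Sum>y\<in>?X. \<Sum>x\<in>?X. cnj (c x y) * (\<Sum>\<sigma>\<in>?G. cnj (l (x \<circ> \<sigma>) y) * \<Phi> \<sigma>))"
    proof -
      have "cnj (\<Phi> \<sigma>) * \<Phi> \<sigma> = (\<Sum>y\<in>?X. \<Sum>x\<in>?X. cnj (c x y) * (cnj (l (x \<circ> \<sigma>) y) * \<Phi> \<sigma>))" for \<sigma>
        by (subst \<Phi>_def) (simp add: sum_distrib_left sum_distrib_right mult.assoc mult.commute mult.left_commute)
      then show ?thesis
        unfolding sum_distrib_left by (simp add: sum.swap[of _ ?G])
    qed
    ultimately show ?thesis by simp
  qed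
  then have "\<forall>\<sigma>\<in>?G. \<Phi> \<sigma> = 0"
    using sum_mult_cnj_eq_0_iff[OF fG, of \<Phi>] by (simp add: mult.commute)
  then have "\<Phi> id = 0" using permutes_id[of I] by blast
  moreover have "(\<Sum>xy\<in>?X \<times> ?X. cnj ((\<lambda>(x, y). c x y) xy - k xy) * k xy) = 0"
    using arg_cong[OF orth[OF k], of cnj] by simp
  ultimately have "(\<Sum>xy\<in>?X \<times> ?X. cnj ((\<lambda>(x, y). c x y) xy - k xy) * ((\<lambda>(x, y). c x y) xy - k xy)) = 0"
    unfolding \<Phi>_def l_def right_diff_distrib[of "cnj _"] sum_subtractf
    by (subst (asm) sum.swap) (simp add: sum.cartesian_product split_beta)
  then have "\<forall>xy\<in>?X \<times> ?X. (\<lambda>(x, y). c x y) xy - k xy = 0"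
    using sum_mult_cnj_eq_0_iff[of "?X \<times> ?X" "\<lambda>xy. (\<lambda>(x, y). c x y) xy - k xy"] f
    by (simp add: mult.commute)
  moreover obtain \<gamma> where "k = (\<lambda>(x, y). \<Sum>\<sigma>\<in>?G. \<gamma> \<sigma> * of_bool (y = x \<circ> \<sigma>))"
    using k unfolding D_def by blast
  ultimately show ?thesis using that[of \<gamma>] by auto
qed

section \<open>Computing in the enveloping algebra\<close>

lemma uea_gen_add: "uea_gen (x + y) = uea_gen x + uea_gen y"
  by transfer (use uea_ideal_gen_add in \<open>simp add: uea_rel_def diff_diff_eq\<close>)

lemma uea_gen_lscale: "uea_gen (lscale c x) = uea_const c * uea_gen x"
  by transfer (use uea_ideal_gen_scale in \<open>simp add: uea_rel_def\<close>)

lemma uea_gen_bracket: "uea_gen (lie_bracket x y) = uea_gen x * uea_gen y - uea_gen y * uea_gen x"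
  by transfer (use uea_ideal_uminus[OF uea_ideal_gen_bracket] in \<open>simp add: uea_rel_def algebra_simps\<close>)

lemma uea_gen_zero: "uea_gen 0 = 0"
  using uea_gen_add[of 0 0] by simp

lemma uea_gen_diff: "uea_gen (x - y) = uea_gen x - uea_gen y"
  using uea_gen_add[of "x - y" y] by simp

lemma uea_gen_sum: "uea_gen (sum f A) = (\<Sum>a\<in>A. uea_gen (f a))"
  by (induction A rule: infinite_finite_induct) (simp_all add: uea_gen_zero uea_gen_add)

lemma uea_rel_refl: "uea_rel p p"
  by (simp add: uea_rel_def uea_ideal_zero)

lemma uea_const_zero: "uea_const 0 = 0"
  by transfer (simp add: uea_rel_refl)

lemma uea_const_one: "uea_const 1 = 1"
  by transfer (simp add: uea_rel_refl)

lemma uea_const_add: "uea_const (c + d) = uea_const c + uea_const d"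
  by transfer (simp add: uea_rel_refl single_add)

lemma uea_const_uminus: "uea_const (- c) = - uea_const c"
  using uea_const_add[of c "- c"] by (simp add: uea_const_zero eq_neg_iff_add_eq_0 add.commute)

text \<open>Constants are supported on the empty word.\<close>

lemma uea_const_central: "uea_const c * u = u * uea_const c"
proof transfer
  fix c and p :: "'a word \<Rightarrow>\<^sub>0 complex"
  have "free_const c * p = p * free_const c"
    by (induction p rule: poly_mapping_single_induct)
      (simp_all add: distrib_left distrib_right mult_single mult.commute)
  then show "uea_rel (free_const c * p) (p * free_const c)" by (simp add: uea_rel_refl)
qed

lemma trace_alg_const: "uea_const c \<in> trace_alg"
  and trace_alg_add: "x \<in> trace_alg \<Longrightarrow> y \<in> trace_alg \<Longrightarrow> x + y \<in> trace_alg"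
  and trace_alg_mult: "x \<in> trace_alg \<Longrightarrow> y \<in> trace_alg \<Longrightarrow> x * y \<in> trace_alg"
  and trace_alg_elt: "bs \<noteq> [] \<Longrightarrow> trace_elt bs \<in> trace_alg"
  unfolding trace_alg_def by (auto intro: subalgebra_generated.intros)

lemma trace_alg_zero: "0 \<in> trace_alg"
  and trace_alg_one: "1 \<in> trace_alg"
  using trace_alg_const[of 0] trace_alg_const[of 1] by (simp_all add: uea_const_zero uea_const_one)

lemma trace_alg_diff: "x \<in> trace_alg \<Longrightarrow> y \<in> trace_alg \<Longrightarrow> x - y \<in> trace_alg"
  using trace_alg_add[OF _ trace_alg_mult[OF trace_alg_const[of "- 1"]], of x y]
  by (simp add: uea_const_uminus uea_const_one)

lemma trace_alg_diff_iff: "x - y \<in> trace_alg \<Longrightarrow> x \<in> trace_alg \<longleftrightarrow> y \<in> trace_alg"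
  using trace_alg_add[of "x - y" y] trace_alg_diff[of x "x - y"] by auto

lemma trace_alg_sum: "(\<And>a. a \<in> A \<Longrightarrow> f a \<in> trace_alg) \<Longrightarrow> sum f A \<in> trace_alg"
  by (induction A rule: infinite_finite_induct) (auto intro: trace_alg_zero trace_alg_add)

lemma trace_alg_of_nat: "of_nat m \<in> trace_alg"
  by (induction m) (auto intro: trace_alg_zero trace_alg_add trace_alg_one)

lemma gl_bracket_unit:
  "lie_bracket (gl_unit i j) (gl_unit k l)
    = (if j = k then gl_unit i l else 0) - (if l = i then gl_unit k j else 0)"
proof transfer
  fix i j k l :: 'a
  have *: "(\<chi> k' l'. if k' = i \<and> l' = j then 1 else 0) ** (\<chi> k' l'. if k' = k \<and> l' = l then 1 else 0)
     = (if j = k then (\<chi> k' l'. if k' = i \<and> l' = l then 1 else 0) else (0 :: complex^'a^'a))" for i j k l :: 'a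
  proof -
    have "(\<Sum>m\<in>UNIV. (if x = i \<and> m = j then 1 else 0) * (if m = k \<and> y = l then 1 else 0))
      = (\<Sum>m\<in>UNIV. if m = j then if x = i \<and> j = k \<and> y = l then 1 else (0::complex) else 0)" for x y
      by (intro sum.cong) auto
    then show ?thesis by (auto simp: matrix_matrix_mult_def vec_eq_iff)
  qed
  show "(\<chi> k' l'. if k' = i \<and> l' = j then 1 else 0) ** (\<chi> k' l'. if k' = k \<and> l' = l then 1 else 0) -
        (\<chi> k' l'. if k' = k \<and> l' = l then 1 else 0) ** (\<chi> k' l'. if k' = i \<and> l' = j then 1 else 0)
    = (if j = k then (\<chi> k' l'. if k' = i \<and> l' = l then 1 else 0) else 0) -
      (if l = i then (\<chi> k' l'. if k' = k \<and> l' = j then 1 else 0) else (0 :: complex^'a^'a))"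
    unfolding * ..
qed

lemma gl_tensor_diff: "gl_tensor (X - Y) b = gl_tensor X b - gl_tensor Y b"
  by transfer (simp add: vec_eq_iff of_C_diff left_diff_distrib)

lemma gl_tensor_zero: "gl_tensor 0 b = 0"
  using gl_tensor_diff[of 0 0 b] by simp

definition gE :: "'n \<Rightarrow> 'n \<Rightarrow> laurent \<Rightarrow> (laurent, 'n::finite) gl uea" where
  "gE i j b = uea_gen (gl_tensor (gl_unit i j) b)"

lemma gE_commutator:
  "gE i j b * gE k l c - gE k l c * gE i j b
    = (if j = k then gE i l (b * c) else 0) - (if l = i then gE k j (b * c) else 0)"
  unfolding gE_def uea_gen_bracket[symmetric] bracket_gl_tensor gl_bracket_unit
  by (auto simp: gl_tensor_diff uea_gen_diff gl_tensor_zero uea_gen_zero)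

section \<open>The trace algebra commutes with the constant matrices\<close>

text \<open>The entries \<open>A\<^sub>i\<^sub>j\<close> transform under the commutator with \<open>gl\<^sub>N\<close> like the matrix units.\<close>

definition covariant :: "('n \<Rightarrow> 'n \<Rightarrow> (laurent, 'n::finite) gl uea) \<Rightarrow> bool" where
  "covariant A \<longleftrightarrow> (\<forall>p q i j. gE p q 1 * A i j - A i j * gE p q 1
    = (if q = i then A p j else 0) - (if j = p then A i q else 0))"

text \<open>In the product rule the two terms with a summation index fixed to \<open>p\<close> or \<open>q\<close> cancel.\<close>

lemma covariant_mult:
  fixes A B :: "'n::finite \<Rightarrow> 'n \<Rightarrow> (laurent, 'n) gl uea"
  assumes "covariant A" "covariant B"
  shows "covariant (\<lambda>i j. \<Sum>k\<in>UNIV. A i k * B k j)"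
  unfolding covariant_def
proof (intro allI)
  fix p q i j :: 'n
  let ?X = "gE p q 1"
  have cA: "?X * A i k - A i k * ?X = (if q = i then A p k else 0) - (if k = p then A i q else 0)"
    and cB: "?X * B k j - B k j * ?X = (if q = k then B p j else 0) - (if j = p then B k q else 0)" for k
    using assms by (simp_all only: covariant_def)
  have "?X * (\<Sum>k\<in>UNIV. A i k * B k j) - (\<Sum>k\<in>UNIV. A i k * B k j) * ?X
    = (\<Sum>k\<in>UNIV. (?X * A i k - A i k * ?X) * B k j + A i k * (?X * B k j - B k j * ?X))"
    by (simp add: sum_distrib_left sum_distrib_right sum_subtractf[symmetric] algebra_simps)
  also have "\<dots> = (\<Sum>k\<in>UNIV. (if q = i then A p k * B k j else 0) - (if k = p then A i q * B p j else 0)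
      + ((if k = q then A i q * B p j else 0) - (if j = p then A i k * B k q else 0)))"
    unfolding cA cB by (intro sum.cong refl) (auto simp: left_diff_distrib right_diff_distrib)
  also have "\<dots> = (if q = i then \<Sum>k\<in>UNIV. A p k * B k j else 0) - (if j = p then \<Sum>k\<in>UNIV. A i k * B k q else 0)"
    by (auto simp: sum.distrib sum_subtractf)
  finally show "?X * (\<Sum>k\<in>UNIV. A i k * B k j) - (\<Sum>k\<in>UNIV. A i k * B k j) * ?X
    = (if q = i then \<Sum>k\<in>UNIV. A p k * B k j else 0) - (if j = p then \<Sum>k\<in>UNIV. A i k * B k q else 0)" .
qed

lemma covariant_trace:
  assumes "covariant A"
  shows "gE p q 1 * (\<Sum>i\<in>UNIV. A i i) = (\<Sum>i\<in>UNIV. A i i) * gE p q 1"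
proof -
  have "gE p q 1 * (\<Sum>i\<in>UNIV. A i i) - (\<Sum>i\<in>UNIV. A i i) * gE p q 1
    = (\<Sum>i\<in>UNIV. gE p q 1 * A i i - A i i * gE p q 1)"
    by (simp add: sum_distrib_left sum_distrib_right sum_subtractf)
  also have "\<dots> = (\<Sum>i\<in>UNIV. (if i = q then A p q else 0) - (if i = p then A p q else 0))"
    using assms unfolding covariant_def by (intro sum.cong) auto
  also have "\<dots> = 0" by (simp add: sum_subtractf)
  finally show ?thesis by simp
qed

text \<open>The entries of the product of the matrices \<open>(E\<^sub>i\<^sub>j(b))\<^sub>i\<^sub>j\<close>, for \<open>b\<close> in the list; the elements
\<open>T\<^sub>k\<close> are the traces of these products.\<close>

primrec gE_path :: "laurent list \<Rightarrow> 'n \<Rightarrow> 'n \<Rightarrow> (laurent, 'n::finite) gl uea" where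
  "gE_path [] i j = (if i = j then 1 else 0)"
| "gE_path (b # bs) i j = (\<Sum>k\<in>UNIV. gE i k b * gE_path bs k j)"

lemma covariant_gE: "covariant (\<lambda>i j. gE i j b)"
  unfolding covariant_def by (simp add: gE_commutator)

lemma covariant_gE_path: "covariant (gE_path bs)"
proof (induction bs)
  case Nil
  then show ?case by (auto simp: covariant_def)
next
  case (Cons b bs)
  have "gE_path (b # bs) = (\<lambda>i j. \<Sum>k\<in>UNIV. gE i k b * gE_path bs k j)" by (intro ext) simp
  then show ?case using covariant_mult[OF covariant_gE Cons] by simp
qed

lemma gE_path_eq:
  "gE_path bs i j = (\<Sum>is | length is = Suc (length bs) \<and> is ! 0 = i \<and> is ! length bs = j.
     \<Prod>r\<leftarrow>[0..<length bs]. gE (is ! r) (is ! Suc r) (bs ! r))"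
proof (induction bs arbitrary: i)
  case Nil
  have "{is. length is = Suc 0 \<and> is ! 0 = i \<and> is ! 0 = j} = (if i = j then {[i]} else {})"
    by (auto simp: length_Suc_conv)
  then show ?case by simp
next
  case (Cons b bs)
  let ?n = "length bs"
  let ?S = "\<lambda>k. {is. length is = Suc ?n \<and> is ! 0 = k \<and> is ! ?n = j}"
  have fin: "finite (?S k)" for k
    by (rule finite_subset[OF _ finite_lists_length_eq[of UNIV "Suc ?n"]]) auto
  have upt: "[0..<Suc ?n] = 0 # map Suc [0..<?n]"
    by (simp add: upt_conv_Cons map_Suc_upt del: upt_Suc)
  have "{is. length is = Suc (length (b # bs)) \<and> is ! 0 = i \<and> is ! length (b # bs) = j}
    = (#) i ` (\<Union>k\<in>UNIV. ?S k)"
    by (auto simp: length_Suc_conv image_iff)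
  then have "(\<Sum>is | length is = Suc (length (b # bs)) \<and> is ! 0 = i \<and> is ! length (b # bs) = j.
       \<Prod>r\<leftarrow>[0..<length (b # bs)]. gE (is ! r) (is ! Suc r) ((b # bs) ! r))
    = (\<Sum>is\<in>(\<Union>k\<in>UNIV. ?S k). \<Prod>r\<leftarrow>[0..<Suc ?n]. gE ((i # is) ! r) ((i # is) ! Suc r) ((b # bs) ! r))"
    by (simp only: sum.reindex inj_on_Cons1 comp_def length_Cons)
  also have "\<dots> = (\<Sum>k\<in>UNIV. \<Sum>is\<in>?S k. \<Prod>r\<leftarrow>[0..<Suc ?n]. gE ((i # is) ! r) ((i # is) ! Suc r) ((b # bs) ! r))"
    by (rule sum.UNION_disjoint) (use fin in auto)
  also have "\<dots> = (\<Sum>k\<in>UNIV. \<Sum>is\<in>?S k. gE i k b * (\<Prod>r\<leftarrow>[0..<?n]. gE (is ! r) (is ! Suc r) (bs ! r)))"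
    by (intro sum.cong refl) (simp add: upt comp_def del: upt_Suc)
  also have "\<dots> = gE_path (b # bs) i j"
    by (simp add: Cons sum_distrib_left)
  finally show ?case ..
qed

lemma trace_elt_eq_trace:
  assumes "bs \<noteq> []"
  shows "trace_elt bs = (\<Sum>i\<in>UNIV. gE_path bs i i :: (laurent, 'n::finite) gl uea)"
proof -
  let ?n = "length bs"
  let ?S = "\<lambda>i :: 'n. {is. length is = Suc ?n \<and> is ! 0 = i \<and> is ! ?n = i}"
  let ?f = "\<lambda>is :: 'n list. \<Prod>r\<leftarrow>[0..<?n]. gE (is ! r) (is ! Suc r) (bs ! r)"
  have fin: "finite (?S k)" for k
    by (rule finite_subset[OF _ finite_lists_length_eq[of UNIV "Suc ?n"]]) auto
  have n: "?n > 0" using assms by simp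
  have "(\<Union>i\<in>UNIV. ?S i) = (\<lambda>is. is @ [hd is]) ` {is. length is = ?n}"
  proof (intro equalityI subsetI)
    fix ks assume "ks \<in> (\<Union>i\<in>UNIV. ?S i)"
    then have ks: "length ks = Suc ?n" "ks ! 0 = ks ! ?n" by auto
    then obtain ys z where yz: "ks = ys @ [z]" "length ys = ?n" by (cases ks rule: rev_cases) auto
    moreover have "ys \<noteq> []" using yz(2) n by auto
    ultimately have "ks = butlast ks @ [hd (butlast ks)]"
      using n ks(2) by (simp add: nth_append hd_conv_nth)
    then show "ks \<in> (\<lambda>is. is @ [hd is]) ` {is. length is = ?n}" using ks(1) by (intro image_eqI) auto
  next
    fix ks :: "'n list" assume "ks \<in> (\<lambda>is. is @ [hd is]) ` {is. length is = ?n}"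
    then obtain ys where ys: "ks = ys @ [hd ys]" "length ys = ?n" by auto
    moreover have "ys \<noteq> []" using ys(2) n by auto
    ultimately show "ks \<in> (\<Union>i\<in>UNIV. ?S i)" using n by (simp add: nth_append hd_conv_nth)
  qed
  moreover have "(\<Sum>i\<in>UNIV. gE_path bs i i) = (\<Sum>is\<in>(\<Union>i\<in>UNIV. ?S i). ?f is)"
    unfolding gE_path_eq by (rule sum.UNION_disjoint[symmetric]) (use fin in auto)
  ultimately have "(\<Sum>i\<in>UNIV. gE_path bs i i) = (\<Sum>is | length is = ?n. ?f (is @ [hd is]))"
    by (simp add: sum.reindex inj_on_def)
  also have "\<dots> = trace_elt bs"
    unfolding trace_elt_def gE_def
  proof (rule sum.cong[OF refl], rule arg_cong[where f = prod_list], rule map_cong[OF refl])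
    fix "is" :: "'n list" and r assume "is \<in> {is. length is = ?n}" "r \<in> set [0..<?n]"
    then have "length is = ?n" "r < ?n" by auto
    moreover from this n have "is \<noteq> []" by auto
    moreover from calculation n have "(is @ [hd is]) ! Suc r = is ! (Suc r mod ?n)"
      by (cases "Suc r = ?n") (auto simp: nth_append hd_conv_nth)
    ultimately show "uea_gen (gl_tensor (gl_unit ((is @ [hd is]) ! r) ((is @ [hd is]) ! Suc r)) (bs ! r))
      = uea_gen (gl_tensor (gl_unit (is ! r) (is ! (Suc r mod ?n))) (bs ! r))"
      by (simp add: nth_append)
  qed
  finally show ?thesis ..
qed

lemma gl_tensor_one_expand:
  "gl_tensor X (1 :: laurent) = (\<Sum>p\<in>UNIV. \<Sum>q\<in>UNIV. lscale (mat_of_gl X $ p $ q) (gl_tensor (gl_unit p q) 1))"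
proof -
  have s: "mat_of_gl (sum f A) = (\<Sum>a\<in>A. mat_of_gl (f a))" for f :: "'x \<Rightarrow> (laurent, 'a) gl" and A
    by (induction A rule: infinite_finite_induct) (simp_all add: zero_gl.rep_eq plus_gl.rep_eq)
  have "(\<Sum>p\<in>UNIV. \<Sum>q\<in>UNIV. of_C (mat_of_gl X $ p $ q) * (of_C (if i = p \<and> j = q then 1 else 0) :: laurent))
     = of_C (mat_of_gl X $ i $ j)" for i j
  proof -
    have "(\<Sum>p\<in>UNIV. \<Sum>q\<in>UNIV. of_C (mat_of_gl X $ p $ q) * (of_C (if i = p \<and> j = q then 1 else 0) :: laurent))
      = (\<Sum>p\<in>UNIV. \<Sum>q\<in>UNIV. if q = j then if p = i then of_C (mat_of_gl X $ i $ j) else 0 else 0)"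
      by (intro sum.cong) (auto simp: of_C_zero of_C_one)
    then show ?thesis by simp
  qed
  then show ?thesis
    by (simp add: mat_of_gl_inject[symmetric] s gl_tensor.rep_eq lscale_gl.rep_eq gl_unit.rep_eq vec_eq_iff)
qed

theorem trace_alg_commutes_gl:
  assumes "x \<in> trace_alg"
  shows "uea_gen (gl_tensor X 1) * x = x * uea_gen (gl_tensor X 1)"
proof -
  have "gE p q 1 * x = x * gE p q 1" for p q
    using assms unfolding trace_alg_def
  proof (induction rule: subalgebra_generated.induct)
    case (subalgebra_gen x)
    then show ?case
      using covariant_trace[OF covariant_gE_path] by (auto simp: trace_elt_eq_trace)
  next
    case (subalgebra_const c)
    then show ?case by (simp add: uea_const_central)
  next
    case (subalgebra_add x y)
    then show ?case by (simp add: distrib_left distrib_right)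
  next
    case (subalgebra_mult x y)
    have "gE p q 1 * (x * y) = (gE p q 1 * x) * y" by (simp only: mult.assoc)
    also have "\<dots> = x * (gE p q 1 * y)" by (simp only: subalgebra_mult.IH mult.assoc)
    also have "\<dots> = x * y * gE p q 1" by (simp only: subalgebra_mult.IH mult.assoc)
    finally show ?case .
  qed
  then have "uea_const c * gE p q 1 * x = x * (uea_const c * gE p q 1)" for c p q
    by (simp only: uea_const_central[of c] mult.assoc) (simp only: mult.assoc[symmetric])
  moreover have "uea_gen (gl_tensor X 1) = (\<Sum>p\<in>UNIV. \<Sum>q\<in>UNIV. uea_const (mat_of_gl X $ p $ q) * gE p q 1)"
    by (subst gl_tensor_one_expand) (simp only: uea_gen_sum uea_gen_lscale gE_def)
  ultimately show ?thesis
    by (simp add: sum_distrib_left sum_distrib_right)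
qed

section \<open>Permuted traces\<close>

lemma sum_PiE_insert:
  assumes "i \<notin> M"
  shows "(\<Sum>e\<in>PiE (insert i M) B. h e) = (\<Sum>e\<in>PiE M B. \<Sum>b\<in>B i. h (e(i := b)))"
proof -
  have "(\<Sum>e\<in>PiE (insert i M) B. h e) = (\<Sum>(b, e)\<in>B i \<times> PiE M B. h (e(i := b)))"
    unfolding PiE_insert_eq
    by (subst sum.reindex) (use assms inj_combinator[of i M B] in \<open>auto simp: split_beta\<close>)
  also have "\<dots> = (\<Sum>e\<in>PiE M B. \<Sum>b\<in>B i. h (e(i := b)))"
    by (subst sum.swap) (simp add: sum.cartesian_product)
  finally show ?thesis .
qed

lemma sum_tuples_insert:
  fixes h :: "('k \<Rightarrow> 'n::finite) \<Rightarrow> 'c::comm_monoid_add"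
  shows "a \<notin> S \<Longrightarrow> (\<Sum>\<nu>\<in>tuples (insert a S). h \<nu>) = (\<Sum>\<nu>\<in>tuples S. \<Sum>t\<in>UNIV. h (\<nu>(a := t)))"
  unfolding tuples_def by (rule sum_PiE_insert)

definition letter :: "('k \<Rightarrow> 'n) \<Rightarrow> 'k \<times> 'k \<times> laurent \<Rightarrow> (laurent, 'n::finite) gl uea" where
  "letter \<nu> = (\<lambda>(p, q, b). gE (\<nu> p) (\<nu> q) b)"

text \<open>A letter \<open>(p, q, b)\<close> stands for \<open>E(b)\<close> with row index \<open>\<nu> p\<close> and column index \<open>\<nu> q\<close>, and the
summation is over all values \<open>\<nu>\<close> of the index variables in \<open>S\<close>. Working with named variables
instead of a permutation makes it easy to identify two variables, or to eliminate one.\<close>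

definition index_sum :: "'k set \<Rightarrow> ('k \<times> 'k \<times> laurent) list \<Rightarrow> (laurent, 'n::finite) gl uea" where
  "index_sum S u = (\<Sum>\<nu>\<in>tuples S. prod_list (map (letter \<nu>) u))"

text \<open>Each variable of \<open>S\<close> is exactly once a row and exactly once a column. Sending the row of each letter
to its column is then a permutation of \<open>S\<close>, and the sum is a permuted trace.\<close>

definition matched :: "'k set \<Rightarrow> ('k \<times> 'k \<times> 'b) list \<Rightarrow> bool" where
  "matched S u \<longleftrightarrow> distinct (map fst u) \<and> set (map fst u) = S \<and>
    distinct (map (fst \<circ> snd) u) \<and> set (map (fst \<circ> snd) u) = S"

lemma matched_mset: "mset u = mset u' \<Longrightarrow> matched S u \<longleftrightarrow> matched S u'"
proof -
  assume "mset u = mset u'"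
  then have "mset (map f u) = mset (map f u')" for f :: "_ \<Rightarrow> 'a" by simp
  then show ?thesis
    unfolding matched_def using mset_eq_imp_distinct_iff mset_eq_setD by blast
qed

lemma matched_finite: "matched S u \<Longrightarrow> finite S"
  by (auto simp: matched_def)

lemma letter_cong: "(\<And>p. p \<in> {fst x, fst (snd x)} \<Longrightarrow> \<nu> p = \<nu>' p) \<Longrightarrow> letter \<nu> x = letter \<nu>' x"
  by (auto simp: letter_def split_beta)

text \<open>This is one half of the commutator of two neighbouring letters. The condition \<open>\<nu> q = \<nu> p'\<close> eliminates
the variable \<open>p'\<close>, which occurs once more as a column and is renamed to \<open>q\<close> there. If \<open>p'\<close> and \<open>q\<close> are
the same variable, it disappears and its free summation contributes the factor \<open>N\<close>.\<close>

lemma index_sum_contract: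
  fixes S :: "'k set"
  assumes m: "matched S (\<alpha> @ (p, q, b) # (p', q', b') # \<beta>)"
  shows "\<exists>(S' :: 'k set) u m. matched S' u \<and> length u = Suc (length \<alpha> + length \<beta>) \<and>
    (\<Sum>\<nu>\<in>tuples S. prod_list (map (letter \<nu>) \<alpha>) *
      (if \<nu> q = \<nu> p' then gE (\<nu> p) (\<nu> q') (b * b') else 0) * prod_list (map (letter \<nu>) \<beta>))
    = (of_nat m * index_sum S' u :: (laurent, 'n::finite) gl uea)"
    (is "\<exists>S' u m. _ S' u \<and> _ S' u \<and> ?L = _ S' u m")
proof -
  \<comment> \<open>only the column \<open>p'\<close> is renamed, since the row \<open>p'\<close> is contracted away\<close>
  define f where "f v = (if v = p' then q else v)" for v
  define S' where "S' = S - {p'}"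
  define w where "w = \<alpha> @ (p, q', b * b') # \<beta>"
  define u where "u = map (\<lambda>(r, c, b). (r, f c, b)) w"
  have S: "S = insert p' S'" "p' \<notin> S'" using m by (auto simp: matched_def S'_def)
  have rows: "distinct (map fst w)" "set (map fst w) = S'"
  proof -
    have "distinct (map fst \<alpha> @ p # p' # map fst \<beta>)" "S = set (map fst \<alpha> @ p # p' # map fst \<beta>)"
      using m by (simp_all add: matched_def)
    moreover have "map fst w = map fst \<alpha> @ p # map fst \<beta>" by (simp add: w_def)
    ultimately show "distinct (map fst w)" "set (map fst w) = S'" by (auto simp: S'_def)
  qed
  have cols: "distinct (map (fst \<circ> snd) w)" "set (map (fst \<circ> snd) w) = S - {q}"
  proof -
    let ?h = "map (fst \<circ> snd)"
    have "distinct (?h \<alpha> @ q # q' # ?h \<beta>)" "S = set (?h \<alpha> @ q # q' # ?h \<beta>)"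
      using m by (simp_all add: matched_def)
    moreover have "?h w = ?h \<alpha> @ q' # ?h \<beta>" by (simp add: w_def)
    ultimately show "distinct (?h w)" "set (?h w) = S - {q}" by auto
  qed
  have qS: "q \<in> S" and p'S: "p' \<in> S" using m by (auto simp: matched_def)
  have fu: "map fst u = map fst w" "map (fst \<circ> snd) u = map f (map (fst \<circ> snd) w)"
    by (auto simp: u_def)
  have "inj_on f (S - {q})" by (auto simp: inj_on_def f_def)
  moreover have "f ` (S - {q}) = S'" using qS p'S by (auto simp: f_def S'_def image_iff)
  ultimately have "matched S' u"
    unfolding matched_def fu using rows cols by (metis distinct_map set_map inj_on_subset order_refl)
  moreover have "length u = Suc (length \<alpha> + length \<beta>)" by (simp add: u_def w_def)
  moreover define m where "m = (if q = p' then CARD('n) else 1)"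
  have "?L = (of_nat m * index_sum S' u :: (laurent, 'n) gl uea)"
  proof -
    have "?L = (\<Sum>\<nu>\<in>tuples S. if \<nu> q = \<nu> p' then prod_list (map (letter \<nu>) w) else 0)"
      by (intro sum.cong) (auto simp: w_def letter_def mult.assoc)
    also have "\<dots> = (\<Sum>\<nu>\<in>tuples S'. \<Sum>t\<in>UNIV. if (\<nu>(p' := t)) q = t then prod_list (map (letter (\<nu>(p' := t))) w) else 0)"
      unfolding S(1) by (subst sum_tuples_insert[OF S(2)]) simp
    also have "\<dots> = (\<Sum>\<nu>\<in>tuples S'. of_nat m * prod_list (map (letter \<nu>) u))"
    proof (intro sum.cong refl)
      fix \<nu> :: "'k \<Rightarrow> 'n"
      have *: "map (letter (\<nu>(p' := t))) w = map (letter \<nu>) u" if "(\<nu>(p' := t)) q = t" for t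
        unfolding u_def map_map
      proof (rule map_cong[OF refl])
        fix x assume x: "x \<in> set w"
        obtain r c d where [simp]: "x = (r, c, d)" by (cases x)
        have "r \<noteq> p'" using x rows(2) S(2) by force
        moreover have "(\<nu>(p' := t)) c = \<nu> (f c)"
        proof (cases "q = p'")
          case True
          then have "c \<noteq> p'" using x cols(2) by force
          then show ?thesis by (simp add: f_def)
        qed (use that in \<open>auto simp: f_def\<close>)
        ultimately show "letter (\<nu>(p' := t)) x = (letter \<nu> \<circ> (\<lambda>(r, c, b). (r, f c, b))) x"
          by (simp add: letter_def)
      qed
      have "(\<Sum>t\<in>UNIV. if (\<nu>(p' := t)) q = t then prod_list (map (letter (\<nu>(p' := t))) w) else 0)
        = (\<Sum>t\<in>UNIV. if q = p' \<or> t = \<nu> q then prod_list (map (letter \<nu>) u) else 0)"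
        by (intro sum.cong refl) (use * in auto)
      also have "\<dots> = of_nat m * prod_list (map (letter \<nu>) u)" by (cases "q = p'") (simp_all add: m_def)
      finally show "(\<Sum>t\<in>UNIV. if (\<nu>(p' := t)) q = t then prod_list (map (letter (\<nu>(p' := t))) w) else 0)
        = of_nat m * prod_list (map (letter \<nu>) u)" .
    qed
    finally show ?thesis by (simp add: index_sum_def sum_distrib_left)
  qed
  ultimately show ?thesis by blast
qed

lemma index_sum_swap:
  fixes S :: "'k set"
  assumes IH: "\<And>(S :: 'k set) u. matched S u \<Longrightarrow> length u < n \<Longrightarrow> (index_sum S u :: (laurent, 'n::finite) gl uea) \<in> trace_alg"
    and m: "matched S (\<alpha> @ x # y # \<beta>)" and n: "n = length (\<alpha> @ x # y # \<beta>)"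
  shows "(index_sum S (\<alpha> @ x # y # \<beta>) - index_sum S (\<alpha> @ y # x # \<beta>) :: (laurent, 'n) gl uea) \<in> trace_alg"
proof -
  obtain p q b p' q' b' where xy: "x = (p, q, b)" "y = (p', q', b')" by (metis prod_cases3)
  have m': "matched S (\<alpha> @ y # x # \<beta>)" using m by (subst matched_mset) auto
  have "(index_sum S (\<alpha> @ x # y # \<beta>) - index_sum S (\<alpha> @ y # x # \<beta>) :: (laurent, 'n) gl uea)
    = (\<Sum>\<nu>\<in>tuples S. prod_list (map (letter \<nu>) \<alpha>) *
      (letter \<nu> x * letter \<nu> y - letter \<nu> y * letter \<nu> x) * prod_list (map (letter \<nu>) \<beta>))"
    by (simp add: index_sum_def sum_subtractf algebra_simps)
  also have "\<dots> = (\<Sum>\<nu>\<in>tuples S. prod_list (map (letter \<nu>) \<alpha>) *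
      (if \<nu> q = \<nu> p' then gE (\<nu> p) (\<nu> q') (b * b') else 0) * prod_list (map (letter \<nu>) \<beta>))
    - (\<Sum>\<nu>\<in>tuples S. prod_list (map (letter \<nu>) \<alpha>) *
      (if \<nu> q' = \<nu> p then gE (\<nu> p') (\<nu> q) (b' * b) else 0) * prod_list (map (letter \<nu>) \<beta>))" (is "_ = ?A - ?B")
    unfolding sum_subtractf[symmetric]
    by (intro sum.cong refl)
      (simp only: xy letter_def split_conv gE_commutator mult.commute[of b' b] right_diff_distrib left_diff_distrib)
  also have "\<dots> \<in> trace_alg"
  proof -
    obtain S1 :: "'k set" and u1 m1 where 1: "matched S1 u1" "length u1 = Suc (length \<alpha> + length \<beta>)"
      "?A = (of_nat m1 * index_sum S1 u1 :: (laurent, 'n) gl uea)"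
      using index_sum_contract[OF m[unfolded xy], where 'n = 'n] by blast
    obtain S2 :: "'k set" and u2 m2 where 2: "matched S2 u2" "length u2 = Suc (length \<alpha> + length \<beta>)"
      "?B = (of_nat m2 * index_sum S2 u2 :: (laurent, 'n) gl uea)"
      using index_sum_contract[OF m'[unfolded xy], where 'n = 'n] by blast
    show ?thesis unfolding 1(3) 2(3)
      by (intro trace_alg_diff trace_alg_mult trace_alg_of_nat IH) (use 1(1,2) 2(1,2) n in auto)
  qed
  finally show ?thesis .
qed

text \<open>The prefix \<open>\<gamma>\<close> collects the letters that are in place already. The predicate need only respect swaps
in words with a fixed content \<open>M\<close>, as membership in the trace algebra is known to do so only for words
of a given length.\<close>

lemma adjacent_swaps_imp_permutation_invariant:
  assumes swap: "\<And>\<alpha> x y \<beta>. mset (\<alpha> @ x # y # \<beta>) = M \<Longrightarrow> P (\<alpha> @ x # y # \<beta>) \<longleftrightarrow> P (\<alpha> @ y # x # \<beta>)"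
    and "mset (\<gamma> @ u) = M" "mset u = mset u'"
  shows "P (\<gamma> @ u) \<longleftrightarrow> P (\<gamma> @ u')"
  using assms(2,3)
proof (induction u arbitrary: \<gamma> u')
  case Nil
  then show ?case by simp
next
  case (Cons x u)
  then have "x \<in> set u'" by (metis list.set_intros(1) set_mset_mset)
  then obtain \<alpha> \<beta> where u': "u' = \<alpha> @ x # \<beta>" by (meson split_list)
  have move: "mset (\<gamma> @ \<alpha> @ x # \<beta>) = M \<Longrightarrow> P (\<gamma> @ x # \<alpha> @ \<beta>) \<longleftrightarrow> P (\<gamma> @ \<alpha> @ x # \<beta>)" for \<alpha> \<beta>
  proof (induction \<alpha> arbitrary: \<beta> rule: rev_induct)
    case (snoc y \<alpha>)
    have "P (\<gamma> @ x # (\<alpha> @ [y]) @ \<beta>) \<longleftrightarrow> P (\<gamma> @ \<alpha> @ x # y # \<beta>)"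
      using snoc.IH[of "y # \<beta>"] snoc.prems by (simp add: ac_simps add_mset_commute)
    also have "\<dots> \<longleftrightarrow> P (\<gamma> @ (\<alpha> @ [y]) @ x # \<beta>)"
      using swap[of "\<gamma> @ \<alpha>" x y \<beta>] snoc.prems by (simp add: ac_simps add_mset_commute)
    finally show ?case .
  qed simp
  have "P ((\<gamma> @ [x]) @ u) \<longleftrightarrow> P ((\<gamma> @ [x]) @ \<alpha> @ \<beta>)"
    using Cons.prems by (intro Cons.IH) (auto simp: u')
  also have "\<dots> \<longleftrightarrow> P (\<gamma> @ u')"
    using move[of \<alpha> \<beta>] Cons.prems by (simp add: u')
  finally show ?case by simp
qed

lemma sum_tuples_Un:
  fixes h :: "('k \<Rightarrow> 'n::finite) \<Rightarrow> 'c::comm_monoid_add"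
  assumes "finite S" "S \<inter> S' = {}"
    and "\<And>\<nu> \<nu>'. (\<And>r. r \<in> S \<union> S' \<Longrightarrow> \<nu> r = \<nu>' r) \<Longrightarrow> h \<nu> = h \<nu>'"
  shows "(\<Sum>\<nu>\<in>tuples (S \<union> S'). h \<nu>) = (\<Sum>\<mu>\<in>tuples S. \<Sum>\<nu>\<in>tuples S'. h (\<lambda>r. if r \<in> S then \<mu> r else \<nu> r))"
proof -
  have "(\<Sum>\<mu>\<in>tuples S. \<Sum>\<nu>\<in>tuples S'. h (\<lambda>r. if r \<in> S then \<mu> r else \<nu> r))
    = (\<Sum>(\<mu>, \<nu>)\<in>tuples S \<times> tuples S'. h (\<lambda>r. if r \<in> S then \<mu> r else \<nu> r))"
    by (rule sum.cartesian_product)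
  also have "\<dots> = (\<Sum>\<nu>\<in>tuples (S \<union> S'). h \<nu>)"
    by (rule sum.reindex_bij_witness[where
          j = "\<lambda>(\<mu>, \<nu>) r. if r \<in> S then \<mu> r else \<nu> r" and i = "\<lambda>\<nu>. (restrict \<nu> S, restrict \<nu> S')"])
      (use assms(2) in \<open>auto simp: tuples_def PiE_def extensional_def fun_eq_iff restrict_def intro!: assms(3)\<close>)
  finally show ?thesis ..
qed

lemma prod_letter_cong:
  assumes "\<And>r. r \<in> set (map fst u) \<union> set (map (fst \<circ> snd) u) \<Longrightarrow> \<nu> r = \<nu>' r"
  shows "map (letter \<nu>) u = map (letter \<nu>') u"
  using assms by (intro map_cong refl letter_cong) force

lemma index_sum_append:
  fixes u u' :: "('k \<times> 'k \<times> laurent) list"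
  assumes "matched S u" "matched S' u'" "S \<inter> S' = {}"
  shows "(index_sum (S \<union> S') (u @ u') :: (laurent, 'n::finite) gl uea) = index_sum S u * index_sum S' u'"
proof -
  have "(index_sum (S \<union> S') (u @ u') :: (laurent, 'n) gl uea) = (\<Sum>\<mu>\<in>tuples S. \<Sum>\<nu>\<in>tuples S'.
      prod_list (map (letter (\<lambda>r. if r \<in> S then \<mu> r else \<nu> r)) (u @ u')))"
    unfolding index_sum_def using matched_finite[OF assms(1)] assms(3)
  proof (rule sum_tuples_Un)
    fix \<nu> \<nu>' :: "'k \<Rightarrow> 'n" assume "\<And>r. r \<in> S \<union> S' \<Longrightarrow> \<nu> r = \<nu>' r"
    then show "prod_list (map (letter \<nu>) (u @ u')) = prod_list (map (letter \<nu>') (u @ u'))"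
      using assms by (intro arg_cong[where f = prod_list] prod_letter_cong) (auto simp: matched_def)
  qed
  also have "\<dots> = (\<Sum>\<mu>\<in>tuples S. \<Sum>\<nu>\<in>tuples S'. prod_list (map (letter \<mu>) u) * prod_list (map (letter \<nu>) u'))"
  proof (intro sum.cong refl)
    fix \<mu> \<nu> :: "'k \<Rightarrow> 'n"
    have "map (letter (\<lambda>r. if r \<in> S then \<mu> r else \<nu> r)) u = map (letter \<mu>) u"
      using assms by (intro prod_letter_cong) (auto simp: matched_def)
    moreover have "map (letter (\<lambda>r. if r \<in> S then \<mu> r else \<nu> r)) u' = map (letter \<nu>) u'"
      using assms by (intro prod_letter_cong) (auto simp: matched_def)
    ultimately show "prod_list (map (letter (\<lambda>r. if r \<in> S then \<mu> r else \<nu> r)) (u @ u'))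
      = prod_list (map (letter \<mu>) u) * prod_list (map (letter \<nu>) u')"
      by (simp only: map_append prod_list.append)
  qed
  also have "\<dots> = index_sum S u * index_sum S' u'"
    by (simp add: index_sum_def sum_product)
  finally show ?thesis .
qed

text \<open>An assignment of values to the variables of a cycle is the same as the list of these values.\<close>

lemma index_sum_cycle:
  assumes "distinct ps" "ps \<noteq> []" "length bs = length ps"
  shows "index_sum (set ps) (map (\<lambda>j. (ps ! j, ps ! (Suc j mod length ps), bs ! j)) [0..<length ps]) = trace_elt bs"
  unfolding trace_elt_def index_sum_def
proof (rule sum.reindex_bij_witness[where
      j = "\<lambda>\<nu>. map \<nu> ps" and i = "\<lambda>is r. if r \<in> set ps then is ! (THE j. j < length ps \<and> ps ! j = r) else undefined"])
  have the: "(THE j. j < length ps \<and> ps ! j = ps ! i) = i" if "i < length ps" for i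
    using that assms(1) by (intro the_equality) (auto simp: nth_eq_iff_index_eq)
  fix \<nu> :: "'a \<Rightarrow> 'b" assume nu: "\<nu> \<in> tuples (set ps)"
  show "(\<lambda>r. if r \<in> set ps then map \<nu> ps ! (THE j. j < length ps \<and> ps ! j = r) else undefined) = \<nu>"
  proof
    fix r
    show "(if r \<in> set ps then map \<nu> ps ! (THE j. j < length ps \<and> ps ! j = r) else undefined) = \<nu> r"
      using nu by (auto simp: in_set_conv_nth the tuples_def PiE_def extensional_def)
  qed
  show "map \<nu> ps \<in> {is. length is = length bs}" using assms by simp
  show "(\<Prod>j\<leftarrow>[0..<length bs]. uea_gen (gl_tensor (gl_unit (map \<nu> ps ! j) (map \<nu> ps ! (Suc j mod length bs))) (bs ! j)))
    = prod_list (map (letter \<nu>) (map (\<lambda>j. (ps ! j, ps ! (Suc j mod length ps), bs ! j)) [0..<length ps]))"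
    unfolding map_map using assms
    by (intro arg_cong[where f = prod_list] map_cong) (auto simp: letter_def gE_def)
next
  have the: "(THE j. j < length ps \<and> ps ! j = ps ! i) = i" if "i < length ps" for i
    using that assms(1) by (intro the_equality) (auto simp: nth_eq_iff_index_eq)
  fix "is" :: "'b list" assume "is": "is \<in> {is. length is = length bs}"
  show "map (\<lambda>r. if r \<in> set ps then is ! (THE j. j < length ps \<and> ps ! j = r) else undefined) ps = is"
    using "is" assms by (intro nth_equalityI) (auto simp: the)
  show "(\<lambda>r. if r \<in> set ps then is ! (THE j. j < length ps \<and> ps ! j = r) else undefined) \<in> tuples (set ps)"
    by (auto simp: tuples_def PiE_def extensional_def)
qed

lemma matched_cycle:
  assumes "distinct ps" "ps \<noteq> []"
  shows "matched (set ps) (map (\<lambda>j. (ps ! j, ps ! (Suc j mod length ps), bs ! j)) [0..<length ps])"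
proof -
  let ?n = "length ps"
  have 1: "map (\<lambda>j. ps ! j) [0..<?n] = ps" by (rule map_nth)
  have 2: "map (\<lambda>j. ps ! (Suc j mod ?n)) [0..<?n] = rotate1 ps"
    using assms(2) by (intro nth_equalityI) (auto simp: nth_rotate1)
  show ?thesis using assms(1) by (simp add: matched_def comp_def 1 2 flip: set_map)
qed

text \<open>The cycle is the orbit of any variable under the permutation that sends rows to columns.\<close>

lemma matched_split_cycle:
  assumes m: "matched S u" and "u \<noteq> []"
  shows "\<exists>ps bs rest. ps \<noteq> [] \<and> distinct ps \<and> length bs = length ps \<and> set ps \<subseteq> S \<and>
    mset u = mset (map (\<lambda>j. (ps ! j, ps ! (Suc j mod length ps), bs ! j)) [0..<length ps] @ rest) \<and>
    matched (S - set ps) rest"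
proof -
  define g where "g v = the (map_of u v)" for v
  define \<sigma> where "\<sigma> v = (if v \<in> S then fst (g v) else v)" for v
  let ?W = "map (\<lambda>v. (v, \<sigma> v, snd (g v)))"
  have u: "u = ?W (map fst u)"
  proof -
    have "(fst x, \<sigma> (fst x), snd (g (fst x))) = x" if "x \<in> set u" for x
    proof -
      have "map_of u (fst x) = Some (snd x)"
        using that m by (intro map_of_is_SomeI) (auto simp: matched_def)
      moreover have "fst x \<in> S" using that m by (auto simp: matched_def)
      ultimately show ?thesis by (simp add: g_def \<sigma>_def)
    qed
    then show ?thesis by (simp add: map_idI)
  qed
  have fs: "map (fst \<circ> snd) u = map \<sigma> (map fst u)" by (subst u) simp
  have S: "S = set (map fst u)" and d: "distinct (map fst u)" using m by (auto simp: matched_def)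
  have \<sigma>: "\<sigma> permutes S"
  proof (rule bij_imp_permutes)
    have "inj_on \<sigma> S" "\<sigma> ` S = S"
      using m unfolding matched_def fs distinct_map[of \<sigma>] by auto
    then show "bij_betw \<sigma> S S" by (simp add: bij_betw_def)
  qed (simp add: \<sigma>_def)
  then have perm: "permutation \<sigma>" using matched_finite[OF m] by (auto simp: permutation_permutes)
  obtain v0 where v0: "v0 \<in> S" using \<open>u \<noteq> []\<close> S by (cases u) auto
  define ps where "ps = support \<sigma> v0"
  define n where "n = length ps"
  have n: "n > 0" "n = least_power \<sigma> v0" "(\<sigma> ^^ n) v0 = v0"
    using least_power_of_permutation[OF perm, of v0] by (auto simp: n_def ps_def)
  have ps_nth: "ps ! j = (\<sigma> ^^ j) v0" if "j < n" for j
    using that by (simp add: ps_def n(2))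
  have ps: "distinct ps" "ps \<noteq> []" using cycle_of_permutation[OF perm, of v0] n by (auto simp: ps_def n_def)
  have psS: "set ps \<subseteq> S"
  proof
    fix v assume "v \<in> set ps"
    then obtain j where "v = (\<sigma> ^^ j) v0" by (auto simp: ps_def)
    moreover have "(\<sigma> ^^ j) v0 \<in> S" for j
      by (induction j) (use v0 permutes_in_image[OF \<sigma>] in auto)
    ultimately show "v \<in> S" by simp
  qed
  define bs where "bs = map (snd \<circ> g) ps"
  define rs where "rs = filter (\<lambda>v. v \<notin> set ps) (map fst u)"
  have next_nth: "ps ! (Suc j mod n) = \<sigma> (ps ! j)" if "j < n" for j
  proof (cases "Suc j = n")
    case True
    then show ?thesis using n ps_nth[of 0] ps_nth[OF that] by (metis comp_apply funpow.simps(2) funpow_0 mod_self)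
  qed (use that ps_nth in auto)
  have cyc: "map (\<lambda>j. (ps ! j, ps ! (Suc j mod length ps), bs ! j)) [0..<length ps] = ?W ps"
    by (intro nth_equalityI) (simp_all add: n_def[symmetric] next_nth bs_def)
  have rs: "set rs = S - set ps" "distinct rs" using S d by (auto simp: rs_def)
  have "mset (map fst u) = mset (ps @ rs)"
    by (intro iffD1[OF set_eq_iff_mset_eq_distinct]) (use d ps rs psS S in auto)
  then have mu: "mset u = mset (?W ps @ ?W rs)" by (subst u) (metis map_append mset_map)
  have "matched (S - set ps) (?W rs)"
  proof -
    have "matched (set ps) (?W ps)" using matched_cycle[OF ps, of bs] by (simp add: cyc)
    moreover have "matched S (?W ps @ ?W rs)" using m matched_mset[OF mu] by blast
    ultimately show ?thesis by (auto simp: matched_def)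
  qed
  then show ?thesis
    using ps psS mu cyc by (intro exI[of _ ps] exI[of _ bs] exI[of _ "?W rs"]) (auto simp: bs_def)
qed

text \<open>Induction on the length. Swapping neighbours changes the sum by shorter ones, so the letters may be
reordered such that a cycle comes first; the sum is then a generator times a shorter sum.\<close>

theorem index_sum_in_trace_alg:
  "matched S u \<Longrightarrow> index_sum S u \<in> (trace_alg :: (laurent, 'n::finite) gl uea set)"
proof (induction "length u" arbitrary: S u rule: less_induct)
  case less
  let ?T = "trace_alg :: (laurent, 'n) gl uea set"
  show ?case
  proof (cases "u = []")
    case True
    then have "S = {}" using less.prems by (simp add: matched_def)
    then show ?thesis using True by (simp add: index_sum_def tuples_def trace_alg_one)
  next
    case False
    then obtain ps bs rest where ps: "ps \<noteq> []" "distinct ps" "length bs = length ps" "set ps \<subseteq> S"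
      and mu: "mset u = mset (map (\<lambda>j. (ps ! j, ps ! (Suc j mod length ps), bs ! j)) [0..<length ps] @ rest)"
      and rest: "matched (S - set ps) rest"
      using matched_split_cycle[OF less.prems] by blast
    let ?c = "map (\<lambda>j. (ps ! j, ps ! (Suc j mod length ps), bs ! j)) [0..<length ps]"
    have "length u = length ps + length rest" using arg_cong[OF mu, of size] by simp
    then have "length rest < length u" using ps(1) by simp
    then have "index_sum (S - set ps) rest \<in> ?T" using less.hyps rest by blast
    moreover have "index_sum (set ps) ?c \<in> ?T"
      using ps by (subst index_sum_cycle) (auto intro: trace_alg_elt)
    ultimately have "index_sum (set ps \<union> (S - set ps)) (?c @ rest) \<in> ?T"
      by (subst index_sum_append[OF matched_cycle[OF ps(2,1)] rest]) (auto intro: trace_alg_mult)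
    then have "index_sum S (?c @ rest) \<in> ?T" using ps(4) by (simp add: Un_absorb1)
    moreover have "index_sum S ([] @ u) \<in> ?T \<longleftrightarrow> index_sum S ([] @ ?c @ rest) \<in> ?T"
    proof (rule adjacent_swaps_imp_permutation_invariant[of "mset u"])
      fix \<alpha> x y \<beta> assume w: "mset (\<alpha> @ x # y # \<beta>) = mset u"
      have "matched S (\<alpha> @ x # y # \<beta>)" using less.prems matched_mset[OF w] by blast
      moreover have "length u = length (\<alpha> @ x # y # \<beta>)" using arg_cong[OF w, of size] by simp
      ultimately have "index_sum S (\<alpha> @ x # y # \<beta>) - index_sum S (\<alpha> @ y # x # \<beta>) \<in> ?T"
        using less.hyps by (intro index_sum_swap[where n = "length u"]) auto
      then show "index_sum S (\<alpha> @ x # y # \<beta>) \<in> ?T \<longleftrightarrow> index_sum S (\<alpha> @ y # x # \<beta>) \<in> ?T"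
        by (rule trace_alg_diff_iff)
    qed (use mu in auto)
    ultimately show ?thesis by simp
  qed
qed

section \<open>Burnside's theorem\<close>

lemma uea_induct [case_names const gen add mult]:
  assumes const: "\<And>c. P (uea_const c)" and gen: "\<And>x. P (uea_gen x)"
    and add: "\<And>u v. P u \<Longrightarrow> P v \<Longrightarrow> P (u + v)" and mult: "\<And>u v. P u \<Longrightarrow> P v \<Longrightarrow> P (u * v)"
  shows "P u"
proof -
  have word: "P (abs_uea (Poly_Mapping.single (Word xs) c))" for xs c
  proof (induction xs)
    case Nil
    then show ?case using const[of c] by (simp add: uea_const_def zero_word_def)
  next
    case (Cons x xs)
    have "Poly_Mapping.single (Word (x # xs)) c = free_gen x * Poly_Mapping.single (Word xs) c"
      by (simp add: mult_single plus_word_def)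
    then show ?case using mult[OF gen[of x] Cons] by (simp add: uea_gen_def times_uea.abs_eq)
  qed
  have "P (abs_uea p)" for p
  proof (induction p rule: poly_mapping_single_induct)
    case zero
    then show ?case using word[of "[]" 0] by simp
  next
    case (add p k c)
    have "P (abs_uea (Poly_Mapping.single k c))" using word[of "letters k" c] by simp
    from assms(3)[OF add this] show ?case by (simp add: plus_uea.abs_eq)
  qed
  then show ?thesis using Quotient3_abs_rep[OF Quotient3_uea] by metis
qed

text \<open>Split off linear factors \<open>X - c\<close> of \<open>p\<close>, with quotient \<open>q\<close>, until \<open>q(T) v \<noteq> 0\<close>; that vector is an
eigenvector for \<open>c\<close>.\<close>

lemma eigenvector_of_annihilating_poly:
  fixes s :: "complex \<Rightarrow> 'v::ab_group_add \<Rightarrow> 'v"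
  assumes "vector_space s" and sub: "module.subspace s V" and T: "\<And>v. v \<in> V \<Longrightarrow> T v \<in> V"
    and lin: "\<And>v w. v \<in> V \<Longrightarrow> w \<in> V \<Longrightarrow> T (v + w) = T v + T w" "\<And>c v. v \<in> V \<Longrightarrow> T (s c v) = s c (T v)"
    and "v \<in> V" "v \<noteq> 0" "p \<noteq> 0" "(\<Sum>i<Suc (degree p). s (coeff p i) ((T ^^ i) v)) = 0"
  shows "\<exists>c w. w \<in> V \<and> w \<noteq> 0 \<and> T w = s c w"
proof -
  interpret vector_space s by fact
  have Tn: "(T ^^ i) v \<in> V" for i by (induction i) (use T \<open>v \<in> V\<close> in auto)
  define act where "act p n = (\<Sum>i<n. s (coeff p i) ((T ^^ i) v))" for p :: "complex poly" and n
  have act_in: "act p n \<in> V" for p n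
    unfolding act_def by (intro subspace_sum[OF sub] subspace_scale[OF sub] Tn)
  have act_Suc: "act p (Suc n) = act p n + s (coeff p n) ((T ^^ n) v)" for p n by (simp add: act_def)
  have T0: "T 0 = 0" using lin(2)[OF subspace_0[OF sub], of 0] by simp
  have T_act: "T (act q n) = (\<Sum>i<n. s (coeff q i) ((T ^^ Suc i) v))" for q n
  proof (induction n)
    case 0
    then show ?case by (simp add: act_def T0)
  next
    case (Suc n)
    then show ?case
      by (simp add: act_Suc lin act_in subspace_scale[OF sub Tn] Tn)
  qed
  have shift: "act ([:- c, 1:] * q) (Suc n) = T (act q n) - s c (act q (Suc n))" for c q n
  proof -
    have "act ([:- c, 1:] * q) (Suc n) = (\<Sum>i<Suc n. s (coeff (pCons 0 q) i) ((T ^^ i) v)) - s c (act q (Suc n))"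
      unfolding act_def by (simp add: scale_sum_right sum_subtractf[symmetric] scale_left_diff_distrib del: sum.lessThan_Suc)
    also have "(\<Sum>i<Suc n. s (coeff (pCons 0 q) i) ((T ^^ i) v)) = T (act q n)"
      unfolding sum.lessThan_Suc_shift T_act by simp
    finally show ?thesis .
  qed
  have "act p (Suc (degree p)) = 0" using assms by (simp add: act_def)
  with \<open>p \<noteq> 0\<close> show ?thesis
  proof (induction "degree p" arbitrary: p)
    case 0
    then have "act p (Suc 0) = s (coeff p 0) v" by (simp add: act_def)
    with 0 \<open>v \<noteq> 0\<close> have "coeff p 0 = 0" by simp
    with 0 have "p = 0" by (metis leading_coeff_0_iff)
    with 0 show ?case by simp
  next
    case (Suc n)
    have "\<not> constant (poly p)" using Suc.hyps(2) by (simp add: constant_degree)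
    then obtain c where "poly p c = 0" using fundamental_theorem_of_algebra by blast
    then obtain q where q: "p = [:- c, 1:] * q" using poly_eq_0_iff_dvd by blast
    with Suc.prems have "q \<noteq> 0" by auto
    then have dq: "degree q = n" using Suc.hyps(2) q by (simp add: degree_mult_eq del: mult_pCons_left)
    have qS: "act q (Suc (Suc n)) = act q (Suc n)" by (simp add: act_Suc dq coeff_eq_0)
    have eig: "T (act q (Suc n)) = s c (act q (Suc n))"
    proof -
      have "act p (Suc (Suc n)) = T (act q (Suc n)) - s c (act q (Suc (Suc n)))"
        unfolding q by (rule shift)
      then show ?thesis using Suc.prems(2) qS by (simp add: Suc.hyps(2)[symmetric])
    qed
    show ?case
    proof (cases "act q (Suc n) = 0")
      case True
      then show ?thesis using Suc.hyps(1)[of q] dq \<open>q \<noteq> 0\<close> by simp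
    next
      case False
      then show ?thesis using eig act_in by blast
    qed
  qed
qed

text \<open>The vectors \<open>v, T v, T\<^sup>2 v, \<dots>\<close> are linearly dependent by finite dimension.\<close>

lemma exists_eigenvector:
  fixes s :: "complex \<Rightarrow> 'v::ab_group_add \<Rightarrow> 'v"
  assumes "vector_space s" and V: "V = module.span s B" "finite B" and T: "\<And>v. v \<in> V \<Longrightarrow> T v \<in> V"
    and lin: "\<And>v w. v \<in> V \<Longrightarrow> w \<in> V \<Longrightarrow> T (v + w) = T v + T w" "\<And>c v. v \<in> V \<Longrightarrow> T (s c v) = s c (T v)"
    and v: "v \<in> V" "v \<noteq> 0"
  shows "\<exists>c w. w \<in> V \<and> w \<noteq> 0 \<and> T w = s c w"
proof -
  interpret vector_space s by fact
  have sub: "subspace V" by (simp add: V)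
  let ?f = "\<lambda>i. (T ^^ i) v"
  have Tn: "?f i \<in> V" for i by (induction i) (use T v in auto)
  have "\<exists>p. p \<noteq> 0 \<and> (\<Sum>i<Suc (degree p). s (coeff p i) (?f i)) = 0"
  proof -
    have ext: "(\<Sum>i<Suc (degree p). s (coeff p i) (?f i)) = (\<Sum>i<n. s (coeff p i) (?f i))"
      if "degree p < n" for p n
      using that by (intro sum.mono_neutral_left) (auto simp: coeff_eq_0)
    define n where "n = Suc (card B)"
    show ?thesis
    proof (cases "inj_on ?f {..<n}")
      case False
      then obtain i j where ij: "i \<noteq> j" "?f i = ?f j" by (auto simp: inj_on_def)
      define p :: "complex poly" where "p = monom 1 i - monom 1 j"
      have "coeff p i = 1" using ij by (simp add: p_def)
      then have p0: "p \<noteq> 0" by auto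
      define N where "N = Suc (degree p) + Suc i + Suc j"
      have "(\<Sum>l<N. s (coeff p l) (?f l)) = (\<Sum>l<N. (if l = i then ?f l else 0) - (if l = j then ?f l else 0))"
        by (intro sum.cong) (auto simp: p_def)
      also have "\<dots> = 0" using ij by (simp add: sum_subtractf N_def del: sum.lessThan_Suc)
      finally show ?thesis using p0 ext[of p N] by (intro exI[of _ p]) (simp add: N_def)
    next
      case True
      have "dependent (?f ` {..<n})"
      proof (rule ccontr)
        assume "\<not> ?thesis"
        then have "card (?f ` {..<n}) \<le> card B"
          using independent_span_bound[OF V(2), of "?f ` {..<n}"] Tn V(1) by auto
        then show False using True by (simp add: card_image n_def)
      qed
      then obtain u x where u: "(\<Sum>y\<in>?f ` {..<n}. s (u y) y) = 0" "x \<in> ?f ` {..<n}" "u x \<noteq> 0"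
        using dependent_finite[of "?f ` {..<n}"] by auto
      then obtain i0 where i0: "i0 < n" "u (?f i0) \<noteq> 0" by auto
      define p where "p = (\<Sum>i<n. monom (u (?f i)) i)"
      have cp: "coeff p l = (if l < n then u (?f l) else 0)" for l
        by (simp add: p_def coeff_sum)
      then have p0: "p \<noteq> 0" using i0 by (metis coeff_0)
      have "degree p < n"
        using i0(1) by (intro le_less_trans[OF degree_le[of "n - 1"]]) (auto simp: cp)
      moreover have "(\<Sum>i<n. s (coeff p i) (?f i)) = 0"
        using u(1) by (simp add: sum.reindex[OF True] cp)
      ultimately show ?thesis using p0 ext by metis
    qed
  qed
  then show ?thesis
    using eigenvector_of_annihilating_poly[where T = T, OF assms(1) sub T lin v] by blast
qed

context
  fixes s :: "complex \<Rightarrow> 'v::ab_group_add \<Rightarrow> 'v" and V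
    and \<rho> :: "'l::complex_lie_algebra \<Rightarrow> 'v \<Rightarrow> 'v"
  assumes mod: "lie_module s V \<rho>"
begin

interpretation vector_space s using mod by (simp add: lie_module_def)

lemma module_subspace: "subspace V" using mod by (simp add: lie_module_def)

lemma uea_act_lin:
  assumes "v \<in> V"
  shows "w \<in> V \<Longrightarrow> uea_act s \<rho> u (v + w) = uea_act s \<rho> u v + uea_act s \<rho> u w"
    and "uea_act s \<rho> u (s c v) = s c (uea_act s \<rho> u v)"
  using assms
  by (simp_all add: uea_act_def free_act_def foldr_act_lin[OF mod] scale_right_distrib sum.distrib
      scale_sum_right mult.commute)

lemma uea_act_zero_right: "uea_act s \<rho> u 0 = 0"
  using uea_act_lin(2)[of 0 u 0] subspace_0[OF module_subspace] by simp

lemma uea_act_sum_right: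
  "(\<And>i. i \<in> I \<Longrightarrow> g i \<in> V) \<Longrightarrow> uea_act s \<rho> u (\<Sum>i\<in>I. g i) = (\<Sum>i\<in>I. uea_act s \<rho> u (g i))"
  by (induction I rule: infinite_finite_induct)
    (simp_all add: uea_act_zero_right uea_act_lin subspace_sum[OF module_subspace])

lemma uea_act_zero_left: "v \<in> V \<Longrightarrow> uea_act s \<rho> 0 v = 0"
  using uea_act_add[OF mod, of v 0 0] by simp

lemma uea_act_one: "v \<in> V \<Longrightarrow> uea_act s \<rho> 1 v = v"
  using uea_act_const[OF mod, of v 1] by (simp add: uea_const_def one_uea_def)

lemma uea_act_sum_left: "v \<in> V \<Longrightarrow> uea_act s \<rho> (\<Sum>i\<in>I. g i) v = (\<Sum>i\<in>I. uea_act s \<rho> (g i) v)"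
  by (induction I rule: infinite_finite_induct) (simp_all add: uea_act_zero_left uea_act_add[OF mod])

lemma submodule_uea_act:
  assumes "lie_submodule s V \<rho> S" "v \<in> S"
  shows "uea_act s \<rho> u v \<in> S"
proof -
  have "lie_module s S \<rho>" using mod assms unfolding lie_submodule_def lie_module_def by blast
  then show ?thesis by (rule uea_act_in) fact
qed

lemma submodule_lie_module: "lie_submodule s V \<rho> S \<Longrightarrow> lie_module s S \<rho>"
  using mod unfolding lie_submodule_def lie_module_def by blast

text \<open>Jacobson density. Let \<open>J\<close> be the left ideal that kills \<open>B\<close>. Unless \<open>J\<close> kills \<open>b\<close>, irreducibility
gives \<open>J b = V\<close>, and \<open>u b \<mapsto> u v\<close> for \<open>u \<in> J\<close> is a well-defined endomorphism of the module. By
Schur's lemma it is a scalar \<open>c\<close>, so \<open>J\<close> kills \<open>v - c b\<close> and the induction hypothesis applies.\<close>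

lemma jacobson_density:
  assumes irr: "irreducible_lie_module s V \<rho>" and fin: "finite G" "V = span G"
    and "finite B" "B \<subseteq> V" "v \<in> V" "\<And>u. (\<And>b. b \<in> B \<Longrightarrow> uea_act s \<rho> u b = 0) \<Longrightarrow> uea_act s \<rho> u v = 0"
  shows "v \<in> span B"
  using assms(4-7)
proof (induction B arbitrary: v rule: finite_induct)
  case empty
  then show ?case using uea_act_one[of v] empty(3)[of 1] by simp
next
  case (insert b B)
  let ?a = "uea_act s \<rho>"
  define J where "J = {u. \<forall>b\<in>B. ?a u b = 0}"
  have b: "b \<in> V" and B: "B \<subseteq> V" using insert.prems by auto
  note lin = uea_act_lin uea_act_add[OF mod] uea_act_mult[OF mod] uea_act_in[OF mod]
  have kill: "u \<in> J \<Longrightarrow> ?a u b = 0 \<Longrightarrow> ?a u v = 0" for u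
    using insert.prems(3)[of u] by (auto simp: J_def)
  have J_add: "u \<in> J \<Longrightarrow> u' \<in> J \<Longrightarrow> u + u' \<in> J" for u u'
    using B by (auto simp: J_def subset_iff uea_act_add[OF mod])
  have J_mult: "u \<in> J \<Longrightarrow> x * u \<in> J" for u x
    using B by (auto simp: J_def subset_iff uea_act_mult[OF mod] uea_act_zero_right)
  have J0: "0 \<in> J" using B by (auto simp: J_def uea_act_zero_left)
  have Jb: "lie_submodule s V \<rho> ((\<lambda>u. ?a u b) ` J)"
    unfolding lie_submodule_def
  proof (intro conjI allI ballI)
    show "subspace ((\<lambda>u. ?a u b) ` J)"
    proof (rule subspaceI)
      show "0 \<in> (\<lambda>u. ?a u b) ` J" using J0 uea_act_zero_left[OF b] by force
      fix x y c assume "x \<in> (\<lambda>u. ?a u b) ` J"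
      then obtain u where u: "u \<in> J" "x = ?a u b" by blast
      then show "s c x \<in> (\<lambda>u. ?a u b) ` J"
        using J_mult[of u "uea_const c"] b by (intro image_eqI[of _ _ "uea_const c * u"]) (auto simp: lin uea_act_const[OF mod])
      assume "y \<in> (\<lambda>u. ?a u b) ` J"
      then obtain u' where "u' \<in> J" "y = ?a u' b" by blast
      then show "x + y \<in> (\<lambda>u. ?a u b) ` J"
        using J_add[of u u'] u b by (intro image_eqI[of _ _ "u + u'"]) (auto simp: lin)
    qed
    show "(\<lambda>u. ?a u b) ` J \<subseteq> V" using b by (auto simp: lin)
    fix x y assume "y \<in> (\<lambda>u. ?a u b) ` J"
    then obtain u where u: "u \<in> J" "y = ?a u b" by blast
    then show "\<rho> x y \<in> (\<lambda>u. ?a u b) ` J"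
      using J_mult[of u "uea_gen x"] b by (intro image_eqI[of _ _ "uea_gen x * u"]) (auto simp: lin uea_act_gen[OF mod])
  qed
  show ?case
  proof (cases "\<forall>u\<in>J. ?a u b = 0")
    case True
    then have "v \<in> span B"
      using insert.prems B kill by (intro insert.IH) (auto simp: J_def)
    then show ?thesis by (meson span_mono subset_insertI subsetD)
  next
    case False
    then have "(\<lambda>u. ?a u b) ` J \<noteq> {0}" by auto
    with Jb irr have onto: "(\<lambda>u. ?a u b) ` J = V" by (auto simp: irreducible_lie_module_def)
    \<comment> \<open>the endomorphism \<open>u b \<mapsto> u v\<close>; the choice of \<open>u\<close> is immaterial, as a difference in \<open>J\<close> that kills \<open>b\<close> kills \<open>v\<close>\<close>
    define T where "T w = ?a (SOME u. u \<in> J \<and> ?a u b = w) v" for w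
    have T: "T (?a u b) = ?a u v" if u: "u \<in> J" for u
    proof -
      define u' where "u' = (SOME u'. u' \<in> J \<and> ?a u' b = ?a u b)"
      have u': "u' \<in> J" "?a u' b = ?a u b"
        using someI_ex[of "\<lambda>u'. u' \<in> J \<and> ?a u' b = ?a u b"] u by (auto simp: u'_def)
      have "u' + uea_const (-1) * u \<in> J" by (intro J_add J_mult u u')
      moreover have "?a (u' + uea_const (-1) * u) w = ?a u' w - ?a u w" if "w \<in> V" for w
        using that by (simp add: lin uea_act_const[OF mod])
      ultimately have "?a u' v = ?a u v" using kill u'(2) b insert.prems(2) by force
      then show ?thesis by (simp add: T_def u'_def)
    qed
    have T_in: "T w \<in> V" if w: "w \<in> V" for w
    proof -
      obtain u where "u \<in> J" "w = ?a u b" using w onto by blast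
      then show ?thesis using T insert.prems(2) by (simp add: lin)
    qed
    have T_comm: "T (?a x w) = ?a x (T w)" if w: "w \<in> V" for x w
    proof -
      obtain u where u: "u \<in> J" "w = ?a u b" using w onto by blast
      then have "T (?a x w) = T (?a (x * u) b)" using b by (simp add: lin)
      then show ?thesis using u T[OF u(1)] T[OF J_mult[OF u(1)]] insert.prems(2) by (simp add: lin)
    qed
    have T_add: "T (w + w') = T w + T w'" if w: "w \<in> V" "w' \<in> V" for w w'
    proof -
      obtain u u' where u: "u \<in> J" "w = ?a u b" "u' \<in> J" "w' = ?a u' b" using w onto by blast
      then have "T (w + w') = T (?a (u + u') b)" using b by (simp add: lin)
      then show ?thesis using u T[OF u(1)] T[OF u(3)] T[OF J_add[OF u(1,3)]] insert.prems(2) by (simp add: lin)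
    qed
    have T_scale: "T (s c w) = s c (T w)" if w: "w \<in> V" for w c
      using T_comm[OF w, of "uea_const c"] w T_in by (simp add: uea_act_const[OF mod])
    obtain w0 where "w0 \<in> V" "w0 \<noteq> 0" using irr subspace_0[OF module_subspace] by (auto simp: irreducible_lie_module_def)
    then obtain c w where w: "w \<in> V" "w \<noteq> 0" "T w = s c w"
      using exists_eigenvector[OF vector_space_axioms fin(2,1), of T] T_in T_add T_scale by blast
    have "lie_submodule s V \<rho> {w\<in>V. T w = s c w}"
      unfolding lie_submodule_def
    proof (intro conjI allI ballI)
      show "subspace {w\<in>V. T w = s c w}"
        using T_scale[of 0 0] subspace_0[OF module_subspace]
        by (intro subspaceI) (auto simp: T_add T_scale scale_right_distrib scale_left_commute
          intro: subspace_add[OF module_subspace] subspace_scale[OF module_subspace])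
      fix x v assume v: "v \<in> {w\<in>V. T w = s c w}"
      then have "T (\<rho> x v) = s c (\<rho> x v)"
        using T_comm[of v "uea_gen x"] T_in[of v] lin(2)[of v "uea_gen x" c] mod
        by (simp add: uea_act_gen[OF mod] lie_module_def)
      then show "\<rho> x v \<in> {w\<in>V. T w = s c w}" using v mod by (auto simp: lie_module_def)
    qed auto
    then have Tc: "T w = s c w" if "w \<in> V" for w
      using irr w that unfolding irreducible_lie_module_def by blast
    have "v - s c b \<in> span B"
    proof (rule insert.IH[OF B])
      show vb: "v - s c b \<in> V" using insert.prems(2) b module_subspace by (intro subspace_diff subspace_scale)
      fix u assume "\<And>b. b \<in> B \<Longrightarrow> ?a u b = 0"
      then have u: "u \<in> J" by (simp add: J_def)
      have "?a u v = ?a u ((v - s c b) + s c b)" by simp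
      also have "\<dots> = ?a u (v - s c b) + s c (?a u b)"
        using vb b by (simp only: lin subspace_scale[OF module_subspace])
      finally have *: "?a u v = ?a u (v - s c b) + s c (?a u b)" .
      have "?a u v = s c (?a u b)" using T[OF u] Tc[of "?a u b"] b by (simp add: lin)
      with * show "?a u (v - s c b) = 0" by simp
    qed
    then have "v - s c b \<in> span (insert b B)" by (meson span_mono subset_insertI subsetD)
    then have "(v - s c b) + s c b \<in> span (insert b B)"
      by (rule span_add) (intro span_scale span_base, simp)
    then show ?thesis by simp
  qed
qed

text \<open>By density there is, for each basis vector, an element that kills the others but not this one; by
irreducibility it can be multiplied so as to send this vector anywhere.\<close>

theorem burnside:
  assumes irr: "irreducible_lie_module s V \<rho>" and fin: "finite G" "V = span G"
    and f: "\<And>v. v \<in> V \<Longrightarrow> f v \<in> V"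
    "\<And>v w. v \<in> V \<Longrightarrow> w \<in> V \<Longrightarrow> f (v + w) = f v + f w" "\<And>c v. v \<in> V \<Longrightarrow> f (s c v) = s c (f v)"
  shows "\<exists>u. \<forall>v\<in>V. uea_act s \<rho> u v = f v"
proof -
  let ?a = "uea_act s \<rho>"
  obtain B where B: "B \<subseteq> V" "independent B" "V \<subseteq> span B"
    by (rule maximal_independent_subset[of V])
  have VB: "V = span B" using B span_minimal[OF B(1) module_subspace] by blast
  have finB: "finite B" using independent_span_bound[OF fin(1) B(2)] B(1) fin(2) by blast
  note lin = uea_act_lin uea_act_add[OF mod] uea_act_mult[OF mod] uea_act_in[OF mod]
  have "\<exists>u. (\<forall>b'\<in>B - {b}. ?a u b' = 0) \<and> ?a u b = f b" if b: "b \<in> B" for b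
  proof -
    have "b \<notin> span (B - {b})" using B(2) b by (auto simp: dependent_def)
    then obtain u where u: "\<And>b'. b' \<in> B - {b} \<Longrightarrow> ?a u b' = 0" "?a u b \<noteq> 0"
      using jacobson_density[OF irr fin, of "B - {b}" b] finB B(1) b by blast
    have ub: "?a u b \<in> V" using b B(1) by (auto simp: lin)
    have "lie_submodule s V \<rho> (range (\<lambda>x. ?a x (?a u b)))"
      unfolding lie_submodule_def
    proof (intro conjI allI ballI)
      show "subspace (range (\<lambda>x. ?a x (?a u b)))"
      proof (rule subspaceI)
        show "0 \<in> range (\<lambda>x. ?a x (?a u b))" using uea_act_zero_left[OF ub] by (metis rangeI)
        fix x y c assume "x \<in> range (\<lambda>x. ?a x (?a u b))"
        then obtain w where w: "x = ?a w (?a u b)" by blast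
        show "s c x \<in> range (\<lambda>x. ?a x (?a u b))"
          using ub w by (intro range_eqI[of _ _ "uea_const c * w"]) (simp add: lin uea_act_const[OF mod])
        assume "y \<in> range (\<lambda>x. ?a x (?a u b))"
        then obtain w' where "y = ?a w' (?a u b)" by blast
        then show "x + y \<in> range (\<lambda>x. ?a x (?a u b))"
          using ub w by (intro range_eqI[of _ _ "w + w'"]) (simp add: lin)
      qed
      show "range (\<lambda>x. ?a x (?a u b)) \<subseteq> V" using ub by (auto simp: lin)
      fix x y assume "y \<in> range (\<lambda>x. ?a x (?a u b))"
      then obtain w where "y = ?a w (?a u b)" by blast
      then show "\<rho> x y \<in> range (\<lambda>x. ?a x (?a u b))"
        using ub by (intro range_eqI[of _ _ "uea_gen x * w"]) (simp add: lin uea_act_gen[OF mod])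
    qed
    moreover have "range (\<lambda>x. ?a x (?a u b)) \<noteq> {0}"
    proof
      assume "range (\<lambda>x. ?a x (?a u b)) = {0}"
      then have "?a 1 (?a u b) \<in> {0}" by blast
      then show False using uea_act_one[OF ub] u(2) by simp
    qed
    ultimately have "range (\<lambda>x. ?a x (?a u b)) = V" using irr by (auto simp: irreducible_lie_module_def)
    moreover have "f b \<in> V" using f(1) b B(1) by blast
    ultimately obtain x where "f b = ?a x (?a u b)" by blast
    then show ?thesis
      using u(1) b B(1) by (intro exI[of _ "x * u"]) (auto simp: uea_act_mult[OF mod] subset_iff uea_act_zero_right)
  qed
  then have "\<exists>U. \<forall>b\<in>B. (\<forall>b'\<in>B - {b}. ?a (U b) b' = 0) \<and> ?a (U b) b = f b"
    by (intro bchoice ballI)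
  then obtain U where U0: "\<forall>b\<in>B. (\<forall>b'\<in>B - {b}. ?a (U b) b' = 0) \<and> ?a (U b) b = f b" by (elim exE)
  have U: "\<And>b b'. b \<in> B \<Longrightarrow> b' \<in> B \<Longrightarrow> b' \<noteq> b \<Longrightarrow> ?a (U b) b' = 0"
    "\<And>b. b \<in> B \<Longrightarrow> ?a (U b) b = f b" using U0 by auto
  define u where "u = (\<Sum>b\<in>B. U b)"
  have base: "?a u b = f b" if b: "b \<in> B" for b
  proof -
    have "?a u b = (\<Sum>b'\<in>B. ?a (U b') b)" using b B(1) by (auto simp: u_def uea_act_sum_left)
    also have "\<dots> = (\<Sum>b'\<in>B. if b' = b then f b else 0)" using U b by (intro sum.cong) auto
    finally show ?thesis using finB b by simp
  qed
  have "v \<in> V \<and> ?a u v = f v" if "v \<in> span B" for v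
    using that
  proof (induction rule: span_induct_alt)
    case base
    then show ?case using f(3)[of 0 0] subspace_0[OF module_subspace] by (simp add: uea_act_zero_right)
  next
    case (step c x y)
    then have "x \<in> V" "s c x \<in> V" using B(1) subspace_scale[OF module_subspace] by auto
    then show ?case using step f base[OF step(1)] subspace_add[OF module_subspace] by (simp add: lin)
  qed
  then show ?thesis using VB by blast
qed

end

section \<open>Endomorphisms of the evaluation module\<close>

text \<open>The Lagrange interpolation polynomial with value \<open>1\<close> at \<open>a m\<close> and \<open>0\<close> at all other \<open>a k\<close>.\<close>

definition lagrange :: "('m::finite \<Rightarrow> complex) \<Rightarrow> 'm \<Rightarrow> laurent" where
  "lagrange a m = (\<Prod>k\<in>UNIV - {m}.
     (Poly_Mapping.single 1 1 - Poly_Mapping.single 0 (a k)) * Poly_Mapping.single 0 (1 / (a m - a k)))"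

lemma laurent_eval_prod:
  "z \<noteq> 0 \<Longrightarrow> laurent_eval z (prod f A) = (\<Prod>x\<in>A. laurent_eval z (f x))"
proof (induction A rule: infinite_finite_induct)
  case (insert x A)
  then show ?case by (simp add: laurent_eval_mult)
qed (simp_all add: laurent_eval_single single_one[symmetric] del: single_one)

lemma laurent_eval_lagrange:
  assumes "inj a" "a k \<noteq> 0"
  shows "laurent_eval (a k) (lagrange a m) = (if k = m then 1 else 0)"
proof (cases "k = m")
  case True
  then show ?thesis using assms
    by (simp add: lagrange_def laurent_eval_prod laurent_eval_mult laurent_eval_diff laurent_eval_single
        inj_eq prod.neutral)
next
  case False
  then show ?thesis using assms
    by (auto simp: lagrange_def laurent_eval_prod laurent_eval_mult laurent_eval_diff laurent_eval_single)
qed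

locale evaluation_module =
  fixes s :: "complex \<Rightarrow> 'v::ab_group_add \<Rightarrow> 'v" and V :: "'m::finite \<Rightarrow> 'v set"
    and \<rho> :: "'m \<Rightarrow> (complex, 'n::finite) gl \<Rightarrow> 'v \<Rightarrow> 'v" and a :: "'m \<Rightarrow> complex"
  assumes irr: "\<And>i. irreducible_lie_module s (V i) (\<rho> i)"
    and fin: "\<And>i. \<exists>B. finite B \<and> module.span s B = V i"
    and inj_a: "inj a" and nz: "\<And>i. a i \<noteq> 0"
begin

lemma mods: "lie_module s (V i) (\<rho> i)"
  using irr by (simp add: irreducible_lie_module_def)

interpretation vector_space s using mods by (simp add: lie_module_def)
interpretation F: vector_space fun_scale by (rule vector_space_fun_scale)

abbreviation "W \<equiv> tensor_product s V"
abbreviation "pt \<equiv> pure_tensor s V"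
abbreviation "L \<equiv> eval_act s V \<rho> a"
abbreviation "act \<equiv> uea_act fun_scale L"
abbreviation "G \<equiv> eval_act_gl s V \<rho> a"

lemmas Lmod = lie_module_eval[of s V \<rho> a, OF mods nz]
lemmas W_sub = module_subspace[OF Lmod]
lemmas pt_in = pure_tensor_in[of s V \<rho> a, OF mods nz]
lemmas pt_add = pure_tensor_add[of s V \<rho> a, OF mods nz]
lemmas pt_scale = pure_tensor_scale[of s V \<rho> a, OF mods nz]
lemmas W_induct = tensor_induct[of s V \<rho> a, OF mods nz, consumes 1, case_names zero add scale pure]
lemmas act_in = uea_act_in[OF Lmod]
lemmas act_lin = uea_act_lin[OF Lmod] uea_act_add[OF Lmod] uea_act_mult[OF Lmod] uea_act_const[OF Lmod]
  uea_act_zero_right[OF Lmod] uea_act_one[OF Lmod]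

lemma V_sub: "subspace (V i)" using mods[of i] by (simp add: lie_module_def)

lemma pt_zero: "(\<And>j. w j \<in> V j) \<Longrightarrow> pt (w(i := 0)) = 0"
  using pt_scale[of w 0 i 0] subspace_0[OF V_sub] by simp

lemma pt_sum:
  assumes w: "\<And>j. w j \<in> V j" and x: "\<And>b. b \<in> B \<Longrightarrow> x b \<in> V i"
  shows "pt (w(i := (\<Sum>b\<in>B. x b))) = (\<Sum>b\<in>B. pt (w(i := x b)))"
  using x
proof (induction B rule: infinite_finite_induct)
  case (insert b B)
  then show ?case using w
    by (simp add: pt_add subspace_sum[OF V_sub] del: fun_upd_apply plus_fun_apply)
qed (simp_all only: sum.infinite sum.empty not_False_eq_True pt_zero[OF w])

lemma slot_lift_gen:
  assumes w: "\<And>j. w j \<in> V j"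
  shows "L (gl_tensor X (lagrange a m)) (pt w) = pt (w(m := \<rho> m X (w m)))"
proof -
  have "L (gl_tensor X (lagrange a m)) (pt w)
    = (\<Sum>i\<in>UNIV. pt (w(i := \<rho> i (gl_eval (a i) (gl_tensor X (lagrange a m))) (w i))))"
    by (rule eval_act_pure[of s V \<rho> a, OF mods nz])
  also have "\<dots> = (\<Sum>i\<in>UNIV. if i = m then pt (w(m := \<rho> m X (w m))) else 0)"
  proof (intro sum.cong refl)
    fix i
    have "\<rho> i (lscale c X) (w i) = s c (\<rho> i X (w i))" for c
      using mods[of i] w by (auto simp: lie_module_def)
    then have "\<rho> i (gl_eval (a i) (gl_tensor X (lagrange a m))) (w i) = s (if i = m then 1 else 0) (\<rho> i X (w i))"
      by (simp add: gl_eval_tensor nz laurent_eval_lagrange inj_a)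
    then show "pt (w(i := \<rho> i (gl_eval (a i) (gl_tensor X (lagrange a m))) (w i)))
      = (if i = m then pt (w(m := \<rho> m X (w m))) else 0)"
      using pt_zero[OF w, of i] by (auto simp del: fun_upd_apply)
  qed
  also have "\<dots> = pt (w(m := \<rho> m X (w m)))" by simp
  finally show ?thesis .
qed

text \<open>Generators lift by Lagrange interpolation, and the elements that lift form a subalgebra.\<close>

lemma slot_lift:
  "\<exists>u'. \<forall>w. (\<forall>i. w i \<in> V i) \<longrightarrow> act u' (pt w) = pt (w(m := uea_act s (\<rho> m) u (w m)))"
proof (induction u rule: uea_induct)
  case (const c)
  have "act (uea_const c) (pt w) = pt (w(m := s c (w m)))" if w: "\<forall>i. w i \<in> V i" for w
    using pt_scale[of w "w m" m c] w pt_in[of w] by (simp add: act_lin)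
  then show ?case by (intro exI[of _ "uea_const c"]) (simp add: uea_act_const[OF mods] del: fun_upd_apply)
next
  case (gen x)
  have "act (uea_gen (gl_tensor x (lagrange a m))) (pt w) = pt (w(m := \<rho> m x (w m)))" if w: "\<forall>i. w i \<in> V i" for w
    using slot_lift_gen[of w] w pt_in[of w] by (simp add: uea_act_gen[OF Lmod])
  then show ?case by (intro exI[of _ "uea_gen (gl_tensor x (lagrange a m))"]) (simp add: uea_act_gen[OF mods] del: fun_upd_apply)
next
  case (add u v)
  then obtain u' v' where *: "\<forall>w. (\<forall>i. w i \<in> V i) \<longrightarrow> act u' (pt w) = pt (w(m := uea_act s (\<rho> m) u (w m)))"
    "\<forall>w. (\<forall>i. w i \<in> V i) \<longrightarrow> act v' (pt w) = pt (w(m := uea_act s (\<rho> m) v (w m)))" by blast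
  then show ?case
    by (intro exI[of _ "u' + v'"]) (simp add: act_lin uea_act_add[OF mods] pt_add pt_in uea_act_in[OF mods]
        del: fun_upd_apply plus_fun_apply)
next
  case (mult u v)
  then obtain u' v' where *: "\<forall>w. (\<forall>i. w i \<in> V i) \<longrightarrow> act u' (pt w) = pt (w(m := uea_act s (\<rho> m) u (w m)))"
    "\<forall>w. (\<forall>i. w i \<in> V i) \<longrightarrow> act v' (pt w) = pt (w(m := uea_act s (\<rho> m) v (w m)))" by blast
  have "act (u' * v') (pt w) = pt (w(m := uea_act s (\<rho> m) (u * v) (w m)))" if w: "\<forall>i. w i \<in> V i" for w
  proof -
    define w1 where "w1 = w(m := uea_act s (\<rho> m) v (w m))"
    have "\<forall>i. w1 i \<in> V i" using w by (simp add: w1_def uea_act_in[OF mods])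
    then have "act u' (pt w1) = pt (w1(m := uea_act s (\<rho> m) u (w1 m)))" using *(1) by blast
    moreover have "act v' (pt w) = pt w1" using *(2) w by (simp add: w1_def)
    ultimately show ?thesis using w by (simp add: act_lin pt_in uea_act_mult[OF mods] w1_def)
  qed
  then show ?case by blast
qed

text \<open>Burnside's theorem in each tensor factor, multiplied over the factors one by one.\<close>

lemma tensor_of_maps:
  assumes g: "\<And>i v. v \<in> V i \<Longrightarrow> g i v \<in> V i"
    "\<And>i v w. v \<in> V i \<Longrightarrow> w \<in> V i \<Longrightarrow> g i (v + w) = g i v + g i w"
    "\<And>i c v. v \<in> V i \<Longrightarrow> g i (s c v) = s c (g i v)"
  shows "\<exists>u. \<forall>w. (\<forall>i. w i \<in> V i) \<longrightarrow> act u (pt w) = pt (\<lambda>i. g i (w i))"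
proof -
  have "\<exists>u. \<forall>w. (\<forall>i. w i \<in> V i) \<longrightarrow> act u (pt w) = pt (\<lambda>i. if i \<in> M then g i (w i) else w i)" for M
    using finite[of M]
  proof (induction M rule: finite_induct)
    case empty
    then show ?case by (intro exI[of _ 1]) (simp add: act_lin pt_in)
  next
    case (insert m M)
    then obtain u where u: "\<And>w. (\<forall>i. w i \<in> V i) \<Longrightarrow> act u (pt w) = pt (\<lambda>i. if i \<in> M then g i (w i) else w i)"
      by blast
    obtain B where B: "finite B" "span B = V m" using fin by blast
    obtain v where v: "\<forall>x\<in>V m. uea_act s (\<rho> m) v x = g m x"
      using burnside[OF mods irr B(1) B(2)[symmetric], of "g m"] g by blast
    obtain v' where v': "\<And>w. (\<forall>i. w i \<in> V i) \<Longrightarrow> act v' (pt w) = pt (w(m := uea_act s (\<rho> m) v (w m)))"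
      using slot_lift by blast
    show ?case
    proof (intro exI[of _ "v' * u"] allI impI)
      fix w assume w: "\<forall>i. w i \<in> V i"
      define w1 where "w1 i = (if i \<in> M then g i (w i) else w i)" for i
      have w1: "\<forall>i. w1 i \<in> V i" using w g by (simp add: w1_def)
      have "act (v' * u) (pt w) = pt (w1(m := g m (w m)))"
        using w w1 u[OF w] v'[OF w1] v insert.hyps by (simp add: act_lin pt_in w1_def[abs_def] del: fun_upd_apply)
      also have "w1(m := g m (w m)) = (\<lambda>i. if i \<in> insert m M then g i (w i) else w i)"
        by (auto simp: w1_def)
      finally show "act (v' * u) (pt w) = pt (\<lambda>i. if i \<in> insert m M then g i (w i) else w i)" .
    qed
  qed
  from this[of UNIV] show ?thesis by simp
qed

lemma pt_scale_all:
  assumes w: "\<And>j. w j \<in> V j"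
  shows "pt (\<lambda>i. s (c i) (w i)) = fun_scale (\<Prod>i\<in>UNIV. c i) (pt w)"
proof -
  have "pt (\<lambda>i. if i \<in> M then s (c i) (w i) else w i) = fun_scale (\<Prod>i\<in>M. c i) (pt w)" for M
    using finite[of M]
  proof (induction M rule: finite_induct)
    case (insert m M)
    define w1 where "w1 i = (if i \<in> M then s (c i) (w i) else w i)" for i
    have w1: "w1 i \<in> V i" for i using w subspace_scale[OF V_sub] by (simp add: w1_def)
    have "(\<lambda>i. if i \<in> insert m M then s (c i) (w i) else w i) = w1(m := s (c m) (w1 m))"
      using insert.hyps by (auto simp: w1_def)
    moreover have "pt (w1(m := s (c m) (w1 m))) = fun_scale (c m) (pt w1)"
      using pt_scale[OF w1 w1, of m "c m"] by simp
    moreover have "pt w1 = fun_scale (\<Prod>i\<in>M. c i) (pt w)" using insert.IH by (simp add: w1_def[abs_def])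
    ultimately show ?case using insert.hyps by (simp del: fun_upd_apply insert_iff)
  qed (simp add: fun_scale_def)
  from this[of UNIV] show ?thesis by simp
qed

lemma exists_bases:
  obtains B where "\<And>i. finite (B i)" "\<And>i. independent (B i)" "\<And>i. span (B i) = V i"
proof -
  have "\<exists>B. finite B \<and> independent B \<and> span B = V i" for i
  proof -
    obtain G where G: "finite G" "span G = V i" using fin by blast
    obtain B where B: "B \<subseteq> V i" "independent B" "V i \<subseteq> span B"
      by (rule maximal_independent_subset[of "V i"])
    have "finite B" using independent_span_bound[OF G(1) B(2)] B(1) G(2) by blast
    moreover have "span B = V i" using B span_minimal[OF B(1) V_sub] by blast
    ultimately show ?thesis using B by blast
  qed
  then have "\<exists>B. \<forall>i. finite (B i) \<and> independent (B i) \<and> span (B i) = V i" by (intro choice allI)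
  then show ?thesis using that by blast
qed

text \<open>The pure tensors of basis vectors span, with coordinates \<open>\<theta>\<close>, and the corresponding matrix units are
tensor products of matrix units of the factors.\<close>

theorem enveloping_algebra_onto_endomorphisms:
  assumes g: "\<And>F. F \<in> W \<Longrightarrow> g F \<in> W"
    "\<And>F G. F \<in> W \<Longrightarrow> G \<in> W \<Longrightarrow> g (F + G) = g F + g G"
    "\<And>c F. F \<in> W \<Longrightarrow> g (fun_scale c F) = fun_scale c (g F)"
  shows "\<exists>u. \<forall>F\<in>W. act u F = g F"
proof -
  obtain B where B: "\<And>i. finite (B i)" "\<And>i. independent (B i)" "\<And>i. span (B i) = V i"
    by (rule exists_bases) blast
  define E where "E = (PiE UNIV B :: ('m \<Rightarrow> 'v) set)"
  have finE: "finite E" using B by (auto simp: E_def intro: finite_PiE)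
  have BV: "b \<in> B i \<Longrightarrow> b \<in> V i" for b i using span_base[of b "B i"] B(3) by blast
  have EV: "e \<in> E \<Longrightarrow> e i \<in> V i" for e i using BV by (auto simp: E_def PiE_def)
  define co where "co i v b = representation (B i) v b" for i v b
  have co_add: "v \<in> V i \<Longrightarrow> w \<in> V i \<Longrightarrow> co i (v + w) b = co i v b + co i w b"
    and co_scale: "v \<in> V i \<Longrightarrow> co i (s c v) b = c * co i v b" for i v w c b
    using representation_add[OF B(2), of w i v] representation_scale[OF B(2), of v i c] B(3)
    by (auto simp: co_def)
  have co_sum: "(\<Sum>b\<in>B i. s (co i v b) b) = v" if "v \<in> V i" for i v
    unfolding co_def using sum_representation_eq[OF B(2)[of i], of v "B i"] that B by auto
  define \<theta> where "\<theta> e F = F (\<lambda>w. \<Prod>i\<in>UNIV. co i (w i) (e i))" for e and F :: "(('m \<Rightarrow> 'v) \<Rightarrow> complex) \<Rightarrow> complex"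
  have ml: "multilinear_form s V (\<lambda>w. \<Prod>i\<in>UNIV. co i (w i) (e i))" for e
  proof -
    have "(\<Prod>j\<in>UNIV. co j ((w(i := x)) j) (e j)) = co i x (e i) * (\<Prod>j\<in>UNIV - {i}. co j (w j) (e j))" for w i x
      by (subst prod.remove[of UNIV i]) (auto intro!: prod.cong)
    then show ?thesis
      unfolding multilinear_form_def by (simp add: co_add co_scale distrib_right)
  qed
  have \<theta>_pt: "\<theta> e (pt w) = (\<Prod>i\<in>UNIV. co i (w i) (e i))" for e w
    by (simp add: \<theta>_def pure_tensor_def ml)
  have \<theta>_lin: "\<theta> e (F + G) = \<theta> e F + \<theta> e G" "\<theta> e (fun_scale c F) = c * \<theta> e F" "\<theta> e 0 = 0" for e F G c
    by (simp_all add: \<theta>_def fun_scale_def)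
  have expand_pt: "pt w = (\<Sum>e\<in>E. fun_scale (\<theta> e (pt w)) (pt e))" if w: "\<And>i. w i \<in> V i" for w
  proof -
    have "pt w = (\<Sum>e\<in>PiE M B. fun_scale (\<Prod>i\<in>M. co i (w i) (e i)) (pt (\<lambda>i. if i \<in> M then e i else w i)))" for M
      using finite[of M]
    proof (induction M rule: finite_induct)
      case empty
      then show ?case by (simp add: fun_scale_def)
    next
      case (insert m M)
      have "(\<Sum>e\<in>PiE (insert m M) B. fun_scale (\<Prod>i\<in>insert m M. co i (w i) (e i)) (pt (\<lambda>i. if i \<in> insert m M then e i else w i)))
        = (\<Sum>e\<in>PiE M B. \<Sum>b\<in>B m. fun_scale (\<Prod>i\<in>insert m M. co i (w i) ((e(m := b)) i))
            (pt (\<lambda>i. if i \<in> insert m M then (e(m := b)) i else w i)))"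
        by (rule sum_PiE_insert) fact
      also have "\<dots> = (\<Sum>e\<in>PiE M B. fun_scale (\<Prod>i\<in>M. co i (w i) (e i)) (pt (\<lambda>i. if i \<in> M then e i else w i)))"
      proof (intro sum.cong refl)
        fix e assume e: "e \<in> PiE M B"
        define w1 where "w1 i = (if i \<in> M then e i else w i)" for i
        have w1: "w1 i \<in> V i" for i using e w BV by (auto simp: w1_def)
        have "(\<Sum>b\<in>B m. fun_scale (\<Prod>i\<in>insert m M. co i (w i) ((e(m := b)) i))
            (pt (\<lambda>i. if i \<in> insert m M then (e(m := b)) i else w i)))
          = (\<Sum>b\<in>B m. fun_scale (\<Prod>i\<in>M. co i (w i) (e i)) (fun_scale (co m (w m) b) (pt (w1(m := b)))))"
        proof (intro sum.cong refl)
          fix b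
          have "(\<Prod>i\<in>insert m M. co i (w i) ((e(m := b)) i)) = co m (w m) b * (\<Prod>i\<in>M. co i (w i) (e i))"
            using insert.hyps by (auto intro!: prod.cong)
          moreover have "(\<lambda>i. if i \<in> insert m M then (e(m := b)) i else w i) = w1(m := b)"
            using insert.hyps by (auto simp: w1_def)
          ultimately show "fun_scale (\<Prod>i\<in>insert m M. co i (w i) ((e(m := b)) i))
              (pt (\<lambda>i. if i \<in> insert m M then (e(m := b)) i else w i))
            = fun_scale (\<Prod>i\<in>M. co i (w i) (e i)) (fun_scale (co m (w m) b) (pt (w1(m := b))))"
            by (simp add: mult.commute)
        qed
        also have "\<dots> = fun_scale (\<Prod>i\<in>M. co i (w i) (e i)) (\<Sum>b\<in>B m. pt (w1(m := s (co m (w m) b) b)))"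
          unfolding F.scale_sum_right by (intro sum.cong refl) (simp add: pt_scale w1 BV)
        also have "(\<Sum>b\<in>B m. pt (w1(m := s (co m (w m) b) b))) = pt (w1(m := (\<Sum>b\<in>B m. s (co m (w m) b) b)))"
          by (rule pt_sum[symmetric]) (auto simp: w1 BV subspace_scale[OF V_sub])
        also have "w1(m := (\<Sum>b\<in>B m. s (co m (w m) b) b)) = w1"
          using insert.hyps w by (auto simp: co_sum w1_def)
        finally show "(\<Sum>b\<in>B m. fun_scale (\<Prod>i\<in>insert m M. co i (w i) ((e(m := b)) i))
            (pt (\<lambda>i. if i \<in> insert m M then (e(m := b)) i else w i)))
          = fun_scale (\<Prod>i\<in>M. co i (w i) (e i)) (pt (\<lambda>i. if i \<in> M then e i else w i))"
          by (simp add: w1_def[abs_def])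
      qed
      finally show ?case using insert.IH by simp
    qed
    from this[of UNIV] show ?thesis
      unfolding E_def \<theta>_pt by (simp only: UNIV_I simp_thms if_True)
  qed
  have expand: "F = (\<Sum>e\<in>E. fun_scale (\<theta> e F) (pt e))" if "F \<in> W" for F
    using that
  proof (induction rule: W_induct)
    case zero
    then show ?case by (simp only: \<theta>_lin F.scale_zero_left sum.neutral_const)
  next
    case (add G H)
    then show ?case by (simp only: \<theta>_lin F.scale_left_distrib sum.distrib)
  next
    case (scale c G)
    then show ?case by (simp only: \<theta>_lin F.scale_scale[symmetric] F.scale_sum_right[symmetric])
  next
    case (pure w)
    then show ?case by (rule expand_pt)
  qed
  have "\<exists>u. \<forall>F\<in>W. act u F = fun_scale (\<theta> e F) (pt e')" if e: "e \<in> E" "e' \<in> E" for e e'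
  proof -
    obtain u where u: "\<And>w. (\<forall>i. w i \<in> V i) \<Longrightarrow> act u (pt w) = pt (\<lambda>i. s (co i (w i) (e i)) (e' i))"
      using tensor_of_maps[of "\<lambda>i v. s (co i v (e i)) (e' i)"] EV[OF e(2)]
      by (auto simp: co_add co_scale scale_left_distrib subspace_scale[OF V_sub])
    have "act u F = fun_scale (\<theta> e F) (pt e')" if "F \<in> W" for F
    proof -
      have "F \<in> W \<and> act u F = fun_scale (\<theta> e F) (pt e')"
        using that
      proof (induction rule: W_induct)
        case (pure w)
        then show ?case using u[of w] pt_scale_all[OF EV[OF e(2)], of "\<lambda>i. co i (w i) (e i)"]
          by (simp add: \<theta>_pt pt_in)
      qed (simp_all add: \<theta>_lin act_lin F.scale_left_distrib F.subspace_0[OF W_sub] F.subspace_add[OF W_sub]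
          F.subspace_scale[OF W_sub] del: zero_fun_apply plus_fun_apply)
      then show ?thesis by simp
    qed
    then show ?thesis by blast
  qed
  then have "\<exists>U. \<forall>ee\<in>E \<times> E. \<forall>F\<in>W. act (U ee) F = fun_scale (\<theta> (fst ee) F) (pt (snd ee))"
    by (intro bchoice) auto
  then obtain U where U: "\<And>e e' F. e \<in> E \<Longrightarrow> e' \<in> E \<Longrightarrow> F \<in> W \<Longrightarrow> act (U (e, e')) F = fun_scale (\<theta> e F) (pt e')"
    by force
  \<comment> \<open>\<open>u\<close> is the combination of matrix units given by the matrix of \<open>g\<close>\<close>
  define u where "u = (\<Sum>e\<in>E. \<Sum>e'\<in>E. uea_const (\<theta> e' (g (pt e))) * U (e, e'))"
  have g0: "g 0 = 0" using g(3)[OF F.subspace_0[OF W_sub], of 0] by simp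
  have g_sum: "(\<And>e. e \<in> A \<Longrightarrow> h e \<in> W) \<Longrightarrow> g (\<Sum>e\<in>A. h e) = (\<Sum>e\<in>A. g (h e))" for h :: "('m \<Rightarrow> 'v) \<Rightarrow> _" and A
    by (induction A rule: infinite_finite_induct) (simp_all add: g0 g F.subspace_sum[OF W_sub])
  have "act u F = g F" if F: "F \<in> W" for F
  proof -
    have ptW: "e \<in> E \<Longrightarrow> pt e \<in> W" for e using EV by (intro pt_in)
    have "g F = g (\<Sum>e\<in>E. fun_scale (\<theta> e F) (pt e))" using expand[OF F] by simp
    also have "\<dots> = (\<Sum>e\<in>E. fun_scale (\<theta> e F) (g (pt e)))"
      by (subst g_sum) (auto simp: g ptW F.subspace_scale[OF W_sub])
    also have "\<dots> = (\<Sum>e\<in>E. fun_scale (\<theta> e F) (\<Sum>e'\<in>E. fun_scale (\<theta> e' (g (pt e))) (pt e')))"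
      using expand[OF g(1)[OF ptW]] by (intro sum.cong refl) simp
    also have "\<dots> = (\<Sum>e\<in>E. \<Sum>e'\<in>E. fun_scale (\<theta> e' (g (pt e))) (fun_scale (\<theta> e F) (pt e')))"
      unfolding F.scale_sum_right by (intro sum.cong refl) (rule F.scale_left_commute)
    also have "\<dots> = (\<Sum>e\<in>E. \<Sum>e'\<in>E. act (uea_const (\<theta> e' (g (pt e))) * U (e, e')) F)"
      by (intro sum.cong refl)
        (simp add: act_lin act_in[OF F] U F F.subspace_scale[OF W_sub] ptW mult.commute)
    also have "\<dots> = act u F"
      using F by (simp add: u_def uea_act_sum_left[OF Lmod])
    finally show ?thesis ..
  qed
  then show ?thesis by blast
qed

end

section \<open>Invariant combinations of words\<close>

text \<open>A word is a list of letters \<open>(i, j, m)\<close>, to be read as \<open>E\<^sub>i\<^sub>j \<otimes> b\<^sub>m\<close>.\<close>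

definition set_row :: "nat \<Rightarrow> 'n \<Rightarrow> ('n \<times> 'n \<times> 'm) list \<Rightarrow> ('n \<times> 'n \<times> 'm) list" where
  "set_row r p w = w[r := (p, snd (w ! r))]"

definition set_col :: "nat \<Rightarrow> 'n \<Rightarrow> ('n \<times> 'n \<times> 'm) list \<Rightarrow> ('n \<times> 'n \<times> 'm) list" where
  "set_col r p w = w[r := (fst (w ! r), p, snd (snd (w ! r)))]"

definition row_at :: "('n \<times> 'n \<times> 'm) list \<Rightarrow> nat \<Rightarrow> 'n" where "row_at w r = fst (w ! r)"
definition col_at :: "('n \<times> 'n \<times> 'm) list \<Rightarrow> nat \<Rightarrow> 'n" where "col_at w r = fst (snd (w ! r))"

definition monomial :: "('m \<Rightarrow> laurent) \<Rightarrow> ('n \<times> 'n \<times> 'm) list \<Rightarrow> (laurent, 'n::finite) gl uea" where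
  "monomial b w = prod_list (map (\<lambda>(i, j, m). gE i j (b m)) w)"

definition words :: "nat \<Rightarrow> ('a::finite) list set" where
  "words K = {w. length w \<le> K}"

lemma finite_words: "finite (words K)"
  unfolding words_def by (rule finite_subset[OF _ finite_lists_length_le[OF finite[of UNIV], of K]]) auto

lemma gE_monomial_commutator:
  "gE p q 1 * monomial b w - monomial b w * gE p q 1
    = (\<Sum>r<length w. (if row_at w r = q then monomial b (set_row r p w) else 0)
        - (if col_at w r = p then monomial b (set_col r q w) else 0))"
proof (induction w)
  case Nil
  then show ?case by (simp add: monomial_def)
next
  case (Cons x w)
  obtain i j m where x: "x = (i, j, m)" by (cases x)
  have c: "monomial b (y # v) = (case y of (i, j, m) \<Rightarrow> gE i j (b m)) * monomial b v" for y v by (simp add: monomial_def)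
  have comm: "gE p q 1 * gE i j (b m) - gE i j (b m) * gE p q 1
    = (if q = i then gE p j (b m) else 0) - (if j = p then gE i q (b m) else 0)"
    by (simp add: gE_commutator)
  have "gE p q 1 * monomial b (x # w) - monomial b (x # w) * gE p q 1
    = (gE p q 1 * gE i j (b m) - gE i j (b m) * gE p q 1) * monomial b w
      + gE i j (b m) * (gE p q 1 * monomial b w - monomial b w * gE p q 1)"
    by (simp add: c x algebra_simps)
  also have "\<dots> = ((if q = i then gE p j (b m) else 0) - (if j = p then gE i q (b m) else 0)) * monomial b w
      + (\<Sum>r<length w. gE i j (b m) * ((if row_at w r = q then monomial b (set_row r p w) else 0)
        - (if col_at w r = p then monomial b (set_col r q w) else 0)))"
    by (simp only: comm Cons.IH sum_distrib_left)
  also have "\<dots> = (\<Sum>r<length (x # w). (if row_at (x # w) r = q then monomial b (set_row r p (x # w)) else 0)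
        - (if col_at (x # w) r = p then monomial b (set_col r q (x # w)) else 0))"
    unfolding length_Cons sum.lessThan_Suc_shift
    by (rule arg_cong2[where f = "(+)"])
      (auto simp: c x row_at_def col_at_def set_row_def set_col_def right_diff_distrib left_diff_distrib intro!: sum.cong)
  finally show ?case .
qed

text \<open>Replacing \<open>q\<close> by \<open>p\<close> in one place of a word, and back, is a bijection between the words with \<open>q\<close> and
the words with \<open>p\<close> in that place.\<close>

lemma sum_words_exchange:
  fixes H :: "'w::finite list \<Rightarrow> 'w list \<Rightarrow> 'c::comm_monoid_add" and get :: "'w \<Rightarrow> 'n" and put :: "'n \<Rightarrow> 'w \<Rightarrow> 'w"
  assumes gp: "\<And>p x. get (put p x) = p" "\<And>x. put (get x) x = x" "\<And>p q x. put p (put q x) = put p x"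
  shows "(\<Sum>w\<in>words K. \<Sum>r<length w. if get (w ! r) = q then H w (w[r := put p (w ! r)]) else 0)
    = (\<Sum>w\<in>words K. \<Sum>r<length w. if get (w ! r) = p then H (w[r := put q (w ! r)]) w else 0)"
proof -
  let ?S = "Sigma (words K) (\<lambda>w. {..<length w})"
  have fin: "finite ?S" using finite_words by auto
  have "(\<Sum>w\<in>words K. \<Sum>r<length w. if get (w ! r) = q then H w (w[r := put p (w ! r)]) else 0)
    = (\<Sum>(w, r)\<in>?S. if get (w ! r) = q then H w (w[r := put p (w ! r)]) else 0)"
    by (rule sum.Sigma) (auto simp: finite_words)
  also have "\<dots> = (\<Sum>(w, r)\<in>{(w, r)\<in>?S. get (w ! r) = q}. H w (w[r := put p (w ! r)]))"
    using fin by (intro sum.mono_neutral_cong_right) (auto split: if_splits)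
  also have "\<dots> = (\<Sum>(w, r)\<in>{(w, r)\<in>?S. get (w ! r) = p}. H (w[r := put q (w ! r)]) w)"
    by (rule sum.reindex_bij_witness[where i = "\<lambda>(w, r). (w[r := put q (w ! r)], r)"
          and j = "\<lambda>(w, r). (w[r := put p (w ! r)], r)"])
      (auto simp: gp words_def list_update_id)
  also have "\<dots> = (\<Sum>(w, r)\<in>?S. if get (w ! r) = p then H (w[r := put q (w ! r)]) w else 0)"
    using fin by (intro sum.mono_neutral_cong_left) (auto split: if_splits)
  also have "\<dots> = (\<Sum>w\<in>words K. \<Sum>r<length w. if get (w ! r) = p then H (w[r := put q (w ! r)]) w else 0)"
    by (rule sum.Sigma[symmetric]) (auto simp: finite_words)
  finally show ?thesis .
qed

lemma sum_words_exchange_row: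
  fixes H :: "('n::finite \<times> 'n \<times> 'm::finite) list \<Rightarrow> ('n \<times> 'n \<times> 'm) list \<Rightarrow> 'c::comm_monoid_add"
  shows "(\<Sum>w\<in>words K. \<Sum>r<length w. if row_at w r = q then H w (set_row r p w) else 0)
    = (\<Sum>w\<in>words K. \<Sum>r<length w. if row_at w r = p then H (set_row r q w) w else 0)"
  unfolding row_at_def set_row_def by (rule sum_words_exchange[of fst "\<lambda>p x. (p, snd x)"]) auto

lemma sum_words_exchange_col:
  fixes H :: "('n::finite \<times> 'n \<times> 'm::finite) list \<Rightarrow> ('n \<times> 'n \<times> 'm) list \<Rightarrow> 'c::comm_monoid_add"
  shows "(\<Sum>w\<in>words K. \<Sum>r<length w. if col_at w r = q then H w (set_col r p w) else 0)
    = (\<Sum>w\<in>words K. \<Sum>r<length w. if col_at w r = p then H (set_col r q w) w else 0)"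
  unfolding col_at_def set_col_def
  by (rule sum_words_exchange[of "\<lambda>x. fst (snd x)" "\<lambda>p x. (fst x, p, snd (snd x))"]) auto

text \<open>The action of \<open>E\<^sub>p\<^sub>q\<close> on coefficients that is induced by the commutator with words.\<close>

definition coeff_ad :: "'n \<Rightarrow> 'n \<Rightarrow> (('n \<times> 'n \<times> 'm) list \<Rightarrow> complex) \<Rightarrow> ('n \<times> 'n \<times> 'm) list \<Rightarrow> complex" where
  "coeff_ad p q c w = (\<Sum>r<length w. (if row_at w r = p then c (set_row r q w) else 0)
      - (if col_at w r = q then c (set_col r p w) else 0))"

definition coeff_elt :: "('m::finite \<Rightarrow> laurent) \<Rightarrow> nat \<Rightarrow> (('n \<times> 'n \<times> 'm) list \<Rightarrow> complex) \<Rightarrow> (laurent, 'n::finite) gl uea" where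
  "coeff_elt b K c = (\<Sum>w\<in>words K. uea_const (c w) * monomial b w)"

lemma uea_const_sum: "uea_const (sum f A) = (\<Sum>x\<in>A. uea_const (f x))"
  by (induction A rule: infinite_finite_induct) (simp_all add: uea_const_zero uea_const_add)

lemma uea_const_diff: "uea_const (c - d) = uea_const c - uea_const d"
  by (simp add: eq_diff_eq uea_const_add[symmetric])

lemma gE_coeff_elt_commutator: "gE p q 1 * coeff_elt b K c - coeff_elt b K c * gE p q 1 = coeff_elt b K (coeff_ad p q c)"
proof -
  have "gE p q 1 * coeff_elt b K c - coeff_elt b K c * gE p q 1
    = (\<Sum>w\<in>words K. uea_const (c w) * (gE p q 1 * monomial b w - monomial b w * gE p q 1))"
    unfolding coeff_elt_def sum_distrib_left sum_distrib_right sum_subtractf[symmetric]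
  proof (intro sum.cong refl)
    fix w
    have "gE p q 1 * (uea_const (c w) * monomial b w) = uea_const (c w) * (gE p q 1 * monomial b w)"
      by (simp only: mult.assoc[symmetric] uea_const_central[of "c w" "gE p q 1"])
    then show "gE p q 1 * (uea_const (c w) * monomial b w) - uea_const (c w) * monomial b w * gE p q 1
      = uea_const (c w) * (gE p q 1 * monomial b w - monomial b w * gE p q 1)"
      by (simp only: right_diff_distrib mult.assoc)
  qed
  also have "\<dots> = (\<Sum>w\<in>words K. \<Sum>r<length w. (if row_at w r = q then uea_const (c w) * monomial b (set_row r p w) else 0))
     - (\<Sum>w\<in>words K. \<Sum>r<length w. (if col_at w r = p then uea_const (c w) * monomial b (set_col r q w) else 0))"
    unfolding gE_monomial_commutator sum_distrib_left sum_subtractf[symmetric] right_diff_distrib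
    by (intro sum.cong refl) simp
  also have "\<dots> = (\<Sum>w\<in>words K. \<Sum>r<length w. (if row_at w r = p then uea_const (c (set_row r q w)) * monomial b w else 0))
     - (\<Sum>w\<in>words K. \<Sum>r<length w. (if col_at w r = q then uea_const (c (set_col r p w)) * monomial b w else 0))"
    by (subst sum_words_exchange_row[where H = "\<lambda>w v. uea_const (c w) * monomial b v"],
        subst sum_words_exchange_col[where H = "\<lambda>w v. uea_const (c w) * monomial b v"]) (rule refl)
  also have "\<dots> = coeff_elt b K (coeff_ad p q c)"
    unfolding coeff_elt_def coeff_ad_def uea_const_sum uea_const_diff sum_distrib_right sum_subtractf[symmetric] left_diff_distrib
    by (intro sum.cong refl) (auto simp: uea_const_zero)
  finally show ?thesis .
qed

text \<open>The analogue of the unitary trick of Weyl: the coefficient space is a unitary representation of the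
unitary group, so the adjoint of \<open>E\<^sub>p\<^sub>q\<close> is \<open>E\<^sub>q\<^sub>p\<close>.\<close>

lemma coeff_ad_adjoint:
  "(\<Sum>w\<in>words K. coeff_ad p q c w * cnj (k w)) = (\<Sum>w\<in>words K. c w * cnj (coeff_ad q p k w))"
proof -
  have "(\<Sum>w\<in>words K. coeff_ad p q c w * cnj (k w))
    = (\<Sum>w\<in>words K. \<Sum>r<length w. (if row_at w r = p then c (set_row r q w) * cnj (k w) else 0))
     - (\<Sum>w\<in>words K. \<Sum>r<length w. (if col_at w r = q then c (set_col r p w) * cnj (k w) else 0))"
    unfolding coeff_ad_def sum_distrib_right sum_subtractf[symmetric] left_diff_distrib
    by (intro sum.cong refl) auto
  also have "\<dots> = (\<Sum>w\<in>words K. \<Sum>r<length w. (if row_at w r = q then c w * cnj (k (set_row r p w)) else 0))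
     - (\<Sum>w\<in>words K. \<Sum>r<length w. (if col_at w r = p then c w * cnj (k (set_col r q w)) else 0))"
    by (subst sum_words_exchange_row[where H = "\<lambda>w v. c v * cnj (k w)"], subst sum_words_exchange_col[where H = "\<lambda>w v. c v * cnj (k w)"]) (rule refl)
  also have "\<dots> = (\<Sum>w\<in>words K. c w * cnj (coeff_ad q p k w))"
    unfolding coeff_ad_def cnj_sum sum_distrib_left sum_subtractf[symmetric] complex_cnj_diff right_diff_distrib
    by (intro sum.cong refl) auto
  finally show ?thesis .
qed

definition word :: "nat \<Rightarrow> (nat \<Rightarrow> 'n) \<Rightarrow> (nat \<Rightarrow> 'n) \<Rightarrow> (nat \<Rightarrow> 'm) \<Rightarrow> ('n \<times> 'n \<times> 'm) list" where
  "word k x y ms = map (\<lambda>r. (x r, y r, ms r)) [0..<k]"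

lemma sum_words_tuples:
  fixes h :: "('n::finite \<times> 'n \<times> 'm::finite) list \<Rightarrow> 'c::comm_monoid_add"
  shows "(\<Sum>w\<in>words K. h w)
    = (\<Sum>k\<le>K. \<Sum>ms\<in>tuples {..<k}. \<Sum>x\<in>tuples {..<k}. \<Sum>y\<in>tuples {..<k}. h (word k x y ms))"
proof -
  have "(\<Sum>w\<in>words K. h w) = (\<Sum>k\<le>K. \<Sum>w | length w = k. h w)"
  proof -
    have "words K = (\<Union>k\<le>K. {w :: ('n \<times> 'n \<times> 'm) list. length w = k})" by (auto simp: words_def)
    moreover have "finite {w :: ('n \<times> 'n \<times> 'm) list. length w = k}" for k
      using finite_lists_length_eq[of "UNIV :: ('n \<times> 'n \<times> 'm) set" k] by simp
    ultimately show ?thesis by (simp only:) (rule sum.UNION_disjoint, auto)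
  qed
  also have "\<dots> = (\<Sum>k\<le>K. \<Sum>(ms, x, y)\<in>tuples {..<k} \<times> tuples {..<k} \<times> tuples {..<k}. h (word k x y ms))"
  proof (intro sum.cong refl)
    fix k
    show "(\<Sum>w | length w = k. h w)
      = (\<Sum>(ms, x, y)\<in>tuples {..<k} \<times> tuples {..<k} \<times> tuples {..<k}. h (word k x y ms))"
      by (rule sum.reindex_bij_witness[where
            j = "\<lambda>w. (restrict (\<lambda>r. snd (snd (w ! r))) {..<k}, restrict (\<lambda>r. fst (w ! r)) {..<k},
                 restrict (\<lambda>r. fst (snd (w ! r))) {..<k})"
            and i = "\<lambda>(ms, x, y). word k x y ms"])
        (auto simp: word_def tuples_def PiE_def extensional_def fun_eq_iff intro!: nth_equalityI arg_cong[where f = h])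
  qed
  also have "\<dots> = (\<Sum>k\<le>K. \<Sum>ms\<in>tuples {..<k}. \<Sum>x\<in>tuples {..<k}. \<Sum>y\<in>tuples {..<k}. h (word k x y ms))"
    by (simp add: sum.cartesian_product split_beta)
  finally show ?thesis .
qed

text \<open>Invariance preserves the length of words and their labels \<open>m\<close>. For a fixed length and fixed labels the
coefficients are functions of row and column tuples, and the first fundamental theorem writes them as
combinations of the coefficients of permuted traces.\<close>

lemma coeff_elt_invariant_in_trace_alg:
  fixes c :: "('n::finite \<times> 'n \<times> 'm::finite) list \<Rightarrow> complex"
  assumes inv: "\<And>p q w. w \<in> words K \<Longrightarrow> coeff_ad p q c w = 0"
  shows "coeff_elt b K c \<in> trace_alg"
proof -
  have inner: "(\<Sum>x\<in>tuples {..<k}. \<Sum>y\<in>tuples {..<k}. uea_const (c (word k x y ms)) * monomial b (word k x y ms)) \<in> trace_alg"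
    if "k \<le> K" "ms \<in> tuples {..<k}" for k and ms :: "nat \<Rightarrow> 'm"
  proof -
    let ?I = "{..<k}" and ?G = "{\<sigma>. \<sigma> permutes {..<k}}"
    have inv': "(\<Sum>r\<in>?I. of_bool (x r = p) * c (word k (x(r := q)) y ms))
      = (\<Sum>r\<in>?I. of_bool (y r = q) * c (word k x (y(r := p)) ms))" for p q :: 'n and x y :: "nat \<Rightarrow> 'n"
    proof -
      have sr: "set_row r q (word k x y ms) = word k (x(r := q)) y ms"
        and sc: "set_col r q (word k x y ms) = word k x (y(r := q)) ms" if "r < k"
        for r and q :: 'n and x y :: "nat \<Rightarrow> 'n"
        using that by (auto simp: set_row_def set_col_def word_def nth_list_update intro!: nth_equalityI)
      have at: "length (word k x y ms) = k" "r < k \<Longrightarrow> row_at (word k x y ms) r = x r"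
        "r < k \<Longrightarrow> col_at (word k x y ms) r = y r" for r
        by (auto simp: word_def row_at_def col_at_def)
      have "(\<Sum>r\<in>?I. of_bool (x r = p) * c (word k (x(r := q)) y ms)) - (\<Sum>r\<in>?I. of_bool (y r = q) * c (word k x (y(r := p)) ms))
        = coeff_ad p q c (word k x y ms)"
        unfolding coeff_ad_def sum_subtractf[symmetric]
        by (intro sum.cong) (simp_all add: sr sc at)
      also have "\<dots> = 0" using that by (intro inv) (simp add: words_def word_def)
      finally show ?thesis by simp
    qed
    obtain \<gamma> where \<gamma>: "\<And>x y. x \<in> tuples ?I \<Longrightarrow> y \<in> tuples ?I \<Longrightarrow>
        c (word k x y ms) = (\<Sum>\<sigma>\<in>?G. \<gamma> \<sigma> * of_bool (y = x \<circ> \<sigma>))"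
      by (rule gl_invariants_spanned_by_permutations[of ?I "\<lambda>x y. c (word k x y ms)"]) (use inv' in auto)
    have "(\<Sum>x\<in>tuples ?I. \<Sum>y\<in>tuples ?I. uea_const (c (word k x y ms)) * monomial b (word k x y ms))
      = (\<Sum>x\<in>tuples ?I. \<Sum>\<sigma>\<in>?G. \<Sum>y\<in>tuples ?I. if y = x \<circ> \<sigma> then uea_const (\<gamma> \<sigma>) * monomial b (word k x y ms) else 0)"
      by (subst (2) sum.swap, intro sum.cong refl)
        (auto simp: \<gamma> uea_const_sum sum_distrib_right uea_const_zero intro!: sum.cong)
    also have "\<dots> = (\<Sum>x\<in>tuples ?I. \<Sum>\<sigma>\<in>?G. uea_const (\<gamma> \<sigma>) * monomial b (word k x (x \<circ> \<sigma>) ms))"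
      by (intro sum.cong refl) (auto simp: finite_tuples tuples_comp)
    also have "\<dots> = (\<Sum>\<sigma>\<in>?G. uea_const (\<gamma> \<sigma>) * index_sum ?I (map (\<lambda>r. (r, \<sigma> r, b (ms r))) [0..<k]))"
      by (subst sum.swap) (simp add: sum_distrib_left index_sum_def monomial_def word_def letter_def comp_def)
    also have "\<dots> \<in> trace_alg"
    proof (intro trace_alg_sum trace_alg_mult trace_alg_const index_sum_in_trace_alg)
      fix \<sigma> assume "\<sigma> \<in> ?G"
      then have "inj \<sigma>" "\<sigma> ` {..<k} = {..<k}" by (auto dest: permutes_inj permutes_image)
      then show "matched ?I (map (\<lambda>r. (r, \<sigma> r, b (ms r))) [0..<k])"
        by (auto simp: matched_def comp_def distinct_map lessThan_atLeast0 intro: inj_on_subset)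
    qed
    finally show ?thesis .
  qed
  have "(\<Sum>ms\<in>tuples {..<k}. \<Sum>x\<in>tuples {..<k}. \<Sum>y\<in>tuples {..<k}.
      uea_const (c (word k x y ms)) * monomial b (word k x y ms)) \<in> trace_alg" if "k \<le> K" for k
    by (rule trace_alg_sum) (rule inner[OF that])
  then show ?thesis unfolding coeff_elt_def sum_words_tuples by (rule trace_alg_sum) simp
qed

context evaluation_module
begin

interpretation vector_space s using mods by (simp add: lie_module_def)
interpretation F: vector_space fun_scale by (rule vector_space_fun_scale)

abbreviation "word_elt \<equiv> coeff_elt (lagrange a)"
abbreviation "mon \<equiv> monomial (lagrange a)"

lemma L_depends_on_evaluations:
  "(\<And>m. gl_eval (a m) x = gl_eval (a m) y) \<Longrightarrow> L x = L y"
  by (simp add: eval_act_def fun_eq_iff)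

text \<open>An element of \<open>g \<otimes> A\<close> acts through its values at the points \<open>a m\<close>, so interpolation replaces it by a
combination of letters.\<close>

lemma L_letters:
  assumes F: "F \<in> W"
  shows "L x F = (\<Sum>l\<in>UNIV. fun_scale (case l of (i, j, m) \<Rightarrow> mat_of_gl (gl_eval (a m) x) $ i $ j)
     (act (mon [l]) F))"
proof -
  define co where "co l = (case l of (i, j, m) \<Rightarrow> mat_of_gl (gl_eval (a m) x) $ i $ j)" for l :: "'n \<times> 'n \<times> 'm"
  define y where "y = (\<Sum>l\<in>UNIV. case l of (i, j, m) \<Rightarrow> lscale (co l) (gl_tensor (gl_unit i j) (lagrange a m)))"
  have gs: "gl_eval z (sum f A) = (\<Sum>l\<in>A. gl_eval z (f l))" for z and f :: "'n \<times> 'n \<times> 'm \<Rightarrow> (laurent, 'n) gl" and A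
  proof -
    have "gl_eval z 0 = (0 :: (complex, 'n) gl)" by transfer (simp add: vec_eq_iff laurent_eval_zero)
    then show ?thesis
      by (induction A rule: infinite_finite_induct) (simp_all add: gl_eval_add)
  qed
  have ms: "mat_of_gl (sum f A) = (\<Sum>l\<in>A. mat_of_gl (f l))" for f :: "'n \<times> 'n \<times> 'm \<Rightarrow> (complex, 'n) gl" and A
    by (induction A rule: infinite_finite_induct) (simp_all add: zero_gl.rep_eq plus_gl.rep_eq)
  have "gl_eval (a k) y = gl_eval (a k) x" for k
  proof -
    have "mat_of_gl (gl_eval (a k) y) $ i0 $ j0 = mat_of_gl (gl_eval (a k) x) $ i0 $ j0" for i0 j0
    proof -
      have "mat_of_gl (gl_eval (a k) y) $ i0 $ j0
        = (\<Sum>l\<in>UNIV. if l = (i0, j0, k) then mat_of_gl (gl_eval (a k) x) $ i0 $ j0 else 0)"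
        unfolding y_def gs ms sum_component
      proof (intro sum.cong refl)
        fix l :: "'n \<times> 'n \<times> 'm"
        obtain i j m where "l = (i, j, m)" by (cases l)
        then show "mat_of_gl (gl_eval (a k) (case l of (i, j, m) \<Rightarrow> lscale (co l) (gl_tensor (gl_unit i j) (lagrange a m)))) $ i0 $ j0
          = (if l = (i0, j0, k) then mat_of_gl (gl_eval (a k) x) $ i0 $ j0 else 0)"
          by (auto simp: gl_eval_lscale nz gl_eval_tensor laurent_eval_lagrange inj_a lscale_gl.rep_eq
              gl_unit.rep_eq of_C_complex_def co_def)
      qed
      then show ?thesis by simp
    qed
    then show ?thesis by (simp add: mat_of_gl_inject[symmetric] vec_eq_iff)
  qed
  then have "L x F = L y F" using L_depends_on_evaluations[of x y] by simp
  also have "\<dots> = act (uea_gen y) F" using F by (simp add: uea_act_gen[OF Lmod])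
  also have "uea_gen y = (\<Sum>l\<in>UNIV. uea_const (co l) * mon [l])"
    unfolding y_def uea_gen_sum
    by (intro sum.cong refl) (auto simp: uea_gen_lscale monomial_def gE_def)
  also have "act \<dots> F = (\<Sum>l\<in>UNIV. fun_scale (co l) (act (mon [l]) F))"
    using F by (simp add: uea_act_sum_left[OF Lmod] act_lin act_in)
  finally show ?thesis by (simp add: co_def)
qed

lemma foldr_L_words:
  "\<exists>c. \<forall>F\<in>W. foldr L xs F = (\<Sum>w | length w = length xs. fun_scale (c w) (act (mon w) F))"
proof (induction xs)
  case Nil
  show ?case by (intro exI[of _ "\<lambda>_. 1"]) (simp add: monomial_def act_lin)
next
  case (Cons x xs)
  then obtain c where c: "\<And>F. F \<in> W \<Longrightarrow> foldr L xs F
    = (\<Sum>w | length w = length xs. fun_scale (c w) (act (mon w) F))" by blast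
  define co where "co l = (case l of (i, j, m) \<Rightarrow> mat_of_gl (gl_eval (a m) x) $ i $ j)" for l :: "'n \<times> 'n \<times> 'm"
  have "foldr L (x # xs) F = (\<Sum>w | length w = length (x # xs).
      fun_scale (co (hd w) * c (tl w)) (act (mon w) F))" if F: "F \<in> W" for F
  proof -
    let ?S = "{w :: ('n \<times> 'n \<times> 'm) list. length w = length xs}"
    have "foldr L (x # xs) F = (\<Sum>l\<in>UNIV. fun_scale (co l) (act (mon [l]) (foldr L xs F)))"
      using L_letters[OF foldr_act_in[OF Lmod F]] by (simp add: co_def)
    also have "\<dots> = (\<Sum>l\<in>UNIV. \<Sum>w\<in>?S. fun_scale (co l * c w) (act (mon (l # w)) F))"
    proof (intro sum.cong refl)
      fix l :: "'n \<times> 'n \<times> 'm"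
      have m: "mon [l] * mon w = mon (l # w)" for w by (simp add: monomial_def)
      have "act (mon [l]) (foldr L xs F)
        = (\<Sum>w\<in>?S. act (mon [l]) (fun_scale (c w) (act (mon w) F)))"
        unfolding c[OF F] by (rule uea_act_sum_right[OF Lmod]) (intro F.subspace_scale[OF W_sub] act_in F)
      also have "\<dots> = (\<Sum>w\<in>?S. fun_scale (c w) (act (mon (l # w)) F))"
        by (intro sum.cong refl)
          (simp only: act_lin(2)[OF act_in[OF F]] uea_act_mult[OF Lmod F, symmetric] m)
      finally show "fun_scale (co l) (act (mon [l]) (foldr L xs F))
        = (\<Sum>w\<in>?S. fun_scale (co l * c w) (act (mon (l # w)) F))"
        by (simp add: F.scale_sum_right)
    qed
    also have "\<dots> = (\<Sum>(l, w)\<in>UNIV \<times> ?S. fun_scale (co l * c w) (act (mon (l # w)) F))"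
      by (rule sum.cartesian_product)
    also have "\<dots> = (\<Sum>w | length w = length (x # xs).
      fun_scale (co (hd w) * c (tl w)) (act (mon w) F))"
      by (rule sum.reindex_bij_witness[where j = "\<lambda>(l, w). l # w" and i = "\<lambda>w. (hd w, tl w)"])
        (auto simp: length_Suc_conv)
    finally show ?thesis .
  qed
  then show ?case by (intro exI[of _ "\<lambda>w. co (hd w) * c (tl w)"]) blast
qed

lemma act_word_elt: "F \<in> W \<Longrightarrow> act (word_elt K c) F = (\<Sum>w\<in>words K. fun_scale (c w) (act (mon w) F))"
  by (simp add: coeff_elt_def uea_act_sum_left[OF Lmod] act_lin act_in)

lemma act_eq_word_elt: "\<exists>K c. \<forall>F\<in>W. act u F = act (word_elt K c) F"
proof -
  define p where "p = rep_uea u"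
  have "\<exists>C. \<forall>xs. \<forall>F\<in>W. foldr L xs F = (\<Sum>w | length w = length xs. fun_scale (C xs w) (act (mon w) F))"
    by (intro choice allI foldr_L_words)
  then obtain C where C: "\<And>xs F. F \<in> W \<Longrightarrow>
    foldr L xs F = (\<Sum>w | length w = length xs. fun_scale (C xs w) (act (mon w) F))" by blast
  \<comment> \<open>\<open>0\<close> is inserted because \<open>p\<close> may have no words at all\<close>
  define K where "K = Max (insert 0 ((\<lambda>k. length (letters k)) ` Poly_Mapping.keys p))"
  have K: "length (letters k) \<le> K" if "k \<in> Poly_Mapping.keys p" for k
    unfolding K_def using that by (intro Max_ge) auto
  define co where "co k w = (if length w = length (letters k)
      then Poly_Mapping.lookup p k * C (letters k) w else 0)" for k w
  define c where "c w = (\<Sum>k\<in>Poly_Mapping.keys p. co k w)" for w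
  have "act u F = act (word_elt K c) F" if F: "F \<in> W" for F
  proof -
    let ?A = "\<lambda>w. act (mon w) F"
    have "act u F = (\<Sum>k\<in>Poly_Mapping.keys p. fun_scale (Poly_Mapping.lookup p k) (foldr L (letters k) F))"
      by (simp add: uea_act_def free_act_def p_def)
    also have "\<dots> = (\<Sum>k\<in>Poly_Mapping.keys p. \<Sum>w\<in>words K. fun_scale (co k w) (?A w))"
    proof (intro sum.cong refl)
      fix k assume k: "k \<in> Poly_Mapping.keys p"
      have "fun_scale (Poly_Mapping.lookup p k) (foldr L (letters k) F)
        = (\<Sum>w | length w = length (letters k). fun_scale (co k w) (?A w))"
        by (simp add: C[OF F] F.scale_sum_right co_def)
      also have "\<dots> = (\<Sum>w\<in>words K. fun_scale (co k w) (?A w))"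
        using K[OF k] by (intro sum.mono_neutral_left finite_words) (auto simp: words_def co_def)
      finally show "fun_scale (Poly_Mapping.lookup p k) (foldr L (letters k) F)
        = (\<Sum>w\<in>words K. fun_scale (co k w) (?A w))" .
    qed
    also have "\<dots> = act (word_elt K c) F"
      unfolding act_word_elt[OF F] c_def F.scale_sum_left by (rule sum.swap)
    finally show ?thesis .
  qed
  then show ?thesis by blast
qed

lemma eval_act_gl_unit: "F \<in> W \<Longrightarrow> G (gl_unit p q) F = act (gE p q 1) F"
  by (simp add: eval_act_gl_def gE_def uea_act_gen[OF Lmod])

text \<open>Extend \<open>f\<close> to all of \<open>W\<close> and realise it by a combination of words. Subtracting the orthogonal
projection to the coefficients that act by \<open>0\<close> on \<open>N\<close> leaves an invariant coefficient function.\<close>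

theorem equivariant_map_from_trace_alg:
  assumes N: "lie_submodule fun_scale W (G) N"
    and f: "\<And>F. F \<in> N \<Longrightarrow> f F \<in> W"
    "\<And>F G. F \<in> N \<Longrightarrow> G \<in> N \<Longrightarrow> f (F + G) = f F + f G"
    "\<And>c F. F \<in> N \<Longrightarrow> f (fun_scale c F) = fun_scale c (f F)"
    "\<And>X F. F \<in> N \<Longrightarrow> f (G X F) = G X (f F)"
  shows "\<exists>x\<in>trace_alg. \<forall>F\<in>N. act x F = f F"
proof -
  interpret FF: vector_space_pair fun_scale fun_scale by unfold_locales
  have NW: "F \<in> N \<Longrightarrow> F \<in> W" and Nsub: "F.subspace N"
    and NE: "F \<in> N \<Longrightarrow> act (gE p q 1) F \<in> N" for F p q
    using N eval_act_gl_unit by (auto simp: lie_submodule_def) (metis subsetD)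
  obtain B where B: "B \<subseteq> N" "F.independent B" "N \<subseteq> F.span B"
    by (rule F.maximal_independent_subset)
  obtain g where g: "Vector_Spaces.linear fun_scale fun_scale g" "\<And>x. x \<in> B \<Longrightarrow> g x = f x" "range g = F.span (f ` B)"
    using FF.linear_independent_extend_subspace[OF B(2), of f] by blast
  have gf: "F \<in> N \<and> g F = f F" if "F \<in> F.span B" for F
    using that
  proof (induction rule: F.span_induct_alt)
    case base
    have "f 0 = 0" using f(3)[OF F.subspace_0[OF Nsub], of 0] by (simp only: F.scale_zero_left)
    then show ?case using F.subspace_0[OF Nsub] FF.linear_0[OF g(1)] by (simp only: simp_thms)
  next
    case (step c x y)
    then have "x \<in> N" using B(1) by blast
    then have "fun_scale c x \<in> N" by (rule F.subspace_scale[OF Nsub])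
    then show ?case using step g(2)[OF step(1)] \<open>x \<in> N\<close> F.subspace_add[OF Nsub]
      by (simp add: FF.linear_add[OF g(1)] FF.linear_scale[OF g(1)] f del: plus_fun_apply)
  qed
  have gW: "g F \<in> W" for F
  proof -
    have "F.span (f ` B) \<subseteq> W" using f(1) B(1) by (intro F.span_minimal[OF _ W_sub]) auto
    then show ?thesis using g(3) by blast
  qed
  obtain u where u: "\<And>F. F \<in> W \<Longrightarrow> act u F = g F"
    using enveloping_algebra_onto_endomorphisms[of g] gW FF.linear_add[OF g(1)] FF.linear_scale[OF g(1)] by blast
  obtain K c0 where c0: "\<And>F. F \<in> W \<Longrightarrow> act u F = act (word_elt K c0) F" using act_eq_word_elt by blast
  have c0f: "act (word_elt K c0) F = f F" if "F \<in> N" for F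
    using c0[OF NW[OF that]] u[OF NW[OF that]] gf that B(3) by auto
  \<comment> \<open>the coefficient functions that act by \<open>0\<close> on \<open>N\<close>\<close>
  define Ker where "Ker = {c. \<forall>F\<in>N. act (word_elt K c) F = 0}"
  have el_add: "act (word_elt K (\<lambda>w. c w + d w)) F = act (word_elt K c) F + act (word_elt K d) F"
    and el_scale: "act (word_elt K (\<lambda>w. z * c w)) F = fun_scale z (act (word_elt K c) F)" if "F \<in> N" for c d z F
    using NW[OF that] by (simp_all only: act_word_elt F.scale_left_distrib sum.distrib F.scale_sum_right F.scale_scale)
  have "\<exists>k\<in>Ker. \<forall>k'\<in>Ker. (\<Sum>w\<in>words K. (c0 w - k w) * cnj (k' w)) = 0"
  proof (rule orthogonal_projection_exists[OF finite_words])
    show "(\<lambda>_. 0) \<in> Ker" using NW by (simp add: Ker_def act_word_elt)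
    show "(\<lambda>w. c w + d w) \<in> Ker" if "c \<in> Ker" "d \<in> Ker" for c d
      using that by (simp add: Ker_def el_add del: plus_fun_apply)
    show "(\<lambda>w. z * c w) \<in> Ker" if "c \<in> Ker" for z c
      using that by (simp add: Ker_def el_scale)
  qed
  then obtain k where k: "k \<in> Ker" "\<And>k'. k' \<in> Ker \<Longrightarrow> (\<Sum>w\<in>words K. (c0 w - k w) * cnj (k' w)) = 0"
    by blast
  define c where "c w = c0 w - k w" for w
  have cf: "act (word_elt K c) F = f F" if "F \<in> N" for F
  proof -
    have "act (word_elt K (\<lambda>w. c0 w + (-1) * k w)) F = f F"
      using k(1) that by (simp only: el_add el_scale c0f) (simp add: Ker_def)
    then show ?thesis by (simp add: c_def[abs_def])
  qed
  have ad_act: "act (word_elt K (coeff_ad p q d)) F = act (gE p q 1) (act (word_elt K d) F) - act (word_elt K d) (act (gE p q 1) F)"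
    if "F \<in> N" for p q d F
  proof -
    have "gE p q 1 * word_elt K d = word_elt K (coeff_ad p q d) + word_elt K d * gE p q 1"
      using gE_coeff_elt_commutator[of p q "lagrange a" K d] by (simp add: algebra_simps)
    then have "act (gE p q 1 * word_elt K d) F = act (word_elt K (coeff_ad p q d) + word_elt K d * gE p q 1) F" by simp
    then show ?thesis using NW[OF that] by (simp only: act_lin) simp
  qed
  have ad_Ker: "coeff_ad p q d \<in> Ker" if "d \<in> Ker" for p q d
    using that NE by (auto simp: Ker_def ad_act act_lin)
  have ad_c: "coeff_ad p q c \<in> Ker" for p q
  proof -
    have "act (gE p q 1) (f F) = f (act (gE p q 1) F)" if "F \<in> N" for F
      using f(4)[OF that, of "gl_unit p q"] eval_act_gl_unit[OF NW[OF that]] eval_act_gl_unit[OF f(1)[OF that]]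
      by simp
    then show ?thesis using NE by (simp add: Ker_def ad_act cf)
  qed
  have "coeff_ad p q c w = 0" if "w \<in> words K" for p q w
  proof -
    have "(\<Sum>w\<in>words K. coeff_ad p q c w * cnj (coeff_ad p q c w)) = (\<Sum>w\<in>words K. c w * cnj (coeff_ad q p (coeff_ad p q c) w))"
      by (rule coeff_ad_adjoint)
    also have "\<dots> = 0" using k(2)[OF ad_Ker[OF ad_c]] by (simp add: c_def)
    finally show ?thesis using that by (simp add: sum_mult_cnj_eq_0_iff finite_words)
  qed
  then have "word_elt K c \<in> trace_alg" by (rule coeff_elt_invariant_in_trace_alg)
  then show ?thesis using cf by blast
qed

end

section \<open>Isotypic components\<close>

lemma lie_module_iso_sym:
  assumes "lie_module_iso s V \<rho> s' V' \<rho>'" and "lie_module s V \<rho>"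
  shows "lie_module_iso s' V' \<rho>' s V \<rho>"
proof -
  interpret vector_space s using assms(2) by (simp add: lie_module_def)
  obtain \<phi> where \<phi>: "bij_betw \<phi> V V'" "\<forall>v\<in>V. \<forall>w\<in>V. \<phi> (v + w) = \<phi> v + \<phi> w"
    "\<forall>c. \<forall>v\<in>V. \<phi> (s c v) = s' c (\<phi> v)" "\<forall>x. \<forall>v\<in>V. \<phi> (\<rho> x v) = \<rho>' x (\<phi> v)"
    using assms(1) by (auto simp: lie_module_iso_def)
  define \<psi> where "\<psi> = inv_into V \<phi>"
  have \<psi>: "bij_betw \<psi> V' V" unfolding \<psi>_def by (rule bij_betw_inv_into) fact
  have \<psi>V: "y \<in> V' \<Longrightarrow> \<psi> y \<in> V" "y \<in> V' \<Longrightarrow> \<phi> (\<psi> y) = y" for y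
    using bij_betw_inv_into_right[OF \<phi>(1)] bij_betw_apply[OF \<psi>] by (auto simp: \<psi>_def)
  have \<psi>\<phi>: "v \<in> V \<Longrightarrow> \<psi> (\<phi> v) = v" for v
    using bij_betw_inv_into_left[OF \<phi>(1)] by (simp add: \<psi>_def)
  have V: "v \<in> V \<Longrightarrow> w \<in> V \<Longrightarrow> v + w \<in> V" "v \<in> V \<Longrightarrow> s c v \<in> V" "v \<in> V \<Longrightarrow> \<rho> x v \<in> V" for v w c x
    using assms(2) by (auto simp: lie_module_def intro: subspace_add subspace_scale)
  show ?thesis
    unfolding lie_module_iso_def
  proof (intro exI[of _ \<psi>] conjI ballI allI)
    show "bij_betw \<psi> V' V" by fact
    fix v c x assume v: "v \<in> V'"
    show "\<psi> (s' c v) = s c (\<psi> v)" using \<psi>\<phi>[of "s c (\<psi> v)"] \<phi>(3) \<psi>V v V by auto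
    show "\<psi> (\<rho>' x v) = \<rho> x (\<psi> v)" using \<psi>\<phi>[of "\<rho> x (\<psi> v)"] \<phi>(4) \<psi>V v V by auto
    fix w assume w: "w \<in> V'"
    show "\<psi> (v + w) = \<psi> v + \<psi> w" using \<psi>\<phi>[of "\<psi> v + \<psi> w"] \<phi>(2) \<psi>V v w V by auto
  qed
qed

lemma lie_module_iso_trans:
  assumes "lie_module_iso s V \<rho> s' V' \<rho>'" "lie_module_iso s' V' \<rho>' s'' V'' \<rho>''"
  shows "lie_module_iso s V \<rho> s'' V'' \<rho>''"
proof -
  obtain \<phi> where \<phi>: "bij_betw \<phi> V V'" "\<forall>v\<in>V. \<forall>w\<in>V. \<phi> (v + w) = \<phi> v + \<phi> w"
    "\<forall>c. \<forall>v\<in>V. \<phi> (s c v) = s' c (\<phi> v)" "\<forall>x. \<forall>v\<in>V. \<phi> (\<rho> x v) = \<rho>' x (\<phi> v)"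
    using assms(1) by (auto simp: lie_module_iso_def)
  obtain \<psi> where \<psi>: "bij_betw \<psi> V' V''" "\<forall>v\<in>V'. \<forall>w\<in>V'. \<psi> (v + w) = \<psi> v + \<psi> w"
    "\<forall>c. \<forall>v\<in>V'. \<psi> (s' c v) = s'' c (\<psi> v)" "\<forall>x. \<forall>v\<in>V'. \<psi> (\<rho>' x v) = \<rho>'' x (\<psi> v)"
    using assms(2) by (auto simp: lie_module_iso_def)
  have "v \<in> V \<Longrightarrow> \<phi> v \<in> V'" for v using \<phi>(1) by (auto simp: bij_betw_def)
  then show ?thesis
    unfolding lie_module_iso_def
    by (intro exI[of _ "\<psi> \<circ> \<phi>"]) (auto simp: \<phi>(2-4) \<psi>(2-4) intro: bij_betw_trans[OF \<phi>(1) \<psi>(1)])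
qed

lemma submodule_irreducible_of_iso:
  assumes irr: "irreducible_lie_module s' M \<sigma>" and iso: "lie_module_iso s' M \<sigma> s S \<rho>"
    and S: "lie_module s S \<rho>"
  shows "irreducible_lie_module s S \<rho>"
proof -
  interpret A: vector_space s using S by (simp add: lie_module_def)
  have M: "lie_module s' M \<sigma>" using irr by (simp add: irreducible_lie_module_def)
  interpret B: vector_space s' using M by (simp add: lie_module_def)
  have subS: "A.subspace S" using S by (simp add: lie_module_def)
  have subM: "B.subspace M" using M by (simp add: lie_module_def)
  obtain \<phi> where \<phi>: "bij_betw \<phi> M S" "\<forall>v\<in>M. \<forall>w\<in>M. \<phi> (v + w) = \<phi> v + \<phi> w"
    "\<forall>c. \<forall>v\<in>M. \<phi> (s' c v) = s c (\<phi> v)" "\<forall>x. \<forall>v\<in>M. \<phi> (\<sigma> x v) = \<rho> x (\<phi> v)"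
    using iso by (auto simp: lie_module_iso_def)
  have img: "\<phi> ` M = S" and inj: "inj_on \<phi> M" using \<phi>(1) by (auto simp: bij_betw_def)
  have \<phi>0: "\<phi> 0 = 0" using \<phi>(3) B.subspace_0[OF subM] by (metis A.scale_zero_left B.scale_zero_left)
  have "S \<noteq> {0}"
  proof
    assume "S = {0}"
    then have "v = 0" if "v \<in> M" for v
      using inj \<phi>0 that img B.subspace_0[OF subM] by (auto dest!: inj_onD[of _ _ v 0])
    then show False using irr B.subspace_0[OF subM] by (auto simp: irreducible_lie_module_def)
  qed
  moreover have "R = {0} \<or> R = S" if R: "lie_submodule s S \<rho> R" for R
  proof -
    define Q where "Q = {v\<in>M. \<phi> v \<in> R}"
    have subR: "A.subspace R" and RS: "R \<subseteq> S" and actR: "\<And>x v. v \<in> R \<Longrightarrow> \<rho> x v \<in> R"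
      using R by (auto simp: lie_submodule_def)
    have RQ: "R = \<phi> ` Q" using RS img by (auto simp: Q_def)
    have "lie_submodule s' M \<sigma> Q"
      unfolding lie_submodule_def
    proof (intro conjI allI ballI)
      show "B.subspace Q"
        using \<phi> \<phi>0 A.subspace_0[OF subR] A.subspace_add[OF subR] A.subspace_scale[OF subR]
          B.subspace_0[OF subM] B.subspace_add[OF subM] B.subspace_scale[OF subM]
        by (intro B.subspaceI) (auto simp: Q_def)
      show "Q \<subseteq> M" by (auto simp: Q_def)
      show "\<sigma> x v \<in> Q" if "v \<in> Q" for x v using that M \<phi>(4) actR by (auto simp: Q_def lie_module_def)
    qed
    then have "Q = {0} \<or> Q = M" using irr by (auto simp: irreducible_lie_module_def)
    then show ?thesis using RQ \<phi>0 img by auto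
  qed
  ultimately show ?thesis using S by (auto simp: irreducible_lie_module_def)
qed

lemma submodule_Int:
  assumes "vector_space s" "lie_submodule s V \<rho> S" "lie_submodule s V \<rho> R"
  shows "lie_submodule s S \<rho> (S \<inter> R)"
proof -
  interpret vector_space s by fact
  show ?thesis using assms(2,3) by (auto simp: lie_submodule_def intro: subspace_inter)
qed

lemma irreducible_inter:
  assumes "irreducible_lie_module s S \<rho>" "lie_submodule s V \<rho> S" "lie_submodule s V \<rho> R" "x \<in> S" "x \<in> R" "x \<noteq> 0"
  shows "S \<subseteq> R"
proof -
  have "vector_space s" using assms(1) by (simp add: irreducible_lie_module_def lie_module_def)
  from submodule_Int[OF this assms(2,3)] have "S \<inter> R = {0} \<or> S \<inter> R = S"
    using assms(1) by (auto simp: irreducible_lie_module_def)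
  then show ?thesis using assms(4-6) by blast
qed

lemma span_finite_subset:
  assumes "vector_space s" "x \<in> module.span s B"
  obtains A where "finite A" "A \<subseteq> B" "x \<in> module.span s A"
proof -
  interpret vector_space s by fact
  have "\<exists>A. finite A \<and> A \<subseteq> B \<and> x \<in> span A"
    using assms(2)
  proof (induction rule: span_induct_alt)
    case base
    show ?case by (intro exI[of _ "{}"]) simp
  next
    case (step c x y)
    then obtain A where A: "finite A" "A \<subseteq> B" "y \<in> span A" by blast
    have "y \<in> span (insert x A)" using A(3) span_mono[of A "insert x A"] by blast
    then have "s c x + y \<in> span (insert x A)" by (simp add: span_add span_scale span_base)
    then show ?case using A step(1) by (intro exI[of _ "insert x A"]) auto
  qed
  then show thesis using that by blast
qed

text \<open>Add the copies one at a time. A new copy \<open>S\<close> is either contained in the sum \<open>R\<close> of the previous ones or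
independent of it. In the second case either \<open>F\<close> lies in \<open>R\<close>, or the projection of \<open>S + R\<close> to \<open>S\<close>,
followed by an isomorphism to \<open>T\<close>, does not kill \<open>F\<close>.\<close>

lemma detecting_homomorphism:
  fixes s :: "complex \<Rightarrow> 'v::ab_group_add \<Rightarrow> 'v"
  assumes V: "lie_module s V \<rho>" and irr: "irreducible_lie_module s' M \<sigma>"
    and "finite C" and C: "\<And>S. S \<in> C \<Longrightarrow> lie_submodule s V \<rho> S \<and> lie_module_iso s' M \<sigma> s S \<rho>"
    and T: "lie_submodule s V \<rho> T" "lie_module_iso s' M \<sigma> s T \<rho>"
    and F: "F \<in> module.span s (\<Union>C)" "F \<noteq> 0"
  shows "\<exists>N f. lie_submodule s V \<rho> N \<and> F \<in> N \<and> f F \<noteq> 0 \<and> (\<forall>x\<in>N. f x \<in> T) \<and>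
    (\<forall>x\<in>N. \<forall>y\<in>N. f (x + y) = f x + f y) \<and> (\<forall>c. \<forall>x\<in>N. f (s c x) = s c (f x)) \<and>
    (\<forall>X. \<forall>x\<in>N. f (\<rho> X x) = \<rho> X (f x))"
  using assms(3) C F
proof (induction C arbitrary: F rule: finite_induct)
  case empty
  interpret vector_space s using V by (simp add: lie_module_def)
  show ?case using empty by simp
next
  case (insert S C)
  interpret vector_space s using V by (simp add: lie_module_def)
  have S: "lie_submodule s V \<rho> S" and isoS: "lie_module_iso s' M \<sigma> s S \<rho>" using insert.prems by auto
  have Smod: "lie_module s S \<rho>" by (rule submodule_lie_module[OF V S])
  have irrS: "irreducible_lie_module s S \<rho>" by (rule submodule_irreducible_of_iso[OF irr isoS Smod])
  have subS: "subspace S" and SV: "S \<subseteq> V" and actS: "\<And>X x. x \<in> S \<Longrightarrow> \<rho> X x \<in> S"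
    using S by (auto simp: lie_submodule_def)
  define R where "R = span (\<Union>C)"
  have CV: "\<Union>C \<subseteq> V" using insert.prems by (auto simp: lie_submodule_def)
  note Vsub = module_subspace[OF V]
  have RV: "R \<subseteq> V" unfolding R_def by (rule span_minimal[OF CV Vsub])
  have act: "\<rho> X (x + y) = \<rho> X x + \<rho> X y" "\<rho> X (s c x) = s c (\<rho> X x)" if "x \<in> V" "y \<in> V" for X x y c
    using V that by (auto simp: lie_module_def)
  have act0: "\<rho> X 0 = 0" for X using act(2)[of 0 0 X 0] subspace_0[OF Vsub] by simp
  have R: "lie_submodule s V \<rho> R"
    unfolding lie_submodule_def
  proof (intro conjI allI ballI)
    show "subspace R" by (simp add: R_def)
    show "R \<subseteq> V" by (rule RV)
    fix X x assume "x \<in> R"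
    then have "x \<in> V \<and> \<rho> X x \<in> R" unfolding R_def
    proof (induction rule: span_induct_alt)
      case base
      show ?case using act0 span_zero subspace_0[OF Vsub] by simp
    next
      case (step c x y)
      then obtain S' where S': "S' \<in> C" "x \<in> S'" by blast
      then have "\<rho> X x \<in> S'" using insert.prems(1)[of S'] by (simp add: lie_submodule_def)
      then have "x \<in> V" "\<rho> X x \<in> \<Union>C" using CV S' by auto
      then show ?case using step act subspace_add[OF Vsub] subspace_scale[OF Vsub]
        by (simp add: span_add span_scale span_base)
    qed
    then show "\<rho> X x \<in> R" by blast
  qed
  have subR: "subspace R" by (simp add: R_def)
  have spanS: "span S = S" using subS by (simp only: span_eq_iff)
  have spanR: "span R = R" using subR by (simp only: span_eq_iff)
  have "span (\<Union>(insert S C)) = {x + y |x y. x \<in> S \<and> y \<in> R}"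
    unfolding Union_insert span_Un R_def spanS ..
  then obtain x y where F: "F = x + y" "x \<in> S" "y \<in> R" using insert.prems(2) by auto
  show ?case
  proof (cases "S \<subseteq> R")
    case True
    then have "F \<in> R" using F subspace_add[OF subR] by blast
    then show ?thesis using insert.IH[of F] insert.prems by (simp add: R_def)
  next
    case False
    then have SR: "z = 0" if "z \<in> S" "z \<in> R" for z
      using irreducible_inter[OF irrS S R] that by blast
    show ?thesis
    proof (cases "x = 0")
      case True
      then have "F \<in> R" using F by simp
      then show ?thesis using insert.IH[of F] insert.prems by (simp add: R_def)
    next
      case xn: False
      define N where "N = {x + y |x y. x \<in> S \<and> y \<in> R}"
      \<comment> \<open>the projection of the direct sum \<open>S + R\<close> to \<open>S\<close>\<close>
      define pr where "pr z = (THE x. x \<in> S \<and> z - x \<in> R)" for z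
      have pr: "pr (x + y) = x" if "x \<in> S" "y \<in> R" for x y
        unfolding pr_def
      proof (rule the_equality)
        show "x \<in> S \<and> x + y - x \<in> R" using that by simp
        fix x' assume x': "x' \<in> S \<and> x + y - x' \<in> R"
        then have "x - x' \<in> S" using that subspace_diff[OF subS] by blast
        moreover have "(x + y - x') - y \<in> R" using x' that subspace_diff[OF subR] by blast
        then have "x - x' \<in> R" by (simp add: algebra_simps)
        ultimately show "x' = x" using SR[of "x - x'"] by simp
      qed
      obtain \<phi> where \<phi>: "bij_betw \<phi> S T" "\<forall>v\<in>S. \<forall>w\<in>S. \<phi> (v + w) = \<phi> v + \<phi> w"
        "\<forall>c. \<forall>v\<in>S. \<phi> (s c v) = s c (\<phi> v)" "\<forall>x. \<forall>v\<in>S. \<phi> (\<rho> x v) = \<rho> x (\<phi> v)"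
        using lie_module_iso_trans[OF lie_module_iso_sym[OF isoS] T(2)] irr
        by (auto simp: lie_module_iso_def irreducible_lie_module_def)
      have "N = span (S \<union> R)" unfolding span_Un spanS spanR N_def ..
      then have subN: "subspace N" by simp
      have N: "lie_submodule s V \<rho> N"
        unfolding lie_submodule_def
      proof (intro conjI allI ballI)
        show "subspace N" by fact
        show "N \<subseteq> V" using SV RV subspace_add[OF Vsub] by (auto simp: N_def)
        fix X z assume "z \<in> N"
        then obtain x y where "z = x + y" "x \<in> S" "y \<in> R" by (auto simp: N_def)
        then have "\<rho> X z = \<rho> X x + \<rho> X y" "\<rho> X x \<in> S" "\<rho> X y \<in> R"
          using act(1)[of x y X] SV RV R actS by (auto simp: lie_submodule_def)
        then show "\<rho> X z \<in> N" unfolding N_def by blast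
      qed
      have \<phi>0: "\<phi> 0 = 0" using \<phi>(3) subspace_0[OF subS] by (metis scale_zero_left)
      have "\<phi> x \<noteq> 0"
        using \<phi>(1) \<phi>0 xn F(2) subspace_0[OF subS] by (auto simp: bij_betw_def dest!: inj_onD[of _ _ x 0])
      moreover have "F \<in> N" using F by (auto simp: N_def)
      moreover have "\<phi> (pr z) \<in> T" if "z \<in> N" for z
        using that \<phi>(1) pr by (auto simp: N_def bij_betw_def)
      moreover have "\<phi> (pr (z + z')) = \<phi> (pr z) + \<phi> (pr z')" if z: "z \<in> N" "z' \<in> N" for z z'
      proof -
        obtain x y x' y' where xy: "z = x + y" "x \<in> S" "y \<in> R" "z' = x' + y'" "x' \<in> S" "y' \<in> R"
          using z by (auto simp: N_def)
        then have sum: "z + z' = (x + x') + (y + y')" by (simp add: algebra_simps)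
        have "pr (z + z') = x + x'"
          unfolding sum using xy by (intro pr subspace_add[OF subS] subspace_add[OF subR])
        then show ?thesis using xy pr \<phi>(2) by simp
      qed
      moreover have "\<phi> (pr (s c z)) = s c (\<phi> (pr z))" if z: "z \<in> N" for z c
      proof -
        obtain x y where xy: "z = x + y" "x \<in> S" "y \<in> R" using z by (auto simp: N_def)
        then show ?thesis using pr[of "s c x" "s c y"] pr \<phi>(3) subspace_scale[OF subS] subspace_scale[OF subR]
          by (simp add: scale_right_distrib)
      qed
      moreover have "\<phi> (pr (\<rho> X z)) = \<rho> X (\<phi> (pr z))" if z: "z \<in> N" for z X
      proof -
        obtain x y where xy: "z = x + y" "x \<in> S" "y \<in> R" using z by (auto simp: N_def)
        then have "\<rho> X y \<in> R" "\<rho> X x \<in> S" using R actS by (auto simp: lie_submodule_def)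
        then have "pr (\<rho> X x + \<rho> X y) = \<rho> X x" by (intro pr)
        moreover have "\<rho> X (x + y) = \<rho> X x + \<rho> X y" using xy SV RV by (intro act) auto
        ultimately show ?thesis using xy pr \<phi>(4) by simp
      qed
      ultimately show ?thesis
        using N F pr by (intro exI[of _ N] exI[of _ "\<phi> \<circ> pr"]) auto
    qed
  qed
qed

text \<open>An equivariant endomorphism maps an irreducible submodule to \<open>0\<close> or isomorphically to its image.\<close>

lemma isotypic_stable:
  fixes s :: "complex \<Rightarrow> 'v::ab_group_add \<Rightarrow> 'v"
  assumes V: "lie_module s V \<rho>" and irr: "irreducible_lie_module s' M \<sigma>"
    and f: "\<And>x. x \<in> V \<Longrightarrow> f x \<in> V" "\<And>x y. x \<in> V \<Longrightarrow> y \<in> V \<Longrightarrow> f (x + y) = f x + f y"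
    "\<And>c x. x \<in> V \<Longrightarrow> f (s c x) = s c (f x)" "\<And>X x. x \<in> V \<Longrightarrow> f (\<rho> X x) = \<rho> X (f x)"
    and F: "F \<in> isotypic_component s V \<rho> s' M \<sigma>"
  shows "F \<in> V \<and> f F \<in> isotypic_component s V \<rho> s' M \<sigma>"
proof -
  interpret vector_space s using V by (simp add: lie_module_def)
  let ?I = "isotypic_component s V \<rho> s' M \<sigma>"
  note Vsub = module_subspace[OF V]
  have f0: "f 0 = 0" using f(3)[of 0 0] subspace_0[OF Vsub] by simp
  have copy: "x \<in> V \<and> f x \<in> ?I" if S: "lie_submodule s V \<rho> S" "lie_module_iso s' M \<sigma> s S \<rho>" and x: "x \<in> S" for S x
  proof -
    have Smod: "lie_module s S \<rho>" by (rule submodule_lie_module[OF V S(1)])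
    have irrS: "irreducible_lie_module s S \<rho>" by (rule submodule_irreducible_of_iso[OF irr S(2) Smod])
    have subS: "subspace S" and SV: "S \<subseteq> V" and actS: "\<And>X x. x \<in> S \<Longrightarrow> \<rho> X x \<in> S"
      using S by (auto simp: lie_submodule_def)
    have \<rho>0: "\<rho> X 0 = 0" for X
    proof -
      have "\<rho> X (s 0 0) = s 0 (\<rho> X 0)" using V subspace_0[OF Vsub] unfolding lie_module_def by blast
      then show ?thesis by simp
    qed
    have "lie_submodule s S \<rho> {x\<in>S. f x = 0}"
      unfolding lie_submodule_def
    proof (intro conjI allI ballI)
      show "subspace {x\<in>S. f x = 0}"
      proof (rule subspaceI)
        show "0 \<in> {x\<in>S. f x = 0}" using f0 subspace_0[OF subS] by simp
        fix u v c assume u: "u \<in> {x\<in>S. f x = 0}"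
        then show "s c u \<in> {x\<in>S. f x = 0}" using f(3)[of u c] SV subspace_scale[OF subS] by auto
        assume "v \<in> {x\<in>S. f x = 0}"
        then show "u + v \<in> {x\<in>S. f x = 0}" using u f(2)[of u v] SV subspace_add[OF subS] by auto
      qed
      fix X u assume "u \<in> {x\<in>S. f x = 0}"
      then show "\<rho> X u \<in> {x\<in>S. f x = 0}" using f(4)[of u X] SV actS \<rho>0 by auto
    qed auto
    then consider "{x\<in>S. f x = 0} = {0}" | "{x\<in>S. f x = 0} = S"
      using irrS by (auto simp: irreducible_lie_module_def)
    then have "f x \<in> ?I"
    proof cases
      case 1
      have inj: "inj_on f S"
      proof (rule inj_onI)
        fix x y assume xy: "x \<in> S" "y \<in> S" "f x = f y"
        then have d: "x - y \<in> S" using subspace_diff[OF subS] by blast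
        have "f ((x - y) + y) = f (x - y) + f y" using d xy SV by (intro f(2)) auto
        then have "f (x - y) = 0" using xy(3) by simp
        with d have "x - y \<in> {x\<in>S. f x = 0}" by simp
        then show "x = y" unfolding 1 by simp
      qed
      have "lie_submodule s V \<rho> (f ` S)"
        unfolding lie_submodule_def
      proof (intro conjI allI ballI)
        show "subspace (f ` S)"
        proof (rule subspaceI)
          show "0 \<in> f ` S" using f0 subspace_0[OF subS] by force
          fix u v c assume "u \<in> f ` S"
          then obtain u' where u': "u = f u'" "u' \<in> S" by blast
          show "s c u \<in> f ` S"
            using u' f(3)[of u' c] SV subspace_scale[OF subS] by (intro image_eqI[of _ _ "s c u'"]) auto
          assume "v \<in> f ` S"
          then obtain v' where v': "v = f v'" "v' \<in> S" by blast
          have "f (u' + v') = f u' + f v'" using u' v' SV by (intro f(2)) auto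
          then show "u + v \<in> f ` S"
            using u' v' subspace_add[OF subS] by (intro image_eqI[of _ _ "u' + v'"]) auto
        qed
        show "f ` S \<subseteq> V" using f(1) SV by auto
        fix X u assume "u \<in> f ` S"
        then obtain u' where u': "u = f u'" "u' \<in> S" by blast
        then show "\<rho> X u \<in> f ` S"
          using f(4)[of u' X] SV actS by (intro image_eqI[of _ _ "\<rho> X u'"]) auto
      qed
      moreover have "lie_module_iso s S \<rho> s (f ` S) \<rho>"
        unfolding lie_module_iso_def using inj f SV
        by (intro exI[of _ f]) (auto simp: bij_betw_def subset_iff)
      then have "lie_module_iso s' M \<sigma> s (f ` S) \<rho>" by (rule lie_module_iso_trans[OF S(2)])
      ultimately show ?thesis
        unfolding isotypic_component_def using x by (intro span_base) blast
    next
      case 2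
      then have "f x = 0" using x by blast
      then show ?thesis by (simp add: isotypic_component_def span_zero)
    qed
    then show ?thesis using x SV by blast
  qed
  show ?thesis using F unfolding isotypic_component_def
  proof (induction rule: span_induct_alt)
    case base
    show ?case using f0 span_zero subspace_0[OF Vsub] by simp
  next
    case (step c x y)
    then have "x \<in> V \<and> f x \<in> ?I" using copy by blast
    then show ?case using step f subspace_add[OF Vsub] subspace_scale[OF Vsub]
      by (simp add: isotypic_component_def span_add span_scale)
  qed
qed

context evaluation_module
begin

interpretation F: vector_space fun_scale by (rule vector_space_fun_scale)

lemmas Gmod = lie_module_eval_gl[of s V \<rho> a, OF mods nz]

lemma trace_alg_equivariant:
  assumes "x \<in> trace_alg" "F \<in> W"
  shows "act x (G X F) = G X (act x F)"
proof -
  have "act x (G X F) = act (x * uea_gen (gl_tensor X 1)) F"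
    using assms by (simp add: act_lin uea_act_gen[OF Lmod] eval_act_gl_def)
  also have "\<dots> = act (uea_gen (gl_tensor X 1) * x) F"
    by (simp add: trace_alg_commutes_gl[OF assms(1)])
  also have "\<dots> = G X (act x F)"
    using assms by (simp add: act_lin uea_act_gen[OF Lmod] eval_act_gl_def act_in)
  finally show ?thesis .
qed

text \<open>Let \<open>F\<close> be a nonzero element of a submodule \<open>S\<close>. For each copy of \<open>M\<close> there is a homomorphism to it
that does not kill \<open>F\<close>, and it is the action of an element of the trace algebra. So \<open>S\<close> contains a
nonzero vector of each copy.\<close>

theorem isotypic_TU_irreducible:
  fixes s' :: "complex \<Rightarrow> 'w::ab_group_add \<Rightarrow> 'w"
  assumes M: "irreducible_lie_module s' M \<sigma>"
    and nonzero: "eval_isotypic s V \<rho> a s' M \<sigma> \<noteq> {0}"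
  shows "TU_irreducible s V \<rho> a (eval_isotypic s V \<rho> a s' M \<sigma>)"
proof -
  let ?I = "eval_isotypic s V \<rho> a s' M \<sigma>"
  let ?copies = "{S. lie_submodule fun_scale W G S \<and> lie_module_iso s' M \<sigma> fun_scale S G}"
  have I: "?I = F.span (\<Union>?copies)" by (simp add: eval_isotypic_def isotypic_component_def)
  have subI: "F.subspace ?I" by (simp add: I)
  have IW: "?I \<subseteq> W"
    unfolding I by (rule F.span_minimal[OF _ W_sub]) (auto simp: lie_submodule_def)
  have G_lin: "G X (fun_scale c x + y) = fun_scale c (G X x) + G X y" for X c x y
    by (simp only: eval_act_gl_def eval_act_add[of s V \<rho> a, OF mods nz] eval_act_scale[of s V \<rho> a, OF mods nz])
  have G_stable: "lie_submodule fun_scale W G ?I"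
    unfolding lie_submodule_def
  proof (intro conjI allI ballI)
    show "F.subspace ?I" "?I \<subseteq> W" by fact+
    fix X F assume "F \<in> ?I"
    then show "G X F \<in> ?I" unfolding I
    proof (induction rule: F.span_induct_alt)
      case base
      have "G X 0 = 0" by (simp only: eval_act_gl_def eval_act_zero[of s V \<rho> a, OF mods nz])
      then show ?case by (simp only: F.span_zero)
    next
      case (step c x y)
      then have "G X x \<in> \<Union>?copies" by (auto simp: lie_submodule_def)
      from F.span_add[OF F.span_scale[OF F.span_base[OF this]] step(2)]
      have "fun_scale c (G X x) + G X y \<in> F.span (\<Union>?copies)" .
      then show ?case
        unfolding G_lin .
    qed
  qed
  have "TU_submodule s V \<rho> a ?I"
    unfolding TU_submodule_def
  proof (intro conjI ballI allI)
    show "F.subspace ?I" "?I \<subseteq> W" by fact+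
    fix x u F assume x: "x \<in> (trace_alg :: (laurent, 'n) gl uea set)" and F: "F \<in> ?I"
    have "uea_act fun_scale G u F \<in> ?I" by (rule submodule_uea_act[OF Gmod G_stable F])
    then show "act x (uea_act fun_scale G u F) \<in> ?I"
      unfolding eval_isotypic_def
      using isotypic_stable[OF Gmod M, of "act x"] act_in act_lin(1,2) trace_alg_equivariant[OF x]
      by blast
  qed
  moreover have "S = {0} \<or> S = ?I" if S: "TU_submodule s V \<rho> a S" "S \<subseteq> ?I" for S
  proof (cases "S = {0}")
    case False
    have subS: "F.subspace S" and SW: "S \<subseteq> W"
      and TU: "\<And>x u F. x \<in> trace_alg \<Longrightarrow> F \<in> S \<Longrightarrow> act x (uea_act fun_scale G u F) \<in> S"
      using S by (auto simp: TU_submodule_def)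
    have T_stable: "act x F \<in> S" if "x \<in> trace_alg" "F \<in> S" for x F
      using TU[OF that, of 1] uea_act_one[OF Gmod] that SW by (metis subsetD)
    have "lie_submodule fun_scale W G S"
      unfolding lie_submodule_def
    proof (intro conjI allI ballI)
      fix X F assume F: "F \<in> S"
      then have "F \<in> W" using SW by blast
      then have "act 1 (uea_act fun_scale G (uea_gen X) F) = G X F"
        using act_lin(7)[of "G X F"] Gmod by (simp add: uea_act_gen[OF Gmod] act_lin lie_module_def)
      then show "G X F \<in> S" using TU[OF trace_alg_one F, of "uea_gen X"] by simp
    qed fact+
    note S_sub = this
    obtain F where F: "F \<in> S" "F \<noteq> 0" using False F.subspace_0[OF subS] by auto
    have "F \<in> F.span (\<Union>?copies)" using F(1) S(2) I by blast
    then obtain A where A: "finite A" "A \<subseteq> \<Union>?copies" and FA: "F \<in> F.span A"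
      by (rule span_finite_subset[OF vector_space_fun_scale])
    obtain C where C: "finite C" "C \<subseteq> ?copies" "A \<subseteq> \<Union>C"
      by (rule finite_subset_Union[OF A])
    have FC: "F \<in> F.span (\<Union>C)" using FA F.span_mono[OF C(3)] by blast
    have "T \<subseteq> S" if T: "T \<in> ?copies" for T
    proof -
      have "\<exists>N f. lie_submodule fun_scale W G N \<and> F \<in> N \<and> f F \<noteq> 0 \<and> (\<forall>x\<in>N. f x \<in> T) \<and>
        (\<forall>x\<in>N. \<forall>y\<in>N. f (x + y) = f x + f y) \<and> (\<forall>c. \<forall>x\<in>N. f (fun_scale c x) = fun_scale c (f x)) \<and>
        (\<forall>X. \<forall>x\<in>N. f (G X x) = G X (f x))"
        by (rule detecting_homomorphism[OF Gmod M C(1)]) (use C(2) T FC F(2) in auto)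
      then obtain N f where N: "lie_submodule fun_scale W G N" "F \<in> N" "f F \<noteq> 0" "\<forall>x\<in>N. f x \<in> T"
        and f: "\<forall>x\<in>N. \<forall>y\<in>N. f (x + y) = f x + f y" "\<forall>c. \<forall>x\<in>N. f (fun_scale c x) = fun_scale c (f x)"
          "\<forall>X. \<forall>x\<in>N. f (G X x) = G X (f x)" by blast
      have TW: "lie_submodule fun_scale W G T" and isoT: "lie_module_iso s' M \<sigma> fun_scale T G" using T by auto
      have "T \<subseteq> W" using TW by (simp add: lie_submodule_def)
      then obtain x where x: "x \<in> trace_alg" "\<forall>F\<in>N. act x F = f F"
        using equivariant_map_from_trace_alg[OF N(1), of f] N(4) f by blast
      then have "f F \<in> S" using T_stable[OF x(1) F(1)] N(2) by simp
      moreover have "irreducible_lie_module fun_scale T G"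
        by (rule submodule_irreducible_of_iso[OF M isoT submodule_lie_module[OF Gmod TW]])
      ultimately show ?thesis
        using irreducible_inter[OF _ TW S_sub, of "f F"] N by blast
    qed
    then have "?I \<subseteq> S" unfolding I by (intro F.span_minimal[OF _ subS]) blast
    then show ?thesis using S(2) by blast
  qed simp
  ultimately show ?thesis using nonzero by (simp add: TU_irreducible_def)
qed

end

theorem theorem4p8:
  fixes s :: "complex \<Rightarrow> 'v::ab_group_add \<Rightarrow> 'v"
    and V :: "'m::finite \<Rightarrow> 'v set"
    and \<rho> :: "'m \<Rightarrow> (complex, 'n::{finite,linorder}) gl \<Rightarrow> 'v \<Rightarrow> 'v"
    and lam :: "'m \<Rightarrow> 'n \<Rightarrow> complex"
    and a :: "'m \<Rightarrow> complex"
    and s' :: "complex \<Rightarrow> 'w::ab_group_add \<Rightarrow> 'w"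
    and M :: "'w set"
    and \<sigma> :: "(complex, 'n) gl \<Rightarrow> 'w \<Rightarrow> 'w"
    and mu :: "'n \<Rightarrow> complex"
  assumes "\<forall>i. dominant_integral (lam i)"
    and "\<forall>i. is_highest_weight_irrep s (V i) (\<rho> i) (lam i)"
    and "inj a"
    and "\<forall>i. a i \<noteq> 0"
    and "dominant_integral mu"
    and "is_highest_weight_irrep s' M \<sigma> mu"
    and "eval_isotypic s V \<rho> a s' M \<sigma> \<noteq> {0}"
  shows "TU_irreducible s V \<rho> a (eval_isotypic s V \<rho> a s' M \<sigma>)"
proof -
  interpret evaluation_module s V \<rho> a
    using assms(2-4) by unfold_locales (auto simp: is_highest_weight_irrep_def)
  show ?thesis
    using assms(6,7) by (intro isotypic_TU_irreducible) (auto simp: is_highest_weight_irrep_def)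
qed

end
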